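(* Let $R$ be a commutative Noetherian local domain of Krull dimension one and let $M$ be a nonzero finitely generated $R$-module that is two-periodic, i.e., $M \cong \Omega_R^2 M$. Then $M\otimes_R M^{\ast}$ has torsion, i.e., its torsion submodule is nonzero, where $M^{\ast}=\operatorname{Hom}_R(M,R)$.
   Context: For a finitely generated module $M$ over a Noetherian local ring $R$ and $n\ge 1$, $\Omega_R^n M$ denotes the $n$th syzygy of $M$, i.e., the image of the $n$th differential in a minimal free resolution of $M$. *)

theory Defs
  imports "HOL-Algebra.Module" "HOL-Algebra.Ring_Divisibility" "HOL-Library.Extended_Nat"
begin

text \<open>
  Modules are records of HOL-Algebra, which inherit the fields \<open>mult\<close> and \<open>one\<close> of rings.
  The locale \<open>module\<close> ignores these two fields, and so they are \<open>undefined\<close> below.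
\<close>

section \<open>Local rings and Krull dimension\<close>

locale local_ring = cring +
  assumes unique_maximal: "\<exists>!\<mm>. maximalideal \<mm> R"

definition max_ideal :: "('a, 'r) ring_scheme \<Rightarrow> 'a set" where
  "max_ideal R = (THE \<mm>. maximalideal \<mm> R)"

definition prime_chain :: "('a, 'r) ring_scheme \<Rightarrow> nat \<Rightarrow> (nat \<Rightarrow> 'a set) \<Rightarrow> bool" where
  "prime_chain R n \<pp> \<longleftrightarrow> (\<forall>i\<le>n. primeideal (\<pp> i) R) \<and> (\<forall>i<n. \<pp> i \<subset> \<pp> (Suc i))"

definition krull_dim :: "('a, 'r) ring_scheme \<Rightarrow> enat" where
  "krull_dim R = Sup {enat n | n. \<exists>\<pp>. prime_chain R n \<pp>}"


section \<open>Modules and their homomorphisms\<close>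

definition module_span ::
  "('a, 'r) ring_scheme \<Rightarrow> ('a, 'b, 'm) module_scheme \<Rightarrow> 'b set \<Rightarrow> 'b set" where
  "module_span R M S = \<Inter>{H. submodule H R M \<and> S \<subseteq> H}"

definition finitely_generated_module ::
  "('a, 'r) ring_scheme \<Rightarrow> ('a, 'b, 'm) module_scheme \<Rightarrow> bool" where
  "finitely_generated_module R M \<longleftrightarrow>
     (\<exists>S. finite S \<and> S \<subseteq> carrier M \<and> module_span R M S = carrier M)"

definition module_hom ::
  "('a, 'r) ring_scheme \<Rightarrow> ('a, 'b, 'm) module_scheme \<Rightarrow> ('a, 'c, 'n) module_scheme \<Rightarrow> ('b \<Rightarrow> 'c) set" where
  "module_hom R M N = {h \<in> carrier M \<rightarrow> carrier N.
     (\<forall>x \<in> carrier M. \<forall>y \<in> carrier M. h (x \<oplus>\<^bsub>M\<^esub> y) = h x \<oplus>\<^bsub>N\<^esub> h y) \<and>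
     (\<forall>a \<in> carrier R. \<forall>x \<in> carrier M. h (a \<odot>\<^bsub>M\<^esub> x) = a \<odot>\<^bsub>N\<^esub> h x)}"

definition modules_isomorphic ::
  "('a, 'r) ring_scheme \<Rightarrow> ('a, 'b, 'm) module_scheme \<Rightarrow> ('a, 'c, 'n) module_scheme \<Rightarrow> bool" where
  "modules_isomorphic R M N \<longleftrightarrow> (\<exists>h \<in> module_hom R M N. bij_betw h (carrier M) (carrier N))"

text \<open>Elements are made extensional, so that equality in the carrier is equality of maps on \<open>M\<close>.\<close>

definition hom_module ::
  "('a, 'r) ring_scheme \<Rightarrow> ('a, 'b, 'm) module_scheme \<Rightarrow> ('a, 'c, 'n) module_scheme
     \<Rightarrow> ('a, 'b \<Rightarrow> 'c) module" where
  "hom_module R M N =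
     \<lparr>carrier = module_hom R M N \<inter> extensional (carrier M),
      monoid.mult = undefined, one = undefined,
      ring.zero = (\<lambda>x \<in> carrier M. \<zero>\<^bsub>N\<^esub>),
      ring.add = (\<lambda>f g. \<lambda>x \<in> carrier M. f x \<oplus>\<^bsub>N\<^esub> g x),
      smult = (\<lambda>a f. \<lambda>x \<in> carrier M. a \<odot>\<^bsub>N\<^esub> f x)\<rparr>"

definition regular_module :: "('a, 'r) ring_scheme \<Rightarrow> ('a, 'a) module" where
  "regular_module R =
     \<lparr>carrier = carrier R, monoid.mult = undefined, one = undefined,
      ring.zero = \<zero>\<^bsub>R\<^esub>, ring.add = ring.add R, smult = monoid.mult R\<rparr>"

definition dual_module ::
  "('a, 'r) ring_scheme \<Rightarrow> ('a, 'b, 'm) module_scheme \<Rightarrow> ('a, 'b \<Rightarrow> 'a) module" where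
  "dual_module R M = hom_module R M (regular_module R)"

text \<open>For \<open>R\<close> a domain; over other rings \<open>r\<close> would have to range over the regular elements.\<close>

definition torsion_submodule ::
  "('a, 'r) ring_scheme \<Rightarrow> ('a, 'b, 'm) module_scheme \<Rightarrow> 'b set" where
  "torsion_submodule R M =
     {x \<in> carrier M. \<exists>r \<in> carrier R - {\<zero>\<^bsub>R\<^esub>}. r \<odot>\<^bsub>M\<^esub> x = \<zero>\<^bsub>M\<^esub>}"


section \<open>Tensor products\<close>

text \<open>The free module on \<open>X\<close>: finitely supported functions, vanishing outside \<open>X\<close>.\<close>

definition free_module :: "('a, 'r) ring_scheme \<Rightarrow> 'x set \<Rightarrow> ('a, 'x \<Rightarrow> 'a) module" where
  "free_module R X =
     \<lparr>carrier = {f. (\<forall>x. f x \<in> carrier R) \<and> finite {x. f x \<noteq> \<zero>\<^bsub>R\<^esub>} \<and> (\<forall>x. x \<notin> X \<longrightarrow> f x = \<zero>\<^bsub>R\<^esub>)},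
      monoid.mult = undefined, one = undefined,
      ring.zero = (\<lambda>x. \<zero>\<^bsub>R\<^esub>),
      ring.add = (\<lambda>f g x. f x \<oplus>\<^bsub>R\<^esub> g x),
      smult = (\<lambda>a f x. a \<otimes>\<^bsub>R\<^esub> f x)\<rparr>"

definition free_gen :: "('a, 'r) ring_scheme \<Rightarrow> 'x \<Rightarrow> 'x \<Rightarrow> 'a" where
  "free_gen R x = (\<lambda>y. if y = x then \<one>\<^bsub>R\<^esub> else \<zero>\<^bsub>R\<^esub>)"

text \<open>The union in \<open>smult\<close> is over equal cosets: \<open>a (N + x) = N + a x\<close>.\<close>

definition quotient_module :: "('a, 'b, 'm) module_scheme \<Rightarrow> 'b set \<Rightarrow> ('a, 'b set) module" where
  "quotient_module M N =
     \<lparr>carrier = a_rcosets\<^bsub>M\<^esub> N, monoid.mult = undefined, one = undefined,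
      ring.zero = N,
      ring.add = (\<lambda>X Y. X <+>\<^bsub>M\<^esub> Y),
      smult = (\<lambda>a X. \<Union>x\<in>X. N +>\<^bsub>M\<^esub> (a \<odot>\<^bsub>M\<^esub> x))\<rparr>"

definition tensor_relations ::
  "('a, 'r) ring_scheme \<Rightarrow> ('a, 'b, 'm) module_scheme \<Rightarrow> ('a, 'c, 'n) module_scheme
     \<Rightarrow> ('b \<times> 'c \<Rightarrow> 'a) set" where
  "tensor_relations R M N =
     (let F = free_module R (carrier M \<times> carrier N); \<delta> = free_gen R in
       {\<delta> (x \<oplus>\<^bsub>M\<^esub> x', y) \<ominus>\<^bsub>F\<^esub> (\<delta> (x, y) \<oplus>\<^bsub>F\<^esub> \<delta> (x', y)) | x x' y.
          x \<in> carrier M \<and> x' \<in> carrier M \<and> y \<in> carrier N} \<union>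
       {\<delta> (x, y \<oplus>\<^bsub>N\<^esub> y') \<ominus>\<^bsub>F\<^esub> (\<delta> (x, y) \<oplus>\<^bsub>F\<^esub> \<delta> (x, y')) | x y y'.
          x \<in> carrier M \<and> y \<in> carrier N \<and> y' \<in> carrier N} \<union>
       {\<delta> (a \<odot>\<^bsub>M\<^esub> x, y) \<ominus>\<^bsub>F\<^esub> a \<odot>\<^bsub>F\<^esub> \<delta> (x, y) | a x y.
          a \<in> carrier R \<and> x \<in> carrier M \<and> y \<in> carrier N} \<union>
       {\<delta> (x, a \<odot>\<^bsub>N\<^esub> y) \<ominus>\<^bsub>F\<^esub> a \<odot>\<^bsub>F\<^esub> \<delta> (x, y) | a x y.
          a \<in> carrier R \<and> x \<in> carrier M \<and> y \<in> carrier N})"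

definition tensor_module ::
  "('a, 'r) ring_scheme \<Rightarrow> ('a, 'b, 'm) module_scheme \<Rightarrow> ('a, 'c, 'n) module_scheme
     \<Rightarrow> ('a, ('b \<times> 'c \<Rightarrow> 'a) set) module" where
  "tensor_module R M N =
     (let F = free_module R (carrier M \<times> carrier N)
      in quotient_module F (module_span R F (tensor_relations R M N)))"


section \<open>Minimal free resolutions and syzygies\<close>

definition finite_free_module ::
  "('a, 'r) ring_scheme \<Rightarrow> ('a, 'b, 'm) module_scheme \<Rightarrow> bool" where
  "finite_free_module R F \<longleftrightarrow>
     module R F \<and> (\<exists>n::nat. modules_isomorphic R (free_module R {..<n}) F)"

definition ideal_smult ::
  "('a, 'r) ring_scheme \<Rightarrow> 'a set \<Rightarrow> ('a, 'b, 'm) module_scheme \<Rightarrow> 'b set" where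
  "ideal_smult R I M = module_span R M {a \<odot>\<^bsub>M\<^esub> x | a x. a \<in> I \<and> x \<in> carrier M}"

text \<open>
  A minimal free resolution \<open>\<cdots> \<rightarrow> F 2 \<rightarrow> F 1 \<rightarrow> F 0 \<rightarrow> M \<rightarrow> 0\<close> over a local ring \<open>R\<close>. The differential
  \<open>d n\<close> goes from \<open>F n\<close> to \<open>F (n - 1)\<close>, for \<open>n \<ge> 1\<close>; the value \<open>d 0\<close> is unused, and the
  augmentation is \<open>\<epsilon>\<close>. Minimality is \<open>d n (F n) \<subseteq> \<mm> F (n - 1)\<close>.
\<close>

definition minimal_free_resolution ::
  "('a, 'r) ring_scheme \<Rightarrow> ('a, 'b, 'm) module_scheme \<Rightarrow> (nat \<Rightarrow> ('a, 'c) module)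
     \<Rightarrow> (nat \<Rightarrow> 'c \<Rightarrow> 'c) \<Rightarrow> ('c \<Rightarrow> 'b) \<Rightarrow> bool" where
  "minimal_free_resolution R M F d \<epsilon> \<longleftrightarrow>
     (\<forall>n. finite_free_module R (F n)) \<and>
     \<epsilon> \<in> module_hom R (F 0) M \<and>
     (\<forall>n. d (Suc n) \<in> module_hom R (F (Suc n)) (F n)) \<and>
     \<epsilon> ` carrier (F 0) = carrier M \<and>
     d 1 ` carrier (F 1) = {x \<in> carrier (F 0). \<epsilon> x = \<zero>\<^bsub>M\<^esub>} \<and>
     (\<forall>n. d (Suc (Suc n)) ` carrier (F (Suc (Suc n))) =
            {x \<in> carrier (F (Suc n)). d (Suc n) x = \<zero>\<^bsub>F n\<^esub>}) \<and>
     (\<forall>n. d (Suc n) ` carrier (F (Suc n)) \<subseteq> ideal_smult R (max_ideal R) (F n))"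

text \<open>
  The \<open>n\<close>th syzygy (\<open>n \<ge> 1\<close>) is determined by \<open>M\<close> up to isomorphism only, hence the predicate:
  \<open>\<Omega>\<close> is the image of the \<open>n\<close>th differential in some minimal free resolution of \<open>M\<close>.
\<close>

definition is_syzygy ::
  "('a, 'r) ring_scheme \<Rightarrow> nat \<Rightarrow> ('a, 'b, 'm) module_scheme \<Rightarrow> ('a, 'c) module \<Rightarrow> bool" where
  "is_syzygy R n M \<Omega> \<longleftrightarrow>
     n \<ge> 1 \<and>
     (\<exists>F d \<epsilon>. minimal_free_resolution R M F d \<epsilon> \<and>
        \<Omega> = (F (n - 1))\<lparr>carrier := d n ` carrier (F n)\<rparr>)"

end

theory Submission
  imports Defs
begin

text \<open>
  Composing a minimal free resolution with the isomorphism of \<open>M\<close> with its second syzygy gives matrices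
  \<open>A : R\<^sup>q \<rightarrow> R\<^sup>p\<close> and \<open>B : R\<^sup>p \<rightarrow> R\<^sup>q\<close> with entries in the maximal ideal such that \<open>ker A = im B\<close>,
  \<open>ker B = im A\<close> and \<open>M\<close> is the cokernel of \<open>A\<close>. Reducing modulo a nonzero \<open>x\<close> keeps the pair exact,
  and counting lengths over \<open>R / x\<close> gives \<open>p = q\<close>.

  Up to isomorphism, \<open>M \<otimes> M\<^sup>*\<close> is the module \<open>{Y. Y A = 0} / {A Z | Z. Z A = 0}\<close> of matrices, and all \<open>Y = A W\<close> with
  \<open>A W A = 0\<close> represent torsion elements. So if there is no torsion, then \<open>A W A = 0\<close> implies
  \<open>A W = A Z\<close> for some \<open>Z\<close> with \<open>Z A = 0\<close>. This says that a certain Tate homology module vanishes; a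
  second count of lengths (a Herbrand quotient) makes the neighbouring one vanish as well, which
  yields \<open>1 = A V + Z\<close> with \<open>Z A = 0\<close>, so that \<open>A = A V A\<close>. By Nakayama \<open>A = 0\<close>, hence \<open>B\<close> is onto, which
  contradicts minimality.
\<close>

section \<open>Homomorphisms of modules\<close>

text \<open>Let \<open>K\<close> be \<open>R^n\<close> modulo the row vectors killed by
  \<open>A\<close>. The sequence from \<open>M^*\<close> through \<open>R^n\<close> to
  \<open>K\<close> embeds \<open>Tor_1(M, K)\<close> into the tensor product of \<open>M\<close> and
  \<open>M^*\<close> as torsion. As \<open>A\<close> and \<open>B\<close> alternate in a resolution
  of \<open>M\<close>, left multiplication by them on matrices with rows in \<open>K\<close>
  computes \<open>Tor_1(M, K)\<close> at one place and \<open>Tor_2(M, K)\<close> at the other. The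
  obstacle is that \<open>K\<close> need not have finite length, so lengths cannot be compared
  directly. But \<open>K\<close> contains a free submodule of full rank, on which the pair is exact,
  and the cokernel is killed by some nonzero \<open>x\<close>. Passing to the cokernel leaves the
  homology unchanged, and dimension one enters by making \<open>R / x\<close> of finite length. The
  identity matrix is a cycle for \<open>B\<close> modulo \<open>{Z. Z A = 0}\<close>, because
  \<open>B A = 0\<close>; that it is a boundary is precisely the equation
  \<open>1 = A V + Z\<close>. Having \<open>p = q\<close> is what puts \<open>A\<close>,
  \<open>B\<close>, \<open>W\<close> and \<open>1\<close> into one ring of square matrices. Lengths
  are counted by chains between two submodules of a fixed module, so that no quotient has to be
  formed for the counting.\<close>

lemma module_homD:
  assumes "h \<in> module_hom R M N"
  shows "x \<in> carrier M \<Longrightarrow> h x \<in> carrier N"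
    and "x \<in> carrier M \<Longrightarrow> y \<in> carrier M \<Longrightarrow> h (x \<oplus>\<^bsub>M\<^esub> y) = h x \<oplus>\<^bsub>N\<^esub> h y"
    and "a \<in> carrier R \<Longrightarrow> x \<in> carrier M \<Longrightarrow> h (a \<odot>\<^bsub>M\<^esub> x) = a \<odot>\<^bsub>N\<^esub> h x"
  using assms by (auto simp: module_hom_def)

lemma module_homI:
  assumes "\<And>x. x \<in> carrier M \<Longrightarrow> h x \<in> carrier N"
    and "\<And>x y. x \<in> carrier M \<Longrightarrow> y \<in> carrier M \<Longrightarrow> h (x \<oplus>\<^bsub>M\<^esub> y) = h x \<oplus>\<^bsub>N\<^esub> h y"
    and "\<And>a x. a \<in> carrier R \<Longrightarrow> x \<in> carrier M \<Longrightarrow> h (a \<odot>\<^bsub>M\<^esub> x) = a \<odot>\<^bsub>N\<^esub> h x"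
  shows "h \<in> module_hom R M N"
  using assms by (auto simp: module_hom_def)

lemma module_hom_zero:
  assumes "module R M" "module R N" "h \<in> module_hom R M N"
  shows "h \<zero>\<^bsub>M\<^esub> = \<zero>\<^bsub>N\<^esub>"
proof -
  interpret M: module R M by fact
  interpret N: module R N by fact
  have "h (\<zero>\<^bsub>R\<^esub> \<odot>\<^bsub>M\<^esub> \<zero>\<^bsub>M\<^esub>) = \<zero>\<^bsub>R\<^esub> \<odot>\<^bsub>N\<^esub> h \<zero>\<^bsub>M\<^esub>"
    by (intro module_homD[OF assms(3)]) auto
  then show ?thesis using module_homD(1)[OF assms(3)] by simp
qed

lemma module_hom_neg:
  assumes "module R M" "module R N" "h \<in> module_hom R M N" "x \<in> carrier M"
  shows "h (\<ominus>\<^bsub>M\<^esub> x) = \<ominus>\<^bsub>N\<^esub> h x"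
proof -
  interpret M: module R M by fact
  interpret N: module R N by fact
  have "h x \<oplus>\<^bsub>N\<^esub> h (\<ominus>\<^bsub>M\<^esub> x) = h (x \<oplus>\<^bsub>M\<^esub> \<ominus>\<^bsub>M\<^esub> x)"
    using module_homD(2)[OF assms(3)] assms(4) by simp
  also have "\<dots> = \<zero>\<^bsub>N\<^esub>"
    using module_hom_zero[OF assms(1-3)] assms(4) by (simp add: M.r_neg)
  finally show ?thesis
    using module_homD(1)[OF assms(3)] assms(4) by (metis N.minus_equality N.a_comm M.a_inv_closed)
qed

lemma module_hom_minus:
  assumes "module R M" "module R N" "h \<in> module_hom R M N" "x \<in> carrier M" "y \<in> carrier M"
  shows "h (x \<ominus>\<^bsub>M\<^esub> y) = h x \<ominus>\<^bsub>N\<^esub> h y"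
proof -
  interpret M: module R M by fact
  show ?thesis
    using module_hom_neg[OF assms(1-3)] module_homD(2)[OF assms(3)] assms(4,5)
    by (simp add: a_minus_def)
qed

lemma module_hom_comp:
  assumes "f \<in> module_hom R M N" "g \<in> module_hom R N K"
  shows "(\<lambda>x. g (f x)) \<in> module_hom R M K"
  using assms by (auto simp: module_hom_def Pi_iff)

lemma module_hom_finsum:
  assumes "module R M" "module R N" "h \<in> module_hom R M N"
    and "finite J" "\<And>j. j \<in> J \<Longrightarrow> u j \<in> carrier M"
  shows "h (finsum M u J) = finsum N (\<lambda>j. h (u j)) J"
proof -
  interpret M: module R M by fact
  interpret N: module R N by fact
  show ?thesis
    using assms(4,5)
  proof (induction J rule: finite_induct)
    case empty
    then show ?case using module_hom_zero[OF assms(1-3)] by simp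
  next
    case (insert j J)
    then show ?case
      using module_homD(1,2)[OF assms(3)] by (auto simp: M.finsum_insert N.finsum_insert Pi_iff)
  qed
qed

section \<open>Submodules: preimages, images, intersections and sums\<close>

lemma submodule_vimage:
  assumes "module R M" "module R N" "h \<in> module_hom R M N" "submodule D R N"
  shows "submodule {x \<in> carrier M. h x \<in> D} R M"
proof -
  interpret M: module R M by fact
  interpret N: module R N by fact
  note D = N.submoduleE[OF assms(4)]
  have "\<zero>\<^bsub>N\<^esub> \<in> D" using D(1,2) D(4)[of "\<zero>\<^bsub>R\<^esub>"] by force
  then show ?thesis
    using D module_homD[OF assms(3)] module_hom_zero[OF assms(1-3)] module_hom_neg[OF assms(1-3)]
    by (intro M.submoduleI) auto
qed

lemma submodule_image:
  assumes "module R M" "module R N" "h \<in> module_hom R M N" "submodule H R M"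
  shows "submodule (h ` H) R N"
proof -
  interpret M: module R M by fact
  interpret N: module R N by fact
  note H = M.submoduleE[OF assms(4)]
  have "\<zero>\<^bsub>M\<^esub> \<in> H" using H(1,2) H(4)[of "\<zero>\<^bsub>R\<^esub>"] by force
  note h = module_homD[OF assms(3)]
  show ?thesis
  proof (intro N.submoduleI)
    show "h ` H \<subseteq> carrier N" using h(1) H(1) by auto
    show "\<zero>\<^bsub>N\<^esub> \<in> h ` H" using \<open>\<zero>\<^bsub>M\<^esub> \<in> H\<close> module_hom_zero[OF assms(1-3)] by force
    show "\<ominus>\<^bsub>N\<^esub> a \<in> h ` H" if a: "a \<in> h ` H" for a
    proof -
      obtain x where "x \<in> H" "a = h x" using a by auto
      then show ?thesis using H(1,3) module_hom_neg[OF assms(1-3), of x] by (metis imageI subsetD)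
    qed
    show "a \<oplus>\<^bsub>N\<^esub> b \<in> h ` H" if ab: "a \<in> h ` H" "b \<in> h ` H" for a b
    proof -
      obtain x y where "x \<in> H" "a = h x" "y \<in> H" "b = h y" using ab by blast
      then show ?thesis using H(1,5) h(2)[of x y] by (metis imageI subsetD)
    qed
    show "r \<odot>\<^bsub>N\<^esub> b \<in> h ` H" if r: "r \<in> carrier R" and b: "b \<in> h ` H" for r b
    proof -
      obtain y where "y \<in> H" "b = h y" using b by auto
      then show ?thesis using H(1,4) h(3)[of r y] r by (metis imageI subsetD)
    qed
  qed
qed

lemma set_addE:
  assumes "x \<in> H <+>\<^bsub>M\<^esub> K"
  obtains y z where "y \<in> H" "z \<in> K" "x = y \<oplus>\<^bsub>M\<^esub> z"
  using assms by (auto simp: set_add_def')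

lemma set_addI: "y \<in> H \<Longrightarrow> z \<in> K \<Longrightarrow> y \<oplus>\<^bsub>M\<^esub> z \<in> H <+>\<^bsub>M\<^esub> K"
  by (auto simp: set_add_def')

context module
begin

lemma submodule_zero: "submodule H R M \<Longrightarrow> \<zero>\<^bsub>M\<^esub> \<in> H"
  using submoduleE(1,2)[of H] submoduleE(4)[of H "\<zero>"] by force

lemma submodule_minus: "submodule H R M \<Longrightarrow> x \<in> H \<Longrightarrow> y \<in> H \<Longrightarrow> x \<ominus>\<^bsub>M\<^esub> y \<in> H"
  using submoduleE(3,5)[of H] by (simp add: a_minus_def)

lemma submodule_Int:
  "submodule H R M \<Longrightarrow> submodule K R M \<Longrightarrow> submodule (H \<inter> K) R M"
  using submoduleE[of H] submoduleE[of K] submodule_zero[of H] submodule_zero[of K]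
  by (intro submoduleI) auto

lemma submodule_set_add:
  assumes H: "submodule H R M" and K: "submodule K R M"
  shows "submodule (H <+>\<^bsub>M\<^esub> K) R M"
proof (intro submoduleI)
  note HE = submoduleE[OF H] and KE = submoduleE[OF K]
  have c: "x \<in> H \<Longrightarrow> x \<in> carrier M" "x \<in> K \<Longrightarrow> x \<in> carrier M" for x using HE(1) KE(1) by auto
  show "H <+>\<^bsub>M\<^esub> K \<subseteq> carrier M" using c by (auto elim!: set_addE)
  show "\<zero>\<^bsub>M\<^esub> \<in> H <+>\<^bsub>M\<^esub> K"
    using set_addI[OF submodule_zero[OF H] submodule_zero[OF K], of M] by simp
  show "\<ominus>\<^bsub>M\<^esub> a \<in> H <+>\<^bsub>M\<^esub> K" if "a \<in> H <+>\<^bsub>M\<^esub> K" for a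
    using that
    by (auto elim!: set_addE simp: M.minus_add c intro!: set_addI HE(3) KE(3))
  show "a \<oplus>\<^bsub>M\<^esub> b \<in> H <+>\<^bsub>M\<^esub> K" if ab: "a \<in> H <+>\<^bsub>M\<^esub> K" "b \<in> H <+>\<^bsub>M\<^esub> K" for a b
  proof -
    obtain y z y' z' where "y \<in> H" "z \<in> K" "y' \<in> H" "z' \<in> K"
      and e: "a = y \<oplus>\<^bsub>M\<^esub> z" "b = y' \<oplus>\<^bsub>M\<^esub> z'"
      using ab by (auto elim!: set_addE)
    then have "(y \<oplus>\<^bsub>M\<^esub> y') \<oplus>\<^bsub>M\<^esub> (z \<oplus>\<^bsub>M\<^esub> z') \<in> H <+>\<^bsub>M\<^esub> K"
      by (intro set_addI HE KE) auto
    moreover have "(y \<oplus>\<^bsub>M\<^esub> y') \<oplus>\<^bsub>M\<^esub> (z \<oplus>\<^bsub>M\<^esub> z') = a \<oplus>\<^bsub>M\<^esub> b"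
      using \<open>y \<in> H\<close> \<open>z \<in> K\<close> \<open>y' \<in> H\<close> \<open>z' \<in> K\<close> c by (simp add: e M.a_ac)
    ultimately show ?thesis by simp
  qed
  show "r \<odot>\<^bsub>M\<^esub> a \<in> H <+>\<^bsub>M\<^esub> K" if "r \<in> carrier R" "a \<in> H <+>\<^bsub>M\<^esub> K" for r a
    using that by (auto elim!: set_addE simp: smult_r_distr c intro!: set_addI HE(4) KE(4))
qed

lemma set_add_upper1: "submodule H R M \<Longrightarrow> submodule K R M \<Longrightarrow> H \<subseteq> H <+>\<^bsub>M\<^esub> K"
  using set_addI[of _ H "\<zero>\<^bsub>M\<^esub>" K M] submodule_zero[of K] submoduleE(1)[of H]
  by (metis (no_types, lifting) M.r_zero subset_iff)

lemma set_add_upper2: "submodule H R M \<Longrightarrow> submodule K R M \<Longrightarrow> K \<subseteq> H <+>\<^bsub>M\<^esub> K"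
  using set_addI[of "\<zero>\<^bsub>M\<^esub>" H _ K M] submodule_zero[of H] submoduleE(1)[of K]
  by (metis (no_types, lifting) M.l_zero subset_iff)

lemma set_add_least:
  "submodule L R M \<Longrightarrow> H \<subseteq> L \<Longrightarrow> K \<subseteq> L \<Longrightarrow> H <+>\<^bsub>M\<^esub> K \<subseteq> L"
  using submoduleE(5)[of L] by (auto elim!: set_addE)

text \<open>If \<open>x\<close> in \<open>C'\<close> is written as \<open>c + q\<close>, then
  \<open>q = x - c\<close> lies in both \<open>C'\<close> and \<open>Q\<close>, hence in
  \<open>C\<close>. This form of the modular law is what makes lengths additive below.\<close>

lemma submodule_modular_eq:
  assumes "submodule C R M" "submodule C' R M" "submodule Q R M" "C \<subseteq> C'"
    and "C' \<inter> Q \<subseteq> C" "C' \<subseteq> C <+>\<^bsub>M\<^esub> Q"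
  shows "C' = C"
proof -
  have "x \<in> C" if x: "x \<in> C'" for x
  proof -
    obtain c q where "c \<in> C" "q \<in> Q" and e: "x = c \<oplus>\<^bsub>M\<^esub> q"
      using assms(6) x by (auto elim!: set_addE)
    then have c: "c \<in> carrier M" "q \<in> carrier M" "c \<in> C'"
      using assms(4) submoduleE(1)[OF assms(1)] submoduleE(1)[OF assms(3)] by auto
    then have "q = x \<ominus>\<^bsub>M\<^esub> c"
      using e M.a_comm[of c q] by (simp add: a_minus_def M.a_assoc M.r_neg)
    then have "q \<in> C'" using submodule_minus[OF assms(2) x c(3)] by simp
    then show ?thesis using assms(5) \<open>q \<in> Q\<close> \<open>c \<in> C\<close> e submoduleE(5)[OF assms(1)] by auto
  qed
  then show ?thesis using assms(4) by auto
qed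

end

section \<open>The length of an interval of submodules\<close>

text \<open>\<open>n\<close> counts strict inclusions, so the chain has \<open>n + 1\<close>
  members; its ends need not reach \<open>P\<close> and \<open>Q\<close>.\<close>

definition submodule_chain ::
  "('a, 'r) ring_scheme \<Rightarrow> ('a, 'b, 'm) module_scheme \<Rightarrow> 'b set \<Rightarrow> 'b set \<Rightarrow> nat \<Rightarrow> (nat \<Rightarrow> 'b set) \<Rightarrow> bool" where
  "submodule_chain R M P Q n C \<longleftrightarrow>
     (\<forall>i\<le>n. submodule (C i) R M \<and> P \<subseteq> C i \<and> C i \<subseteq> Q) \<and> (\<forall>i<n. C i \<subset> C (Suc i))"

text \<open>This is the length of the subquotient \<open>Q / P\<close>, measured inside
  \<open>M\<close>; it is infinite when chains can be arbitrarily long.\<close>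

definition interval_length ::
  "('a, 'r) ring_scheme \<Rightarrow> ('a, 'b, 'm) module_scheme \<Rightarrow> 'b set \<Rightarrow> 'b set \<Rightarrow> enat" where
  "interval_length R M P Q = Sup {enat n | n. \<exists>C. submodule_chain R M P Q n C}"

text \<open>Initial segments of chains are chains, so every length below the supremum is realized.
  Inequalities between lengths thereby become constructions of chains.\<close>

lemma le_interval_length_iff:
  assumes "submodule P R M" "P \<subseteq> Q"
  shows "enat k \<le> interval_length R M P Q \<longleftrightarrow> (\<exists>C. submodule_chain R M P Q k C)"
proof
  assume k: "enat k \<le> interval_length R M P Q"
  show "\<exists>C. submodule_chain R M P Q k C"
  proof (cases k)
    case 0
    then show ?thesis using assms by (intro exI[of _ "\<lambda>_. P"]) (auto simp: submodule_chain_def)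
  next
    case (Suc j)
    then have "enat j < interval_length R M P Q" using k Suc_ile_eq by auto
    then obtain n C where n: "j < n" and C: "submodule_chain R M P Q n C"
      unfolding interval_length_def less_Sup_iff by auto
    then have "submodule_chain R M P Q k C" using Suc by (auto simp: submodule_chain_def)
    then show ?thesis by blast
  qed
next
  assume "\<exists>C. submodule_chain R M P Q k C"
  then show "enat k \<le> interval_length R M P Q"
    unfolding interval_length_def by (intro Sup_upper) auto
qed

lemma enat_leI:
  assumes "\<And>k. enat k \<le> a \<Longrightarrow> enat k \<le> (b :: enat)"
  shows "a \<le> b"
proof (cases a)
  case infinity
  then have "enat (Suc m) \<le> b" for m using assms by simp
  then show ?thesis by (cases b) (auto dest: meta_spec[of _ "the_enat b"])
qed (use assms in auto)

lemma enat_le_addE: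
  assumes "enat k \<le> a + b"
  obtains i j where "k = i + j" "enat i \<le> a" "enat j \<le> b"
proof (cases "enat k \<le> a")
  case True
  then show ?thesis using that[of k 0] by (simp add: zero_enat_def[symmetric])
next
  case False
  then obtain i where i: "a = enat i" by (cases a) auto
  then show ?thesis using False assms that[of i "k - i"] by (cases b) auto
qed

lemma interval_length_mono:
  assumes "P' \<subseteq> P" "Q \<subseteq> Q'"
  shows "interval_length R M P Q \<le> interval_length R M P' Q'"
  unfolding interval_length_def
proof (intro Sup_subset_mono subsetI)
  fix z assume "z \<in> {enat n | n. \<exists>C. submodule_chain R M P Q n C}"
  then obtain n C where "z = enat n" "submodule_chain R M P Q n C" by auto
  moreover from this have "submodule_chain R M P' Q' n C"
    using assms unfolding submodule_chain_def by blast
  ultimately show "z \<in> {enat n | n. \<exists>C. submodule_chain R M P' Q' n C}" by blast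
qed

lemma interval_length_pos:
  assumes "submodule P R M" "submodule Q R M" "P \<subset> Q"
  shows "1 \<le> interval_length R M P Q"
proof -
  have "submodule_chain R M P Q 1 (\<lambda>i. if i = 0 then P else Q)"
    using assms by (auto simp: submodule_chain_def)
  then show ?thesis using le_interval_length_iff[of P R M Q 1] assms by (auto simp: one_enat_def)
qed

lemma interval_length_refl:
  assumes "submodule P R M"
  shows "interval_length R M P P = 0"
proof -
  have "\<not> enat 1 \<le> interval_length R M P P"
    using assms by (auto simp: le_interval_length_iff submodule_chain_def)
  then show ?thesis by (cases "interval_length R M P P") (auto simp: zero_enat_def)
qed

lemma interval_length_superadditive:
  assumes "submodule P R M" "submodule Q R M" "P \<subseteq> Q" "Q \<subseteq> S"
  shows "interval_length R M P Q + interval_length R M Q S \<le> interval_length R M P S"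
proof (rule enat_leI)
  fix k assume "enat k \<le> interval_length R M P Q + interval_length R M Q S"
  then obtain n m where k: "k = n + m" and "enat n \<le> interval_length R M P Q"
    "enat m \<le> interval_length R M Q S"
    by (rule enat_le_addE)
  then obtain C D where C: "submodule_chain R M P Q n C" and D: "submodule_chain R M Q S m D"
    using assms by (auto simp: le_interval_length_iff)
  \<comment> \<open>\<open>D 0\<close> is dropped because it may coincide with \<open>C n\<close>;
    the step from \<open>C n\<close> to \<open>D 1\<close> is still strict, since \<open>C n\<close>
    lies in \<open>Q\<close> and \<open>Q\<close> in \<open>D 0\<close>.\<close>
  define E where "E i = (if i \<le> n then C i else D (i - n))" for i
  have "submodule_chain R M P S k E"
    unfolding submodule_chain_def
  proof (intro conjI allI impI)
    fix i assume i: "i \<le> k"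
    have "submodule (E i) R M \<and> P \<subseteq> E i \<and> E i \<subseteq> S"
    proof (cases "i \<le> n")
      case True
      then have "submodule (C i) R M" "P \<subseteq> C i" "C i \<subseteq> Q"
        using C by (auto simp: submodule_chain_def)
      then show ?thesis using True assms(4) by (auto simp: E_def)
    next
      case False
      then have "i - n \<le> m" using i k by simp
      then have "submodule (D (i - n)) R M" "Q \<subseteq> D (i - n)" "D (i - n) \<subseteq> S"
        using D by (auto simp: submodule_chain_def)
      then show ?thesis using False assms(3) by (auto simp: E_def)
    qed
    then show "submodule (E i) R M" "P \<subseteq> E i" "E i \<subseteq> S" by auto
  next
    fix i assume i: "i < k"
    show "E i \<subset> E (Suc i)"
    proof (cases "i < n")
      case True
      then show ?thesis using C by (auto simp: E_def submodule_chain_def)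
    next
      case False
      then have d: "D (i - n) \<subset> D (Suc (i - n))"
        using D i k by (auto simp: submodule_chain_def)
      have "E i \<subseteq> D (i - n)"
      proof (cases "i = n")
        case True
        then have "C i \<subseteq> Q" "Q \<subseteq> D 0" using C D by (auto simp: submodule_chain_def)
        then show ?thesis using True by (auto simp: E_def)
      qed (use False in \<open>auto simp: E_def\<close>)
      then show ?thesis using d False by (auto simp: E_def Suc_diff_le)
    qed
  qed
  then show "enat k \<le> interval_length R M P S"
    using assms by (auto simp: le_interval_length_iff)
qed

text \<open>Each step of a chain grows in its trace on \<open>Q\<close> or in its sum with \<open>Q\<close>.\<close>

lemma (in module) chain_length_bound:
  assumes Q: "submodule Q R M" and C: "submodule_chain R M P S n C"
  shows "enat n \<le> interval_length R M (C 0 \<inter> Q) (C n \<inter> Q)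
                 + interval_length R M (C 0 <+>\<^bsub>M\<^esub> Q) (C n <+>\<^bsub>M\<^esub> Q)"
  using C
proof (induction n)
  case 0
  then show ?case by (simp add: zero_enat_def[symmetric])
next
  case (Suc n)
  let ?I = "\<lambda>i. C i \<inter> Q" and ?S = "\<lambda>i. C i <+>\<^bsub>M\<^esub> Q" and ?l = "interval_length R M"
  have sub: "submodule (C i) R M" if "i \<le> Suc n" for i
    using Suc.prems that by (auto simp: submodule_chain_def)
  have inc: "C i \<subseteq> C (Suc i)" if "i < Suc n" for i
    using Suc.prems that by (auto simp: submodule_chain_def)
  have inc0: "C 0 \<subseteq> C i" if "i \<le> Suc n" for i
    using that
  proof (induction i)
    case (Suc i)
    then show ?case using inc[of i] by auto
  qed simp
  have subI: "submodule (?I i) R M" and subS: "submodule (?S i) R M" if "i \<le> Suc n" for i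
    using that Q sub submodule_Int submodule_set_add by auto
  have S_mono: "?S i \<subseteq> ?S j" if "C i \<subseteq> C j" for i j
    using that by (auto simp: set_add_def')
  have sI: "?l (?I 0) (?I n) + ?l (?I n) (?I (Suc n)) \<le> ?l (?I 0) (?I (Suc n))"
    using subI inc[of n] inc0[of n] by (intro interval_length_superadditive) auto
  have sS: "?l (?S 0) (?S n) + ?l (?S n) (?S (Suc n)) \<le> ?l (?S 0) (?S (Suc n))"
    using subS S_mono inc[of n] inc0[of n] by (intro interval_length_superadditive) auto
  have "C n \<subset> C (Suc n)" using Suc.prems by (auto simp: submodule_chain_def)
  then have "\<not> (?I (Suc n) \<subseteq> C n \<and> C (Suc n) \<subseteq> ?S n)"
    using submodule_modular_eq[OF sub[of n] sub[of "Suc n"] Q] by auto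
  then have "?I n \<subset> ?I (Suc n) \<or> ?S n \<subset> ?S (Suc n)"
    using inc[of n] S_mono[of n "Suc n"] set_add_upper1[OF sub[of "Suc n"] Q] by auto
  then have step: "1 \<le> ?l (?I n) (?I (Suc n)) + ?l (?S n) (?S (Suc n))"
  proof
    assume "?I n \<subset> ?I (Suc n)"
    then have "1 \<le> ?l (?I n) (?I (Suc n))" using subI by (intro interval_length_pos) auto
    then show ?thesis by (simp add: add_increasing2)
  next
    assume "?S n \<subset> ?S (Suc n)"
    then have "1 \<le> ?l (?S n) (?S (Suc n))" using subS by (intro interval_length_pos) auto
    then show ?thesis by (simp add: add_increasing)
  qed
  have "enat n \<le> ?l (?I 0) (?I n) + ?l (?S 0) (?S n)"
    using Suc by (auto simp: submodule_chain_def)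
  then have "enat n + 1 \<le> (?l (?I 0) (?I n) + ?l (?S 0) (?S n)) + (?l (?I n) (?I (Suc n)) + ?l (?S n) (?S (Suc n)))"
    using step by (rule add_mono)
  also have "\<dots> = (?l (?I 0) (?I n) + ?l (?I n) (?I (Suc n))) + (?l (?S 0) (?S n) + ?l (?S n) (?S (Suc n)))"
    by (simp add: ac_simps)
  also have "\<dots> \<le> ?l (?I 0) (?I (Suc n)) + ?l (?S 0) (?S (Suc n))"
    using sI sS by (rule add_mono)
  finally show ?case by (simp add: one_enat_def)
qed

text \<open>Intersecting a chain with \<open>Q\<close> moves it between \<open>P\<close> and
  \<open>Q\<close>, adding \<open>Q\<close> moves it between \<open>Q\<close> and \<open>S\<close>,
  and \<open>chain_length_bound\<close> says that the two images together lose no step.\<close>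

lemma (in module) interval_length_add:
  assumes P: "submodule P R M" and Q: "submodule Q R M" and S: "submodule S R M"
    and "P \<subseteq> Q" "Q \<subseteq> S"
  shows "interval_length R M P S = interval_length R M P Q + interval_length R M Q S"
proof (rule antisym[OF enat_leI interval_length_superadditive])
  fix k assume "enat k \<le> interval_length R M P S"
  then obtain C where C: "submodule_chain R M P S k C"
    using assms le_interval_length_iff[of P R M S k] by auto
  have "enat k \<le> interval_length R M (C 0 \<inter> Q) (C k \<inter> Q)
                + interval_length R M (C 0 <+>\<^bsub>M\<^esub> Q) (C k <+>\<^bsub>M\<^esub> Q)"
    by (rule chain_length_bound[OF Q C])
  also have "\<dots> \<le> interval_length R M P Q + interval_length R M Q S"
  proof (intro add_mono interval_length_mono)
    show "P \<subseteq> C 0 \<inter> Q" "C k \<inter> Q \<subseteq> Q" using C assms by (auto simp: submodule_chain_def)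
    show "Q \<subseteq> C 0 <+>\<^bsub>M\<^esub> Q" using C Q by (intro set_add_upper2) (auto simp: submodule_chain_def)
    show "C k <+>\<^bsub>M\<^esub> Q \<subseteq> S" using C assms by (intro set_add_least) (auto simp: submodule_chain_def)
  qed
  finally show "enat k \<le> interval_length R M P Q + interval_length R M Q S" .
qed (use assms in auto)

lemma interval_length_le_by_map:
  assumes "submodule P' R N" "P' \<subseteq> Q'"
    and "\<And>H. submodule H R M \<Longrightarrow> P \<subseteq> H \<Longrightarrow> H \<subseteq> Q \<Longrightarrow> submodule (\<phi> H) R N \<and> P' \<subseteq> \<phi> H \<and> \<phi> H \<subseteq> Q'"
    and "\<And>H K. submodule H R M \<Longrightarrow> submodule K R M \<Longrightarrow> P \<subseteq> H \<Longrightarrow> H \<subset> K \<Longrightarrow> K \<subseteq> Q \<Longrightarrow> \<phi> H \<subset> \<phi> K"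
    and "submodule P R M" "P \<subseteq> Q"
  shows "interval_length R M P Q \<le> interval_length R N P' Q'"
proof (rule enat_leI)
  fix k assume "enat k \<le> interval_length R M P Q"
  then obtain C where "submodule_chain R M P Q k C"
    using le_interval_length_iff[OF assms(5,6)] by auto
  then have "submodule_chain R N P' Q' k (\<lambda>i. \<phi> (C i))"
    using assms(3,4) by (simp add: submodule_chain_def)
  then show "enat k \<le> interval_length R N P' Q'"
    using le_interval_length_iff[OF assms(1,2)] by blast
qed

text \<open>The isomorphism theorem on the level of lattices: \<open>H\<close> maps to
  \<open>D + h H\<close>, \<open>K\<close> maps to its preimage under \<open>h\<close>, and these
  monotone maps are inverse to each other (facts \<open>V\<close> and \<open>W\<close>).\<close>

lemma interval_length_vimage:
  assumes M: "module R M" and N: "module R N" and h: "h \<in> module_hom R M N" and D: "submodule D R N"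
  shows "interval_length R M {x \<in> carrier M. h x \<in> D} (carrier M)
       = interval_length R N D (D <+>\<^bsub>N\<^esub> h ` carrier M)"
proof -
  interpret M: module R M by fact
  interpret N: module R N by fact
  let ?V = "\<lambda>H. {x \<in> carrier M. h x \<in> H}"
  have im: "submodule (h ` H) R N" if "submodule H R M" for H
    by (rule submodule_image[OF M N h that])
  have vm: "submodule (?V H) R M" if "submodule H R N" for H
    by (rule submodule_vimage[OF M N h that])
  note hD = module_homD[OF h]
  note DE = N.submoduleE[OF D]
  have imM: "submodule (h ` carrier M) R N" by (rule im[OF M.carrier_is_submodule])
  have V: "?V (D <+>\<^bsub>N\<^esub> h ` H) = H" if H: "submodule H R M" "?V D \<subseteq> H" for H
  proof (intro equalityI subsetI)
    fix x assume "x \<in> ?V (D <+>\<^bsub>N\<^esub> h ` H)"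
    then obtain d y where x: "x \<in> carrier M" and d: "d \<in> D" "y \<in> H" "h x = d \<oplus>\<^bsub>N\<^esub> h y"
      by (auto elim!: set_addE)
    have y: "y \<in> carrier M" using d(2) M.submoduleE(1)[OF H(1)] by auto
    have "h (x \<ominus>\<^bsub>M\<^esub> y) = h x \<ominus>\<^bsub>N\<^esub> h y" using module_hom_minus[OF M N h x y] .
    also have "\<dots> = d" using d y hD(1) DE(1) by (auto simp: a_minus_def N.a_assoc N.r_neg)
    finally have "x \<ominus>\<^bsub>M\<^esub> y \<in> H" using H(2) d(1) x y by auto
    then have "(x \<ominus>\<^bsub>M\<^esub> y) \<oplus>\<^bsub>M\<^esub> y \<in> H" using M.submoduleE(5)[OF H(1)] d(2) by auto
    moreover have "(x \<ominus>\<^bsub>M\<^esub> y) \<oplus>\<^bsub>M\<^esub> y = x" using x y by (simp add: a_minus_def M.a_assoc M.l_neg)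
    ultimately show "x \<in> H" by simp
  next
    fix x assume "x \<in> H"
    then show "x \<in> ?V (D <+>\<^bsub>N\<^esub> h ` H)"
      using N.set_add_upper2[OF D im[OF H(1)]] M.submoduleE(1)[OF H(1)] by auto
  qed
  have W: "D <+>\<^bsub>N\<^esub> h ` (?V K) = K"
    if K: "submodule K R N" "D \<subseteq> K" "K \<subseteq> D <+>\<^bsub>N\<^esub> h ` carrier M" for K
  proof (intro equalityI subsetI)
    fix z assume "z \<in> D <+>\<^bsub>N\<^esub> h ` (?V K)"
    then show "z \<in> K" using K(2) N.submoduleE(5)[OF K(1)] by (auto elim!: set_addE)
  next
    fix z assume z: "z \<in> K"
    then obtain d x where dx: "d \<in> D" "x \<in> carrier M" "z = d \<oplus>\<^bsub>N\<^esub> h x"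
      using K(3) by (auto elim!: set_addE)
    then have "h x = z \<ominus>\<^bsub>N\<^esub> d"
      using hD(1)[of x] DE(1) N.a_comm[of d "h x"]
      by (auto simp: a_minus_def N.a_assoc N.r_neg subset_iff)
    then have "h x \<in> K" using N.submodule_minus[OF K(1) z] dx(1) K(2) by auto
    then show "z \<in> D <+>\<^bsub>N\<^esub> h ` (?V K)" using dx by (auto intro!: set_addI)
  qed
  have Vsub: "submodule (?V D) R M" by (rule vm[OF D])
  let ?W = "\<lambda>H. D <+>\<^bsub>N\<^esub> h ` H"
  have DW: "D \<subseteq> ?W (carrier M)" by (rule N.set_add_upper1[OF D imM])
  have Wmono: "?W H \<subseteq> ?W K" if "H \<subseteq> K" for H K using that by (auto simp: set_add_def')
  show ?thesis
  proof (rule antisym)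
    show "interval_length R M (?V D) (carrier M) \<le> interval_length R N D (?W (carrier M))"
    proof (rule interval_length_le_by_map[where \<phi> = ?W, OF D DW _ _ Vsub])
      show "submodule (?W H) R N \<and> D \<subseteq> ?W H \<and> ?W H \<subseteq> ?W (carrier M)"
        if "submodule H R M" "H \<subseteq> carrier M" for H
        using N.submodule_set_add[OF D im] N.set_add_upper1[OF D im] Wmono that by simp
      show "?W H \<subset> ?W K" if "submodule H R M" "submodule K R M" "?V D \<subseteq> H" "H \<subset> K" for H K
      proof -
        have "?V D \<subseteq> K" using that(3,4) by (meson psubsetE subset_trans)
        then have "?W H \<noteq> ?W K" using V[OF that(1,3)] V[OF that(2)] that(4) by (metis psubset_eq)
        then show ?thesis using Wmono[OF psubset_imp_subset[OF that(4)]] by (simp add: psubset_eq)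
      qed
    qed simp
    show "interval_length R N D (?W (carrier M)) \<le> interval_length R M (?V D) (carrier M)"
    proof (rule interval_length_le_by_map[where \<phi> = ?V, OF Vsub _ _ _ D DW])
      show "submodule (?V H) R M \<and> ?V D \<subseteq> ?V H \<and> ?V H \<subseteq> carrier M" if "submodule H R N" "D \<subseteq> H" for H
        using vm[OF that(1)] that(2) by auto
      show "?V H \<subset> ?V K"
        if "submodule H R N" "submodule K R N" "D \<subseteq> H" "H \<subset> K" "K \<subseteq> ?W (carrier M)" for H K
      proof -
        have "D \<subseteq> K" "H \<subseteq> ?W (carrier M)" using that(3-5) by (meson psubsetE subset_trans)+
        then have "?V H \<noteq> ?V K" using W[OF that(1,3)] W[OF that(2) _ that(5)] that(4) by (metis psubset_eq)
        moreover have "?V H \<subseteq> ?V K" using psubset_imp_subset[OF that(4)] by (simp add: subset_iff)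
        ultimately show ?thesis by (simp add: psubset_eq)
      qed
    qed auto
  qed
qed

text \<open>Rank and nullity for the map from \<open>M / P\<close> to \<open>N / D\<close> induced
  by \<open>h\<close>: the summands are the lengths of its kernel and of its image.\<close>

lemma interval_length_hom:
  assumes M: "module R M" and N: "module R N" and h: "h \<in> module_hom R M N"
    and P: "submodule P R M" and D: "submodule D R N" and hP: "h ` P \<subseteq> D"
  shows "interval_length R M P (carrier M)
       = interval_length R M P {x \<in> carrier M. h x \<in> D}
       + interval_length R N D (D <+>\<^bsub>N\<^esub> h ` carrier M)"
proof -
  interpret M: module R M by fact
  have "P \<subseteq> carrier M" by (rule M.submoduleE(1)[OF P])
  then show ?thesis
    using M.interval_length_add[OF P submodule_vimage[OF M N h D] M.carrier_is_submodule] hP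
      interval_length_vimage[OF M N h D] by auto
qed

text \<open>
  In the two lemmas on exact pairs, \<open>f\<close> and \<open>g\<close> induce maps between \<open>M / D\<close> and \<open>N / D'\<close>; the
  assumptions on \<open>{x. f x \<in> D'}\<close> and \<open>{y. g y \<in> D}\<close> say that these are exact at \<open>M / D\<close> and
  at \<open>N / D'\<close>.
\<close>

lemma exact_pair_length_eq:
  assumes M: "module R M" and N: "module R N"
    and f: "f \<in> module_hom R M N" and g: "g \<in> module_hom R N M"
    and D: "submodule D R M" and D': "submodule D' R N"
    and "f ` D \<subseteq> D'" "g ` D' \<subseteq> D"
    and exM: "{x \<in> carrier M. f x \<in> D'} = D <+>\<^bsub>M\<^esub> g ` carrier N"
    and exN: "{y \<in> carrier N. g y \<in> D} = D' <+>\<^bsub>N\<^esub> f ` carrier M"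
  shows "interval_length R M D (carrier M) = interval_length R N D' (carrier N)"
  unfolding interval_length_hom[OF M N f D D' assms(7)] interval_length_hom[OF N M g D' D assms(8)]
    exM exN by (rule add.commute)

lemma exact_pair_exact:
  assumes M: "module R M" and N: "module R N"
    and f: "f \<in> module_hom R M N" and g: "g \<in> module_hom R N M"
    and D: "submodule D R M" and D': "submodule D' R N"
    and fD: "f ` D \<subseteq> D'" and gD: "g ` D' \<subseteq> D"
    and len: "interval_length R M D (carrier M) = interval_length R N D' (carrier N)"
    and fin: "interval_length R M D (carrier M) \<noteq> \<infinity>"
    and exM: "{x \<in> carrier M. f x \<in> D'} = D <+>\<^bsub>M\<^esub> g ` carrier N"
    and gf: "\<And>x. x \<in> carrier M \<Longrightarrow> g (f x) \<in> D"
  shows "{y \<in> carrier N. g y \<in> D} = D' <+>\<^bsub>N\<^esub> f ` carrier M"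
proof -
  interpret M: module R M by fact
  interpret N: module R N by fact
  let ?V = "{y \<in> carrier N. g y \<in> D}" and ?W = "D' <+>\<^bsub>N\<^esub> f ` carrier M"
  let ?l = "interval_length R N"
  have V: "submodule ?V R N" by (rule submodule_vimage[OF N M g D])
  have W: "submodule ?W R N"
    by (intro N.submodule_set_add D' submodule_image[OF M N f] M.carrier_is_submodule)
  have DV: "D' \<subseteq> ?V" using gD N.submoduleE(1)[OF D'] by auto
  have WV: "?W \<subseteq> ?V" using gf module_homD(1)[OF f] by (intro N.set_add_least V DV) auto
  have DW: "D' \<subseteq> ?W"
    by (intro N.set_add_upper1 D' submodule_image[OF M N f] M.carrier_is_submodule)
  have 1: "interval_length R M D (carrier M)
         = interval_length R M D (D <+>\<^bsub>M\<^esub> g ` carrier N) + ?l D' ?W"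
    using interval_length_hom[OF M N f D D' fD] exM by simp
  have 2: "interval_length R N D' (carrier N)
         = ?l D' ?V + interval_length R M D (D <+>\<^bsub>M\<^esub> g ` carrier N)"
    by (rule interval_length_hom[OF N M g D' D gD])
  have 3: "?l D' ?V = ?l D' ?W + ?l ?W ?V"
    by (rule N.interval_length_add[OF D' W V DW WV])
  have fin': "?l D' ?W \<noteq> \<infinity>" "interval_length R M D (D <+>\<^bsub>M\<^esub> g ` carrier N) \<noteq> \<infinity>"
    "?l ?W ?V \<noteq> \<infinity>"
    using 1 2 3 fin len by (auto simp: plus_eq_infty_iff_enat)
  then obtain i j k where ijk: "?l D' ?W = enat i" "?l ?W ?V = enat k"
    "interval_length R M D (D <+>\<^bsub>M\<^esub> g ` carrier N) = enat j"
    unfolding not_infinity_eq by (elim exE)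
  have "enat j + enat i = enat i + enat k + enat j"
    using 1 2 3 len unfolding ijk by argo
  then have "?l ?W ?V = 0" using ijk(2) by (simp add: zero_enat_def)
  moreover have "\<not> ?W \<subset> ?V"
    using interval_length_pos[OF W V] calculation by (metis not_one_le_zero)
  ultimately show ?thesis using WV by auto
qed

section \<open>Finite length over Noetherian domains of dimension one\<close>

lemma regular_module_simps [simp]:
  "carrier (regular_module R) = carrier R"
  "\<zero>\<^bsub>regular_module R\<^esub> = \<zero>\<^bsub>R\<^esub>"
  "x \<oplus>\<^bsub>regular_module R\<^esub> y = x \<oplus>\<^bsub>R\<^esub> y"
  "a \<odot>\<^bsub>regular_module R\<^esub> x = a \<otimes>\<^bsub>R\<^esub> x"
  by (simp_all add: regular_module_def)

lemma (in cring) regular_module_is_module: "module R (regular_module R)"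
proof (intro moduleI)
  show "abelian_group (regular_module R)"
  proof (intro abelian_groupI)
    show "\<exists>y\<in>carrier (regular_module R). y \<oplus>\<^bsub>regular_module R\<^esub> x = \<zero>\<^bsub>regular_module R\<^esub>"
      if "x \<in> carrier (regular_module R)" for x
      using that by (intro bexI[of _ "\<ominus> x"]) (auto simp: l_neg)
  qed (auto simp: a_ac)
qed (auto simp: l_distr r_distr m_assoc is_cring)

lemma (in cring) regular_module_a_inv:
  assumes "x \<in> carrier R"
  shows "\<ominus>\<^bsub>regular_module R\<^esub> x = \<ominus> x"
proof -
  interpret M: module R "regular_module R" by (rule regular_module_is_module)
  show ?thesis using assms M.minus_equality[of "\<ominus> x" x] by (simp add: l_neg)
qed

lemma (in cring) submodule_regular_iff: "submodule I R (regular_module R) \<longleftrightarrow> ideal I R"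
proof -
  interpret M: module R "regular_module R" by (rule regular_module_is_module)
  show ?thesis
  proof
    assume I: "submodule I R (regular_module R)"
    note E = M.submoduleE[OF I]
    show "ideal I R"
    proof (rule idealI[OF ring_axioms])
      show "subgroup I (add_monoid R)"
      proof (intro subgroup.intro)
        show "inv\<^bsub>add_monoid R\<^esub> x \<in> I" if "x \<in> I" for x
          using E(1) E(3)[OF that] regular_module_a_inv[of x] that by (auto simp: a_inv_def[symmetric])
      qed (use E M.submodule_zero[OF I] in auto)
      show "x \<otimes> a \<in> I" if "a \<in> I" "x \<in> carrier R" for a x using E(4)[of x a] that by simp
      then show "a \<otimes> x \<in> I" if "a \<in> I" "x \<in> carrier R" for a x
        using that E(1) m_comm[of a x] by auto
    qed
  next
    assume "ideal I R"
    then interpret I: ideal I R .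
    show "submodule I R (regular_module R)"
      using I.I_l_closed I.a_subset regular_module_a_inv by (intro M.submoduleI) auto
  qed
qed

section \<open>Ideals of Noetherian rings and primes in dimension one\<close>

lemma (in noetherian_ring) ideal_family_maximal:
  assumes "\<F> \<noteq> {}" "\<And>I. I \<in> \<F> \<Longrightarrow> ideal I R"
  shows "\<exists>J\<in>\<F>. \<forall>K\<in>\<F>. J \<subseteq> K \<longrightarrow> K = J"
proof (rule subset_Zorn_nonempty[OF assms(1)])
  fix C assume C: "C \<noteq> {}" "subset.chain \<F> C"
  then have "subset.chain {I. ideal I R} C"
    using assms(2) by (auto simp: pred_on.chain_def)
  then have "\<Union>C \<in> C" by (rule ideal_chain_is_trivial[OF C(1)])
  then show "\<Union>C \<in> \<F>" using C(2) by (auto simp: pred_on.chain_def)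
qed

lemma (in noetherian_ring) proper_ideal_subset_maximal:
  assumes "ideal I R" "I \<noteq> carrier R"
  shows "\<exists>\<mm>. maximalideal \<mm> R \<and> I \<subseteq> \<mm>"
proof -
  let ?F = "{J. ideal J R \<and> I \<subseteq> J \<and> J \<noteq> carrier R}"
  have "\<exists>J\<in>?F. \<forall>K\<in>?F. J \<subseteq> K \<longrightarrow> K = J"
    by (rule ideal_family_maximal) (use assms in auto)
  then obtain J where J: "J \<in> ?F" and m: "\<forall>K\<in>?F. J \<subseteq> K \<longrightarrow> K = J" by (elim bexE)
  have "maximalideal J R"
  proof (rule maximalidealI)
    fix K assume "ideal K R" "J \<subseteq> K" "K \<subseteq> carrier R"
    then show "K = J \<or> K = carrier R" using J m[rule_format, of K] by auto
  qed (use J in auto)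
  then show ?thesis using J by auto
qed

text \<open>Otherwise the zero ideal, \<open>P\<close> and a maximal ideal above \<open>P\<close>
  form a chain of primes with two strict inclusions.\<close>

lemma (in noetherian_domain) nonzero_prime_is_maximal:
  assumes "krull_dim R = 1" "primeideal P R" "P \<noteq> {\<zero>}"
  shows "maximalideal P R"
proof (rule ccontr)
  assume nm: "\<not> maximalideal P R"
  interpret P: primeideal P R by fact
  obtain \<mm> where m: "maximalideal \<mm> R" "P \<subseteq> \<mm>"
    using proper_ideal_subset_maximal[OF P.is_ideal] P.I_notcarr by auto
  have "prime_chain R 2 (\<lambda>i. if i = 0 then {\<zero>} else if i = 1 then P else \<mm>)"
    using assms m nm maximalideal_prime[OF m(1)] zeroprimeideal
    by (auto simp: prime_chain_def less_2_cases_iff)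
  then have "enat 2 \<le> krull_dim R" unfolding krull_dim_def by (intro Sup_upper) auto
  then show False using assms(1) by (simp add: one_enat_def)
qed

text \<open>Only \<open>P\<close> and the whole ring are ideals containing \<open>P\<close>, so a
  chain cannot have two strict inclusions.\<close>

lemma (in cring) interval_length_maximalideal:
  assumes "maximalideal P R"
  shows "interval_length R (regular_module R) P (carrier R) \<noteq> \<infinity>"
proof
  interpret P: maximalideal P R by fact
  assume "interval_length R (regular_module R) P (carrier R) = \<infinity>"
  then have "enat 2 \<le> interval_length R (regular_module R) P (carrier R)" by simp
  then obtain C where C: "submodule_chain R (regular_module R) P (carrier R) 2 C"
    using le_interval_length_iff[of P R "regular_module R" "carrier R" 2]
    by (auto simp: submodule_regular_iff P.is_ideal P.a_subset)
  have "ideal (C i) R" "P \<subseteq> C i" "C i \<subseteq> carrier R" if "i \<le> 2" for i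
    using C that by (auto simp: submodule_chain_def submodule_regular_iff)
  then have "C i = P \<or> C i = carrier R" if "i \<le> 2" for i using that P.I_maximal by blast
  moreover have "C 0 \<subset> C 1" "C 1 \<subset> C 2"
    using C by (auto simp: submodule_chain_def numeral_2_eq_2)
  ultimately show False by (metis less_or_eq_imp_le one_le_numeral order_less_irrefl psubset_trans zero_le)
qed

text \<open>
  A maximal counterexample \<open>P\<close> is prime: if \<open>a b \<in> P\<close> but \<open>a, b \<notin> P\<close>, then \<open>R / P\<close> is an extension of
  \<open>R / (P + a R)\<close> by \<open>R / (P : a)\<close>.
\<close>

lemma (in noetherian_domain) finite_interval_length:
  assumes dim: "krull_dim R = 1" and "ideal I R" "I \<noteq> {\<zero>}"
  shows "interval_length R (regular_module R) I (carrier R) \<noteq> \<infinity>"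
proof
  let ?M = "regular_module R"
  let ?l = "interval_length R ?M"
  interpret M: module R ?M by (rule regular_module_is_module)
  let ?F = "{J. ideal J R \<and> I \<subseteq> J \<and> ?l J (carrier R) = \<infinity>}"
  assume "?l I (carrier R) = \<infinity>"
  then have "\<exists>J\<in>?F. \<forall>K\<in>?F. J \<subseteq> K \<longrightarrow> K = J"
    using assms by (intro ideal_family_maximal) auto
  then obtain P where P: "ideal P R" "I \<subseteq> P" and inf: "?l P (carrier R) = \<infinity>"
    and mx: "\<And>K. ideal K R \<Longrightarrow> P \<subset> K \<Longrightarrow> ?l K (carrier R) \<noteq> \<infinity>" by fastforce
  interpret P: ideal P R by fact
  have Psub: "submodule P R ?M" using P by (simp add: submodule_regular_iff)
  have "primeideal P R"
  proof (rule primeidealI[OF P(1) is_cring])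
    show "carrier R \<noteq> P" using inf interval_length_refl[OF Psub] by auto
    fix a b assume ab: "a \<in> carrier R" "b \<in> carrier R" "a \<otimes> b \<in> P"
    show "a \<in> P \<or> b \<in> P"
    proof (rule ccontr)
      assume n: "\<not> (a \<in> P \<or> b \<in> P)"
      \<comment> \<open>\<open>?V\<close> is the colon ideal \<open>(P : a)\<close>, which contains
        \<open>b\<close>, and \<open>?W = P + a R\<close> contains \<open>a\<close>. Both exceed
        \<open>P\<close> strictly, hence have finite colength by the choice of
        \<open>P\<close>.\<close>
      define h where "h r = a \<otimes> r" for r
      have h: "h \<in> module_hom R ?M ?M"
        using ab(1) by (intro module_homI) (auto simp: h_def r_distr m_lcomm)
      let ?V = "{r \<in> carrier R. h r \<in> P}" and ?W = "P <+>\<^bsub>?M\<^esub> h ` carrier R"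
      have hs: "submodule (h ` carrier R) R ?M"
        using submodule_image[OF M.module_axioms M.module_axioms h M.carrier_is_submodule] by simp
      have V: "submodule ?V R ?M"
        using submodule_vimage[OF M.module_axioms M.module_axioms h Psub] by simp
      have W: "submodule ?W R ?M" by (intro M.submodule_set_add Psub hs)
      have "P \<subset> ?V" using n ab P.I_l_closed P.a_subset by (auto simp: h_def)
      then have Vf: "?l ?V (carrier R) \<noteq> \<infinity>" using mx V by (simp add: submodule_regular_iff)
      have "a \<in> h ` carrier R" using ab(1) by (auto simp: h_def intro!: image_eqI[of _ _ \<one>])
      then have "P \<subset> ?W"
        using M.set_add_upper1[OF Psub hs] M.set_add_upper2[OF Psub hs] n by auto
      then have Wf: "?l ?W (carrier R) \<noteq> \<infinity>" using mx W by (simp add: submodule_regular_iff)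
      have "?l ?V (carrier R) = ?l P ?W"
        using interval_length_vimage[OF M.module_axioms M.module_axioms h Psub] by simp
      moreover have "?l P (carrier R) = ?l P ?W + ?l ?W (carrier R)"
        using M.interval_length_add[OF Psub W M.carrier_is_submodule] M.submoduleE(1)[OF W] \<open>P \<subset> ?W\<close>
        by auto
      ultimately show False using inf Vf Wf by (auto simp: plus_eq_infty_iff_enat)
    qed
  qed
  moreover have "P \<noteq> {\<zero>}"
    using P(2) assms(3) additive_subgroup.zero_closed[OF ideal.axioms(1)[OF assms(2)]] by blast
  ultimately have "maximalideal P R" using nonzero_prime_is_maximal[OF dim] by blast
  then show False using interval_length_maximalideal inf by blast
qed

section \<open>Finite free modules\<close>

lemma free_module_simps [simp]:
  "f \<in> carrier (free_module R X) \<longleftrightarrow>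
     (\<forall>x. f x \<in> carrier R) \<and> finite {x. f x \<noteq> \<zero>\<^bsub>R\<^esub>} \<and> (\<forall>x. x \<notin> X \<longrightarrow> f x = \<zero>\<^bsub>R\<^esub>)"
  "\<zero>\<^bsub>free_module R X\<^esub> = (\<lambda>x. \<zero>\<^bsub>R\<^esub>)"
  "f \<oplus>\<^bsub>free_module R X\<^esub> g = (\<lambda>x. f x \<oplus>\<^bsub>R\<^esub> g x)"
  "a \<odot>\<^bsub>free_module R X\<^esub> f = (\<lambda>x. a \<otimes>\<^bsub>R\<^esub> f x)"
  by (simp_all add: free_module_def)

context cring
begin

lemma free_module_is_module: "module R (free_module R X)"
proof (intro moduleI)
  have fin: "finite {x. h (f x) (g x) \<noteq> \<zero>}"
    if "finite {x. f x \<noteq> \<zero>}" "finite {x. g x \<noteq> \<zero>}" "h \<zero> \<zero> = \<zero>" for f g and h :: "'a \<Rightarrow> 'a \<Rightarrow> 'a"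
  proof (rule finite_subset)
    show "{x. h (f x) (g x) \<noteq> \<zero>} \<subseteq> {x. f x \<noteq> \<zero>} \<union> {x. g x \<noteq> \<zero>}" using that(3) by auto
  qed (use that in simp)
  show "abelian_group (free_module R X)"
  proof (intro abelian_groupI)
    fix f assume f: "f \<in> carrier (free_module R X)"
    have "(\<lambda>x. \<ominus> f x) \<in> carrier (free_module R X)"
      using f fin[of f f "\<lambda>a b. \<ominus> a"] by auto
    then show "\<exists>g\<in>carrier (free_module R X). g \<oplus>\<^bsub>free_module R X\<^esub> f = \<zero>\<^bsub>free_module R X\<^esub>"
      using f by (intro bexI[of _ "\<lambda>x. \<ominus> f x"]) (auto simp: l_neg)
  next
    fix f g assume "f \<in> carrier (free_module R X)" "g \<in> carrier (free_module R X)"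
    then show "f \<oplus>\<^bsub>free_module R X\<^esub> g \<in> carrier (free_module R X)"
      using fin[of f g "\<lambda>u v. u \<oplus> v"] by auto
  qed (auto simp: a_ac)
  show "a \<odot>\<^bsub>free_module R X\<^esub> f \<in> carrier (free_module R X)"
    if "a \<in> carrier R" "f \<in> carrier (free_module R X)" for a f
    using that fin[of f f "\<lambda>u v. a \<otimes> u"] by auto
qed (auto simp: l_distr r_distr m_assoc is_cring)

lemma free_module_finite_carrier:
  assumes "finite X"
  shows "f \<in> carrier (free_module R X) \<longleftrightarrow> (\<forall>x. f x \<in> carrier R) \<and> (\<forall>x. x \<notin> X \<longrightarrow> f x = \<zero>)"
proof -
  have "finite {x. f x \<noteq> \<zero>}" if "\<forall>x. x \<notin> X \<longrightarrow> f x = \<zero>"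
    by (rule finite_subset[OF _ assms]) (use that in auto)
  then show ?thesis by auto
qed

lemma free_module_a_inv:
  assumes "f \<in> carrier (free_module R X)"
  shows "\<ominus>\<^bsub>free_module R X\<^esub> f = (\<lambda>x. \<ominus> f x)"
proof -
  interpret F: module R "free_module R X" by (rule free_module_is_module)
  have "{x. \<ominus> f x \<noteq> \<zero>} \<subseteq> {x. f x \<noteq> \<zero>}" by auto
  then have "(\<lambda>x. \<ominus> f x) \<in> carrier (free_module R X)"
    using assms finite_subset by fastforce
  then show ?thesis using assms by (intro F.minus_equality) (auto simp: l_neg)
qed

lemma free_gen_closed: "x \<in> X \<Longrightarrow> free_gen R x \<in> carrier (free_module R X)"
  by (auto simp: free_gen_def)

lemma free_module_finsum:
  assumes "finite J" "\<And>j. j \<in> J \<Longrightarrow> u j \<in> carrier (free_module R X)"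
  shows "finsum (free_module R X) u J = (\<lambda>x. \<Oplus>j\<in>J. u j x)"
  using assms
proof (induction J rule: finite_induct)
  case empty
  interpret F: module R "free_module R X" by (rule free_module_is_module)
  show ?case by simp
next
  case (insert j J)
  interpret F: module R "free_module R X" by (rule free_module_is_module)
  show ?case using insert by (subst F.finsum_insert) (auto simp: fun_eq_iff finsum_insert Pi_iff)
qed

text \<open>The submodule \<open>I F\<close> of the free module \<open>F\<close> on
  \<open>X\<close>, described by its coordinates.\<close>

definition ideal_power :: "'a set \<Rightarrow> 'x set \<Rightarrow> ('x \<Rightarrow> 'a) set" where
  "ideal_power I X = {f \<in> carrier (free_module R X). \<forall>x. f x \<in> I}"

lemma submodule_ideal_power:
  assumes "ideal I R"
  shows "submodule (ideal_power I X) R (free_module R X)"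
proof -
  interpret F: module R "free_module R X" by (rule free_module_is_module)
  interpret I: ideal I R by fact
  show ?thesis
  proof (intro F.submoduleI)
    show "\<ominus>\<^bsub>free_module R X\<^esub> f \<in> ideal_power I X" if "f \<in> ideal_power I X" for f
    proof -
      have f: "f \<in> carrier (free_module R X)" "\<And>x. f x \<in> I" using that by (simp_all add: ideal_power_def)
      then have "(\<ominus>\<^bsub>free_module R X\<^esub> f) x \<in> I" for x
        unfolding free_module_a_inv[OF f(1)] by simp
      then show ?thesis unfolding ideal_power_def using F.a_inv_closed[OF f(1)] by blast
    qed
    show "f \<oplus>\<^bsub>free_module R X\<^esub> g \<in> ideal_power I X" if "f \<in> ideal_power I X" "g \<in> ideal_power I X" for f g
      using F.a_closed[of f g] that by (auto simp: ideal_power_def simp del: free_module_simps(1))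
    show "a \<odot>\<^bsub>free_module R X\<^esub> f \<in> ideal_power I X" if "a \<in> carrier R" "f \<in> ideal_power I X" for a f
      using F.smult_closed[of a f] that I.I_l_closed by (auto simp: ideal_power_def simp del: free_module_simps(1))
  qed (auto simp: ideal_power_def)
qed

text \<open>Evaluation at the new index \<open>y\<close> splits off one copy of
  \<open>R / I\<close>; what remains is the same quotient for the free module on
  \<open>X\<close>.\<close>

lemma interval_length_ideal_power:
  fixes X :: "'x set"
  assumes I: "ideal I R" and "finite X"
  shows "interval_length R (free_module R X) (ideal_power I X) (carrier (free_module R X))
       = of_nat (card X) * interval_length R (regular_module R) I (carrier R)"
  using assms(2)
proof (induction X rule: finite_induct)
  case empty
  interpret F: module R "free_module R ({} :: 'x set)" by (rule free_module_is_module)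
  have "ideal_power I {} = carrier (free_module R ({} :: 'x set))"
    using additive_subgroup.zero_closed[OF ideal.axioms(1)[OF I]] by (auto simp: ideal_power_def)
  then show ?case using interval_length_refl[OF F.carrier_is_submodule] by simp
next
  case (insert y X)
  interpret I: ideal I R by fact
  let ?F = "free_module R X" and ?G = "free_module R (insert y X)" and ?M = "regular_module R"
  interpret F: module R ?F by (rule free_module_is_module)
  interpret G: module R ?G by (rule free_module_is_module)
  interpret M: module R ?M by (rule regular_module_is_module)
  define ev where "ev f = f y" for f :: "'x \<Rightarrow> 'a"
  have ev: "ev \<in> module_hom R ?G ?M" by (intro module_homI) (auto simp: ev_def)
  have inc: "(\<lambda>f. f) \<in> module_hom R ?F ?G" by (intro module_homI) auto
  have Isub: "submodule I R ?M" using I by (simp add: submodule_regular_iff)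
  have P: "submodule (ideal_power I (insert y X)) R ?G" by (rule submodule_ideal_power[OF I])
  have "interval_length R ?G (ideal_power I (insert y X)) (carrier ?G)
      = interval_length R ?G (ideal_power I (insert y X)) {f \<in> carrier ?G. ev f \<in> I}
        + interval_length R ?M I (I <+>\<^bsub>?M\<^esub> ev ` carrier ?G)"
    by (rule interval_length_hom[OF G.module_axioms M.module_axioms ev P Isub])
       (auto simp: ideal_power_def ev_def)
  also have "I <+>\<^bsub>?M\<^esub> ev ` carrier ?G = carrier R"
  proof
    show "I <+>\<^bsub>?M\<^esub> ev ` carrier ?G \<subseteq> carrier R"
      by (auto elim!: set_addE simp: ev_def)
    have "r \<in> ev ` carrier ?G" if "r \<in> carrier R" for r
      using that by (intro image_eqI[of _ _ "\<lambda>x. if x = y then r else \<zero>"]) (auto simp: ev_def)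
    then have "\<zero> \<oplus>\<^bsub>?M\<^esub> r \<in> I <+>\<^bsub>?M\<^esub> ev ` carrier ?G" if "r \<in> carrier R" for r
      using that by (intro set_addI) auto
    then show "carrier R \<subseteq> I <+>\<^bsub>?M\<^esub> ev ` carrier ?G" by auto
  qed
  also have "{f \<in> carrier ?G. ev f \<in> I} = ideal_power I (insert y X) <+>\<^bsub>?G\<^esub> (\<lambda>f. f) ` carrier ?F"
  proof
    show "ideal_power I (insert y X) <+>\<^bsub>?G\<^esub> (\<lambda>f. f) ` carrier ?F \<subseteq> {f \<in> carrier ?G. ev f \<in> I}"
    proof (rule G.set_add_least)
      show "submodule {f \<in> carrier ?G. ev f \<in> I} R ?G"
        by (rule submodule_vimage[OF G.module_axioms M.module_axioms ev Isub])
      show "(\<lambda>f. f) ` carrier ?F \<subseteq> {f \<in> carrier ?G. ev f \<in> I}"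
        using insert(2) by (auto simp: ev_def)
    qed (auto simp: ideal_power_def ev_def)
    show "{f \<in> carrier ?G. ev f \<in> I} \<subseteq> ideal_power I (insert y X) <+>\<^bsub>?G\<^esub> (\<lambda>f. f) ` carrier ?F"
    proof
      fix f assume f: "f \<in> {f \<in> carrier ?G. ev f \<in> I}"
      define f1 f2 where "f1 = (\<lambda>x. if x = y then f y else \<zero>)" and "f2 = f(y := \<zero>)"
      have 1: "f1 \<in> ideal_power I (insert y X)"
        using f by (auto simp: ideal_power_def f1_def ev_def)
      have "{x. f2 x \<noteq> \<zero>} \<subseteq> {x. f x \<noteq> \<zero>}" by (auto simp: f2_def)
      moreover have "finite {x. f x \<noteq> \<zero>}" using f by simp
      ultimately have "finite {x. f2 x \<noteq> \<zero>}" by (rule finite_subset)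
      then have 2: "f2 \<in> carrier ?F"
        using f by (auto simp: f2_def simp del: fun_upd_apply) (auto simp: fun_upd_apply)
      have "f = f1 \<oplus>\<^bsub>?G\<^esub> f2" using f by (auto simp: f1_def f2_def)
      then show "f \<in> ideal_power I (insert y X) <+>\<^bsub>?G\<^esub> (\<lambda>f. f) ` carrier ?F"
        using set_addI[OF 1, of f2 "carrier ?F" ?G] 2 by simp
    qed
  qed
  also have "interval_length R ?G (ideal_power I (insert y X))
               (ideal_power I (insert y X) <+>\<^bsub>?G\<^esub> (\<lambda>f. f) ` carrier ?F)
           = interval_length R ?F {f \<in> carrier ?F. f \<in> ideal_power I (insert y X)} (carrier ?F)"
    by (rule interval_length_vimage[OF F.module_axioms G.module_axioms inc P, symmetric])
  also have "{f \<in> carrier ?F. f \<in> ideal_power I (insert y X)} = ideal_power I X"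
    by (auto simp: ideal_power_def)
  also have "interval_length R ?F (ideal_power I X) (carrier ?F)
           = of_nat (card X) * interval_length R ?M I (carrier R)"
    by (rule insert.IH)
  finally show ?case using insert(1,2) by (simp add: algebra_simps)
qed

lemma ideal_power_cgenideal:
  assumes "finite X" "x \<in> carrier R"
  shows "ideal_power (PIdl x) X = (\<lambda>w. x \<odot>\<^bsub>free_module R X\<^esub> w) ` carrier (free_module R X)"
proof
  show "ideal_power (PIdl x) X \<subseteq> (\<lambda>w. x \<odot>\<^bsub>free_module R X\<^esub> w) ` carrier (free_module R X)"
  proof
    fix f assume f: "f \<in> ideal_power (PIdl x) X"
    have "\<forall>p. f p \<in> PIdl x" using f by (simp add: ideal_power_def)
    then have "\<forall>p. \<exists>r. r \<in> carrier R \<and> f p = x \<otimes> r"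
      using assms(2) unfolding cgenideal_def by (auto, metis m_comm)
    then obtain w where w: "\<And>p. w p \<in> carrier R" "\<And>p. f p = x \<otimes> w p" by metis
    \<comment> \<open>The quotients \<open>w p\<close> come from a choice that is unconstrained
      outside \<open>X\<close>, so they are cut off there to give an element of the free
      module.\<close>
    define W where "W p = (if p \<in> X then w p else \<zero>)" for p
    have "W \<in> carrier (free_module R X)"
      using w(1) unfolding free_module_finite_carrier[OF assms(1)] by (auto simp: W_def)
    moreover have "f = x \<odot>\<^bsub>free_module R X\<^esub> W"
      using f w assms(2) by (auto simp: W_def fun_eq_iff ideal_power_def)
    ultimately show "f \<in> (\<lambda>w. x \<odot>\<^bsub>free_module R X\<^esub> w) ` carrier (free_module R X)" by blast
  qed
  show "(\<lambda>w. x \<odot>\<^bsub>free_module R X\<^esub> w) ` carrier (free_module R X) \<subseteq> ideal_power (PIdl x) X"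
  proof
    fix f assume "f \<in> (\<lambda>w. x \<odot>\<^bsub>free_module R X\<^esub> w) ` carrier (free_module R X)"
    then obtain w where w: "w \<in> carrier (free_module R X)" "f = x \<odot>\<^bsub>free_module R X\<^esub> w" by blast
    interpret F: module R "free_module R X" by (rule free_module_is_module)
    have "f \<in> carrier (free_module R X)" unfolding w(2) by (rule F.smult_closed[OF assms(2) w(1)])
    moreover have "f p \<in> PIdl x" for p
      using w assms(2) m_comm[of x "w p"] by (auto simp: cgenideal_def)
    ultimately show "f \<in> ideal_power (PIdl x) X" by (simp add: ideal_power_def)
  qed
qed

end

section \<open>Finite sums and maps out of free modules\<close>

lemma (in abelian_monoid) finsum_swap:
  assumes "finite I" "finite J" "\<And>i j. i \<in> I \<Longrightarrow> j \<in> J \<Longrightarrow> f i j \<in> carrier G"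
  shows "(\<Oplus>i\<in>I. \<Oplus>j\<in>J. f i j) = (\<Oplus>j\<in>J. \<Oplus>i\<in>I. f i j)"
  using assms(1,3)
proof (induction I rule: finite_induct)
  case empty
  then show ?case by simp
next
  case (insert i I)
  have "(\<Oplus>i\<in>insert i I. \<Oplus>j\<in>J. f i j) = (\<Oplus>j\<in>J. f i j) \<oplus> (\<Oplus>i\<in>I. \<Oplus>j\<in>J. f i j)"
    using insert by (intro finsum_insert) (auto intro!: finsum_closed)
  also have "(\<Oplus>i\<in>I. \<Oplus>j\<in>J. f i j) = (\<Oplus>j\<in>J. \<Oplus>i\<in>I. f i j)" using insert by auto
  also have "(\<Oplus>j\<in>J. f i j) \<oplus> (\<Oplus>j\<in>J. \<Oplus>i\<in>I. f i j) = (\<Oplus>j\<in>J. f i j \<oplus> (\<Oplus>i\<in>I. f i j))"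
    using insert by (intro finsum_addf[symmetric]) (auto intro!: finsum_closed)
  also have "\<dots> = (\<Oplus>j\<in>J. \<Oplus>i\<in>insert i I. f i j)"
    using insert by (intro finsum_cong') (auto intro!: finsum_closed finsum_insert[symmetric])
  finally show ?case .
qed

lemma (in abelian_monoid) finsum_single:
  assumes "finite J" "i \<in> J" "f i \<in> carrier G" "\<And>j. j \<in> J \<Longrightarrow> j \<noteq> i \<Longrightarrow> f j = \<zero>"
  shows "(\<Oplus>j\<in>J. f j) = f i"
proof -
  have "(\<Oplus>j\<in>J. f j) = (\<Oplus>j\<in>J. if i = j then f i else \<zero>)"
    using assms by (intro finsum_cong') auto
  also have "\<dots> = f i" using assms by (intro finsum_singleton[of i J "\<lambda>_. f i"]) auto
  finally show ?thesis .
qed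

context cring
begin

lemma free_module_expansion:
  assumes "finite X" "v \<in> carrier (free_module R X)"
  shows "v = (\<Oplus>\<^bsub>free_module R X\<^esub> k\<in>X. v k \<odot>\<^bsub>free_module R X\<^esub> free_gen R k)"
proof -
  interpret F: module R "free_module R X" by (rule free_module_is_module)
  have "v k \<odot>\<^bsub>free_module R X\<^esub> free_gen R k \<in> carrier (free_module R X)" if "k \<in> X" for k
    using that assms(2) free_gen_closed[OF that] by (intro F.smult_closed) auto
  then have "(\<Oplus>\<^bsub>free_module R X\<^esub> k\<in>X. v k \<odot>\<^bsub>free_module R X\<^esub> free_gen R k)
           = (\<lambda>x. \<Oplus>k\<in>X. (v k \<odot>\<^bsub>free_module R X\<^esub> free_gen R k) x)"
    by (rule free_module_finsum[OF assms(1)])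
  also have "\<dots> = v"
  proof
    fix x
    show "(\<Oplus>k\<in>X. (v k \<odot>\<^bsub>free_module R X\<^esub> free_gen R k) x) = v x"
    proof (cases "x \<in> X")
      case True
      then show ?thesis
        using assms by (subst finsum_single[of X x]) (auto simp: free_gen_def)
    next
      case False
      have "(\<Oplus>k\<in>X. (v k \<odot>\<^bsub>free_module R X\<^esub> free_gen R k) x) = \<zero>"
        using assms False by (intro add.finprod_one_eqI) (auto simp: free_gen_def)
      then show ?thesis using assms(2) False by simp
    qed
  qed
  finally show ?thesis ..
qed

lemma module_hom_free_expansion:
  assumes "finite X" "module R N" "h \<in> module_hom R (free_module R X) N" "v \<in> carrier (free_module R X)"
  shows "h v = (\<Oplus>\<^bsub>N\<^esub> k\<in>X. v k \<odot>\<^bsub>N\<^esub> h (free_gen R k))"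
proof -
  let ?F = "free_module R X"
  interpret F: module R ?F by (rule free_module_is_module)
  interpret N: module R N by fact
  have g: "free_gen R k \<in> carrier ?F" if "k \<in> X" for k by (rule free_gen_closed[OF that])
  have v: "v k \<in> carrier R" for k using assms(4) by simp
  have "h v = h (\<Oplus>\<^bsub>?F\<^esub> k\<in>X. v k \<odot>\<^bsub>?F\<^esub> free_gen R k)"
    using free_module_expansion[OF assms(1,4)] by simp
  also have "\<dots> = (\<Oplus>\<^bsub>N\<^esub> k\<in>X. h (v k \<odot>\<^bsub>?F\<^esub> free_gen R k))"
    using g v by (intro module_hom_finsum[OF F.module_axioms assms(2,3,1)] F.smult_closed)
  also have "\<dots> = (\<Oplus>\<^bsub>N\<^esub> k\<in>X. v k \<odot>\<^bsub>N\<^esub> h (free_gen R k))"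
    using g v module_homD(1,3)[OF assms(3)]
    by (intro N.finsum_cong') (auto simp del: free_module_simps)
  finally show ?thesis .
qed

text \<open>The universal property is stated for arbitrary \<open>X\<close>, because the tensor
  product is a quotient of the free module on all pairs, which may be infinite.\<close>

lemma free_module_extension:
  assumes "module R N" "\<And>x. x \<in> X \<Longrightarrow> g x \<in> carrier N"
  shows "\<exists>h\<in>module_hom R (free_module R X) N. \<forall>x\<in>X. h (free_gen R x) = g x"
proof -
  interpret N: module R N by fact
  let ?F = "free_module R X"
  interpret F: module R ?F by (rule free_module_is_module)
  define h where "h t = (\<Oplus>\<^bsub>N\<^esub> x\<in>{x. t x \<noteq> \<zero>}. t x \<odot>\<^bsub>N\<^esub> g x)" for t
  have cl: "t x \<odot>\<^bsub>N\<^esub> g x \<in> carrier N" if "t \<in> carrier ?F" "x \<in> X" for t x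
    using that assms(2) by auto
  \<comment> \<open>Any finite set containing the support may serve as index set; this makes the
    sums for \<open>t\<close>, \<open>t'\<close> and their sum comparable.\<close>
  have h: "h t = (\<Oplus>\<^bsub>N\<^esub> x\<in>S. t x \<odot>\<^bsub>N\<^esub> g x)"
    if "t \<in> carrier ?F" "finite S" "{x. t x \<noteq> \<zero>} \<subseteq> S" "S \<subseteq> X" for t S
    unfolding h_def
    using that cl[OF that(1)] assms(2) by (intro N.add.finprod_mono_neutral_cong_left) auto
  have supp: "finite {x. t x \<noteq> \<zero>}" "{x. t x \<noteq> \<zero>} \<subseteq> X" if "t \<in> carrier ?F" for t
    using that by auto
  have "h \<in> module_hom R ?F N"
  proof (rule module_homI)
    show "h t \<in> carrier N" if "t \<in> carrier ?F" for t
      unfolding h_def using cl[OF that] supp[OF that] by (intro N.finsum_closed) auto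
    fix t t' assume t: "t \<in> carrier ?F" and t': "t' \<in> carrier ?F"
    let ?S = "{x. t x \<noteq> \<zero>} \<union> {x. t' x \<noteq> \<zero>}"
    have S: "finite ?S" "?S \<subseteq> X" using supp t t' by auto
    have tc: "t x \<in> carrier R" "t' x \<in> carrier R" for x using t t' by auto
    have "h (t \<oplus>\<^bsub>?F\<^esub> t') = (\<Oplus>\<^bsub>N\<^esub> x\<in>?S. (t x \<oplus> t' x) \<odot>\<^bsub>N\<^esub> g x)"
    proof (subst h[of _ ?S])
      show "{x. (t \<oplus>\<^bsub>?F\<^esub> t') x \<noteq> \<zero>} \<subseteq> ?S" by auto
    qed (use F.a_closed[OF t t'] S in auto)
    also have "\<dots> = (\<Oplus>\<^bsub>N\<^esub> x\<in>?S. t x \<odot>\<^bsub>N\<^esub> g x \<oplus>\<^bsub>N\<^esub> t' x \<odot>\<^bsub>N\<^esub> g x)"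
      using tc S assms(2) by (intro N.finsum_cong') (auto simp: N.smult_l_distr subset_iff)
    also have "\<dots> = (\<Oplus>\<^bsub>N\<^esub> x\<in>?S. t x \<odot>\<^bsub>N\<^esub> g x) \<oplus>\<^bsub>N\<^esub> (\<Oplus>\<^bsub>N\<^esub> x\<in>?S. t' x \<odot>\<^bsub>N\<^esub> g x)"
      using cl[OF t] cl[OF t'] S by (intro N.finsum_addf) (auto simp: subset_iff)
    also have "\<dots> = h t \<oplus>\<^bsub>N\<^esub> h t'"
      using h[OF t S(1) _ S(2)] h[OF t' S(1) _ S(2)] by auto
    finally show "h (t \<oplus>\<^bsub>?F\<^esub> t') = h t \<oplus>\<^bsub>N\<^esub> h t'" .
  next
    fix a t assume a: "a \<in> carrier R" and t: "t \<in> carrier ?F"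
    let ?S = "{x. t x \<noteq> \<zero>}"
    have "h (a \<odot>\<^bsub>?F\<^esub> t) = (\<Oplus>\<^bsub>N\<^esub> x\<in>?S. (a \<otimes> t x) \<odot>\<^bsub>N\<^esub> g x)"
    proof (subst h[of _ ?S])
      show "{x. (a \<odot>\<^bsub>?F\<^esub> t) x \<noteq> \<zero>} \<subseteq> ?S" using a by auto
    qed (use F.smult_closed[OF a t] supp[OF t] in auto)
    also have "\<dots> = (\<Oplus>\<^bsub>N\<^esub> x\<in>?S. a \<odot>\<^bsub>N\<^esub> (t x \<odot>\<^bsub>N\<^esub> g x))"
      using a t cl[OF t] supp[OF t] assms(2) by (intro N.finsum_cong') (auto simp: N.smult_assoc1)
    also have "\<dots> = a \<odot>\<^bsub>N\<^esub> h t"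
      unfolding h_def using a cl[OF t] supp[OF t] by (intro N.finsum_smult_ldistr[symmetric]) auto
    finally show "h (a \<odot>\<^bsub>?F\<^esub> t) = a \<odot>\<^bsub>N\<^esub> h t" .
  qed
  moreover have "h (free_gen R x) = g x" if "x \<in> X" for x
  proof -
    have "h (free_gen R x) = (\<Oplus>\<^bsub>N\<^esub> y\<in>{x}. free_gen R x y \<odot>\<^bsub>N\<^esub> g y)"
      using that free_gen_closed[OF that] by (intro h) (auto simp: free_gen_def)
    then show ?thesis using assms(2)[OF that] by (simp add: free_gen_def)
  qed
  ultimately show ?thesis by blast
qed

text \<open>Gaussian elimination: since \<open>1 - \<mu> j j\<close> is a unit, the equation for
  \<open>a j\<close> can be solved and substituted into the others, whose new coefficients again lie
  in the ideal.\<close>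

lemma nakayama_finite:
  assumes "ideal \<mm> R" and units: "\<And>t. t \<in> \<mm> \<Longrightarrow> \<one> \<ominus> t \<in> Units R"
    and "finite I" "\<And>i. i \<in> I \<Longrightarrow> a i \<in> carrier R"
    and "\<And>i l. i \<in> I \<Longrightarrow> l \<in> I \<Longrightarrow> \<mu> i l \<in> \<mm>"
    and "\<And>i. i \<in> I \<Longrightarrow> a i = (\<Oplus>l\<in>I. \<mu> i l \<otimes> a l)"
    and "i \<in> I"
  shows "a i = \<zero>"
  using assms(3-7)
proof (induction I arbitrary: \<mu> i rule: finite_induct)
  case empty
  from empty.prems(4) show ?case by simp
next
  case (insert j I)
  interpret m: ideal \<mm> R by fact
  have ac: "a l \<in> carrier R" if "l \<in> insert j I" for l using insert.prems(1) that by auto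
  have \<mu>c: "\<mu> k l \<in> carrier R" if "k \<in> insert j I" "l \<in> insert j I" for k l
    using insert.prems(2)[of k l] that m.Icarr by auto
  have split: "a k = \<mu> k j \<otimes> a j \<oplus> (\<Oplus>l\<in>I. \<mu> k l \<otimes> a l)" if "k \<in> insert j I" for k
    using insert.hyps ac \<mu>c that
    by (subst insert.prems(3)[OF that], subst finsum_insert) auto
  define t where "t = \<mu> j j"
  have t: "t \<in> \<mm>" "t \<in> carrier R" using insert.prems(2) \<mu>c by (auto simp: t_def)
  define u where "u = inv (\<one> \<ominus> t)"
  have u: "u \<in> carrier R" "u \<otimes> (\<one> \<ominus> t) = \<one>" using units[OF t(1)] by (auto simp: u_def)
  define s where "s = (\<Oplus>l\<in>I. \<mu> j l \<otimes> a l)"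
  have s: "s \<in> carrier R" unfolding s_def using ac \<mu>c by (intro finsum_closed) auto
  have aj: "a j = t \<otimes> a j \<oplus> s" using split[of j] by (simp add: t_def s_def)
  have "(\<one> \<ominus> t) \<otimes> a j = a j \<ominus> t \<otimes> a j" using t ac by (simp add: a_minus_def l_distr l_minus)
  also have "\<dots> = s" using aj t ac s by (metis add.inv_solve_right' add.m_comm insertI1 m_closed minus_eq)
  finally have aj': "a j = u \<otimes> s"
    using u t ac by (metis insertI1 l_one m_assoc minus_closed one_closed)
  have "a k = \<zero>" if k: "k \<in> I" for k
  proof (rule insert.IH[of "\<lambda>k l. \<mu> k j \<otimes> u \<otimes> \<mu> j l \<oplus> \<mu> k l" k, OF _ _ _ k])
    show "a l \<in> carrier R" if "l \<in> I" for l using ac that by auto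
    show "\<mu> k j \<otimes> u \<otimes> \<mu> j l \<oplus> \<mu> k l \<in> \<mm>" if "k \<in> I" "l \<in> I" for k l
      using that u \<mu>c insert.prems(2) by (intro m.a_closed m.I_l_closed) auto
    fix k assume k: "k \<in> I"
    have "\<mu> k j \<otimes> a j = (\<mu> k j \<otimes> u) \<otimes> s" using aj' k u s \<mu>c by (simp add: m_assoc)
    also have "\<dots> = (\<Oplus>l\<in>I. (\<mu> k j \<otimes> u) \<otimes> (\<mu> j l \<otimes> a l))"
      unfolding s_def using k u ac \<mu>c insert.hyps by (intro finsum_rdistr) auto
    finally have "a k = (\<Oplus>l\<in>I. (\<mu> k j \<otimes> u) \<otimes> (\<mu> j l \<otimes> a l)) \<oplus> (\<Oplus>l\<in>I. \<mu> k l \<otimes> a l)"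
      using split[of k] k by simp
    also have "\<dots> = (\<Oplus>l\<in>I. (\<mu> k j \<otimes> u) \<otimes> (\<mu> j l \<otimes> a l) \<oplus> \<mu> k l \<otimes> a l)"
      using k u ac \<mu>c by (intro finsum_addf[symmetric]) auto
    also have "\<dots> = (\<Oplus>l\<in>I. (\<mu> k j \<otimes> u \<otimes> \<mu> j l \<oplus> \<mu> k l) \<otimes> a l)"
      using k u ac \<mu>c by (intro finsum_cong') (auto simp: l_distr m_assoc)
    finally show "a k = (\<Oplus>l\<in>I. (\<mu> k j \<otimes> u \<otimes> \<mu> j l \<oplus> \<mu> k l) \<otimes> a l)" .
  qed
  then have z: "a k = \<zero>" if "k \<in> I" for k using that by blast
  then have "s = \<zero>" unfolding s_def using \<mu>c by (intro add.finprod_one_eqI) auto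
  then have "a j = \<zero>" using aj' u by simp
  then show ?case using z insert.prems(4) by auto
qed

end

section \<open>Exact pairs in algebras\<close>

text \<open>
  In \<open>exact_pair_regular\<close>, \<open>e\<close> cuts out a free submodule \<open>E e\<close> of full rank in \<open>E / {Z. Z A = 0}\<close>,
  and \<open>D = E e + {Z. Z A = 0}\<close> has finite colength. Multiplication by \<open>A\<close> and \<open>B\<close> from the left is an
  exact pair on \<open>E e\<close>; the assumption on \<open>A W A\<close> gives exactness at one of the two places on
  \<open>E / {Z. Z A = 0}\<close>, hence on \<open>E / D\<close>. Counting lengths gives exactness at the other place on \<open>E / D\<close>,
  which applies to \<open>1\<close> because \<open>B A = 0\<close>.
\<close>

lemma exact_pair_regular:
  fixes E (structure)
  assumes E: "module R E" "ring E"
    and smult_left: "\<And>a x y. a \<in> carrier R \<Longrightarrow> x \<in> carrier E \<Longrightarrow> y \<in> carrier E \<Longrightarrow> (a \<odot> x) \<otimes> y = a \<odot> (x \<otimes> y)"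
    and smult_right: "\<And>a x y. a \<in> carrier R \<Longrightarrow> x \<in> carrier E \<Longrightarrow> y \<in> carrier E \<Longrightarrow> x \<otimes> (a \<odot> y) = a \<odot> (x \<otimes> y)"
    and A: "A \<in> carrier E" and B: "B \<in> carrier E" and e: "e \<in> carrier E" "e \<otimes> e = e"
    and AB: "A \<otimes> B = \<zero>" and BA: "B \<otimes> A = \<zero>"
    and kerA: "\<And>W. W \<in> carrier E \<Longrightarrow> A \<otimes> W = \<zero> \<Longrightarrow> \<exists>V\<in>carrier E. W = B \<otimes> V"
    and kerB: "\<And>W. W \<in> carrier E \<Longrightarrow> B \<otimes> W = \<zero> \<Longrightarrow> \<exists>V\<in>carrier E. W = A \<otimes> V"
    and indep: "\<And>C. C \<in> carrier E \<Longrightarrow> C \<otimes> e \<otimes> A = \<zero> \<Longrightarrow> C \<otimes> e = \<zero>"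
    and x: "x \<in> carrier R"
    and rank: "\<And>W. W \<in> carrier E \<Longrightarrow> \<exists>C\<in>carrier E. \<exists>Z\<in>carrier E. x \<odot> W = C \<otimes> e \<oplus> Z \<and> Z \<otimes> A = \<zero>"
    and fin: "interval_length R E {x \<odot> W | W. W \<in> carrier E} (carrier E) \<noteq> \<infinity>"
    and tor: "\<And>W. W \<in> carrier E \<Longrightarrow> A \<otimes> W \<otimes> A = \<zero> \<Longrightarrow> \<exists>Z\<in>carrier E. A \<otimes> W = A \<otimes> Z \<and> Z \<otimes> A = \<zero>"
  shows "\<exists>V\<in>carrier E. A = A \<otimes> V \<otimes> A"
proof -
  interpret E: ring E by fact
  interpret M: module R E by fact
  have lmul: "(\<lambda>W. X \<otimes> W) \<in> module_hom R E E" if "X \<in> carrier E" for X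
    using that by (intro module_homI) (auto simp: E.r_distr smult_right)
  have rmul: "(\<lambda>W. W \<otimes> X) \<in> module_hom R E E" if "X \<in> carrier E" for X
    using that by (intro module_homI) (auto simp: E.l_distr smult_left)
  define N where "N = {Z \<in> carrier E. Z \<otimes> A = \<zero>}"
  have zero: "submodule {\<zero>} R E" by (intro M.submoduleI) auto
  have N: "submodule N R E"
    using submodule_vimage[OF E(1) E(1) rmul[OF A] zero] by (simp add: N_def)
  define D where "D = (\<lambda>C. C \<otimes> e) ` carrier E <+>\<^bsub>E\<^esub> N"
  have D: "submodule D R E"
    unfolding D_def by (intro M.submodule_set_add N submodule_image[OF E(1) E(1) rmul[OF e(1)]] M.carrier_is_submodule)
  have DI: "C \<otimes> e \<oplus> Z \<in> D" if "C \<in> carrier E" "Z \<in> carrier E" "Z \<otimes> A = \<zero>" for C Z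
    unfolding D_def using that by (intro set_addI) (auto simp: N_def)
  have DE: "\<exists>C\<in>carrier E. \<exists>Z\<in>carrier E. W = C \<otimes> e \<oplus> Z \<and> Z \<otimes> A = \<zero>" if "W \<in> D" for W
    using that unfolding D_def N_def by (auto elim!: set_addE)
  have lD: "X \<otimes> W \<in> D" if X: "X \<in> carrier E" and W: "W \<in> D" for X W
  proof -
    obtain C Z where C: "C \<in> carrier E" "Z \<in> carrier E" "W = C \<otimes> e \<oplus> Z" "Z \<otimes> A = \<zero>" using DE[OF W] by auto
    then have "X \<otimes> W = (X \<otimes> C) \<otimes> e \<oplus> X \<otimes> Z" using X e by (simp add: E.r_distr E.m_assoc)
    moreover have "X \<otimes> Z \<otimes> A = \<zero>" using C X A by (simp add: E.m_assoc)
    ultimately show ?thesis using DI[of "X \<otimes> C" "X \<otimes> Z"] C X by simp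
  qed
  \<comment> \<open>This is exactness on the free part \<open>E e\<close>. As
    \<open>Z A = 0\<close>, the condition \<open>B Q A = 0\<close> becomes
    \<open>(B C) e A = 0\<close>; \<open>indep\<close> cancels \<open>A\<close>, exactness on
    \<open>E\<close> gives \<open>C e = A V\<close>, and idempotence of \<open>e\<close> brings the
    right-hand side back into \<open>E e\<close>.\<close>
  have free: "\<exists>V\<in>carrier E. C \<otimes> e = A \<otimes> V \<otimes> e"
    if C: "C \<in> carrier E" and Z: "Z \<in> carrier E" "Z \<otimes> A = \<zero>" and Q: "Q \<in> carrier E" "B \<otimes> Q \<otimes> A = \<zero>" and
      eq: "C \<otimes> e \<oplus> Z = Q" for C Z Q
  proof -
    have "\<zero> = B \<otimes> (C \<otimes> e \<oplus> Z) \<otimes> A" using eq Q by simp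
    also have "\<dots> = (B \<otimes> C) \<otimes> e \<otimes> A \<oplus> B \<otimes> (Z \<otimes> A)"
      using B C Z(1) A e(1) by (simp add: E.r_distr E.l_distr E.m_assoc)
    also have "\<dots> = (B \<otimes> C) \<otimes> e \<otimes> A" using B C Z A e(1) by simp
    finally have "(B \<otimes> C) \<otimes> e = \<zero>" using indep[of "B \<otimes> C"] B C by simp
    then have "B \<otimes> (C \<otimes> e) = \<zero>" using B C e by (simp add: E.m_assoc)
    then obtain V where V: "V \<in> carrier E" "C \<otimes> e = A \<otimes> V" using kerB[of "C \<otimes> e"] C e by auto
    have "C \<otimes> e = C \<otimes> e \<otimes> e" using C e by (simp add: E.m_assoc)
    then show ?thesis using V by auto
  qed
  have ex: "{W \<in> carrier E. A \<otimes> W \<in> D} = D <+>\<^bsub>E\<^esub> (\<lambda>W. B \<otimes> W) ` carrier E"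
  proof
    show "D <+>\<^bsub>E\<^esub> (\<lambda>W. B \<otimes> W) ` carrier E \<subseteq> {W \<in> carrier E. A \<otimes> W \<in> D}"
    proof (rule M.set_add_least)
      show "submodule {W \<in> carrier E. A \<otimes> W \<in> D} R E"
        by (rule submodule_vimage[OF E(1) E(1) lmul[OF A] D])
      show "D \<subseteq> {W \<in> carrier E. A \<otimes> W \<in> D}" using lD A M.submoduleE(1)[OF D] by auto
      show "(\<lambda>W. B \<otimes> W) ` carrier E \<subseteq> {W \<in> carrier E. A \<otimes> W \<in> D}"
        using A B AB M.submodule_zero[OF D] by (auto simp: E.m_assoc[symmetric])
    qed
    show "{W \<in> carrier E. A \<otimes> W \<in> D} \<subseteq> D <+>\<^bsub>E\<^esub> (\<lambda>W. B \<otimes> W) ` carrier E"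
    proof
      fix W assume "W \<in> {W \<in> carrier E. A \<otimes> W \<in> D}"
      then have W: "W \<in> carrier E" "A \<otimes> W \<in> D" by auto
      then obtain C Z where C: "C \<in> carrier E" "Z \<in> carrier E" "C \<otimes> e \<oplus> Z = A \<otimes> W" "Z \<otimes> A = \<zero>"
        using DE[OF W(2)] by auto
      have "B \<otimes> (A \<otimes> W) \<otimes> A = \<zero>" using A B BA W(1) by (simp add: E.m_assoc[symmetric])
      then obtain V where V: "V \<in> carrier E" "C \<otimes> e = A \<otimes> V \<otimes> e"
        using free[OF C(1,2,4) _ _ C(3)] A W(1) by auto
      \<comment> \<open>Subtracting \<open>V e\<close>, an element of \<open>D\<close>, cancels the
        free component of \<open>A W\<close>: now \<open>A U = Z\<close> with
        \<open>Z A = 0\<close>, and \<open>tor\<close> applies to \<open>U\<close>.\<close>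
      define U where "U = W \<ominus> V \<otimes> e"
      have U: "U \<in> carrier E" "W = V \<otimes> e \<oplus> U"
        using W(1) V(1) e by (auto simp: U_def a_minus_def E.a_ac E.r_neg)
      have "A \<otimes> W = A \<otimes> V \<otimes> e \<oplus> A \<otimes> U" using U V(1) A e by (simp add: E.r_distr E.m_assoc)
      then have "A \<otimes> U = Z" using C V U A e by (metis E.add.l_cancel E.m_closed)
      then obtain Z' where Z': "Z' \<in> carrier E" "A \<otimes> U = A \<otimes> Z'" "Z' \<otimes> A = \<zero>"
        using tor[OF U(1)] C(4) by auto
      have "A \<otimes> (U \<ominus> Z') = \<zero>" using A U Z' by (simp add: a_minus_def E.r_distr E.r_minus E.r_neg)
      then obtain V' where V': "V' \<in> carrier E" "U \<ominus> Z' = B \<otimes> V'"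
        using kerA[of "U \<ominus> Z'"] U Z' by auto
      have "U = Z' \<oplus> B \<otimes> V'" unfolding V'(2)[symmetric] using U(1) Z'(1) by (simp add: a_minus_def E.a_ac E.r_neg)
      then have "W = (V \<otimes> e \<oplus> Z') \<oplus> B \<otimes> V'" using U V V' Z' B e by (simp add: E.a_assoc)
      then show "W \<in> D <+>\<^bsub>E\<^esub> (\<lambda>W. B \<otimes> W) ` carrier E"
        using V'(1) DI[OF V(1) Z'(1,3)] by (auto intro!: set_addI)
    qed
  qed
  have "x \<odot> W \<in> D" if W: "W \<in> carrier E" for W
  proof -
    obtain C Z where "C \<in> carrier E" "Z \<in> carrier E" "x \<odot> W = C \<otimes> e \<oplus> Z" "Z \<otimes> A = \<zero>"
      using rank[OF W] by auto
    then show ?thesis using DI[of C Z] by simp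
  qed
  then have "{x \<odot> W | W. W \<in> carrier E} \<subseteq> D" by auto
  then have "interval_length R E D (carrier E) \<noteq> \<infinity>"
    using fin interval_length_mono[of "{x \<odot> W | W. W \<in> carrier E}" D "carrier E" "carrier E" R E]
    by (cases "interval_length R E D (carrier E)") auto
  then have "{W \<in> carrier E. B \<otimes> W \<in> D} = D <+>\<^bsub>E\<^esub> (\<lambda>W. A \<otimes> W) ` carrier E"
    using lD A B BA M.submodule_zero[OF D]
    by (intro exact_pair_exact[OF E(1) E(1) lmul[OF A] lmul[OF B] D D _ _ refl _ ex])
       (auto simp: E.m_assoc[symmetric])
  \<comment> \<open>\<open>B\<close> itself lies in \<open>D\<close> because \<open>B A = 0\<close>,
    so the identity is a cycle; the exactness just obtained makes it a boundary up to an element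
    \<open>d\<close> of \<open>D\<close>.\<close>
  moreover have "\<one> \<in> {W \<in> carrier E. B \<otimes> W \<in> D}" using DI[of \<zero> B] B BA e by simp
  ultimately obtain d V where d: "d \<in> D" "V \<in> carrier E" "\<one> = d \<oplus> A \<otimes> V" by (auto elim!: set_addE)
  obtain C Z where C: "C \<in> carrier E" "Z \<in> carrier E" "d = C \<otimes> e \<oplus> Z" "Z \<otimes> A = \<zero>" using DE[OF d(1)] by auto
  have dc: "d \<in> carrier E" using C e by simp
  \<comment> \<open>This is the hypothesis of \<open>free\<close> for \<open>d\<close>, which
    rewrites the free component of \<open>d\<close> as a left multiple of \<open>A\<close>. Only a
    summand killed by \<open>A\<close> from the right is then left over in the decomposition of the
    identity.\<close>
  have "B \<otimes> d \<otimes> A = \<zero>"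
  proof -
    have "\<zero> = B \<otimes> (d \<oplus> A \<otimes> V) \<otimes> A" using d(3)[symmetric] B BA by simp
    also have "\<dots> = B \<otimes> d \<otimes> A \<oplus> (B \<otimes> A) \<otimes> V \<otimes> A"
      using B A d(2) dc by (simp add: E.r_distr E.l_distr E.m_assoc)
    also have "\<dots> = B \<otimes> d \<otimes> A" using B A BA d(2) dc by simp
    finally show ?thesis ..
  qed
  then obtain V' where V': "V' \<in> carrier E" "C \<otimes> e = A \<otimes> V' \<otimes> e"
    using free[OF C(1,2,4) dc _ C(3)[symmetric]] by auto
  have "A = (C \<otimes> e \<oplus> Z \<oplus> A \<otimes> V) \<otimes> A" using E.l_one[OF A] unfolding d(3) C(3) by (rule sym)
  also have "\<dots> = A \<otimes> (V' \<otimes> e) \<otimes> A \<oplus> Z \<otimes> A \<oplus> A \<otimes> V \<otimes> A"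
    using A C V' d(2) e by (simp add: E.l_distr E.m_assoc)
  also have "\<dots> = A \<otimes> (V' \<otimes> e \<oplus> V) \<otimes> A"
    using A C V' d(2) e by (simp add: E.l_distr E.r_distr)
  finally show ?thesis using V' d(2) e by (intro bexI[of _ "V' \<otimes> e \<oplus> V"]) auto
qed

section \<open>Matrices\<close>

text \<open>The locale \<open>module\<close> never looks at the fields \<open>mult\<close> and
  \<open>one\<close>, so a free module can receive a ring multiplication afterwards and keep all its
  module facts.\<close>

lemma module_mult_one_update:
  "module R (M\<lparr>monoid.mult := f, one := g\<rparr>) \<longleftrightarrow> module R M"
  by (simp add: module_def module_axioms_def abelian_group_def abelian_monoid_def
      abelian_group_axioms_def)

lemma submodule_mult_one_update:
  "submodule H R (M\<lparr>monoid.mult := f, one := g\<rparr>) \<longleftrightarrow> submodule H R M"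
  by (simp add: submodule_def submodule_axioms_def)

lemma interval_length_mult_one_update:
  "interval_length R (M\<lparr>monoid.mult := f, one := g\<rparr>) = interval_length R M"
  by (simp add: fun_eq_iff interval_length_def submodule_chain_def submodule_mult_one_update)

text \<open>A single record is to be both a ring and an \<open>R\<close>-module, so only two fields
  of the free module on index pairs are replaced. Entries outside the range are zero, which makes
  equality of matrices equality of functions.\<close>

definition mat_ring :: "('a, 'r) ring_scheme \<Rightarrow> nat \<Rightarrow> ('a, nat \<times> nat \<Rightarrow> 'a) module" where
  "mat_ring R n = (free_module R ({..<n} \<times> {..<n}))
     \<lparr>monoid.mult := (\<lambda>V W (i, j).
        if i < n \<and> j < n then \<Oplus>\<^bsub>R\<^esub>k\<in>{..<n}. V (i, k) \<otimes>\<^bsub>R\<^esub> W (k, j) else \<zero>\<^bsub>R\<^esub>),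
      one := (\<lambda>(i, j). if i = j \<and> i < n then \<one>\<^bsub>R\<^esub> else \<zero>\<^bsub>R\<^esub>)\<rparr>"

lemma mat_ring_simps [simp]:
  "\<zero>\<^bsub>mat_ring R n\<^esub> = (\<lambda>_. \<zero>\<^bsub>R\<^esub>)"
  "V \<oplus>\<^bsub>mat_ring R n\<^esub> W = (\<lambda>p. V p \<oplus>\<^bsub>R\<^esub> W p)"
  "a \<odot>\<^bsub>mat_ring R n\<^esub> W = (\<lambda>p. a \<otimes>\<^bsub>R\<^esub> W p)"
  "(V \<otimes>\<^bsub>mat_ring R n\<^esub> W) (i, j)
     = (if i < n \<and> j < n then \<Oplus>\<^bsub>R\<^esub>k\<in>{..<n}. V (i, k) \<otimes>\<^bsub>R\<^esub> W (k, j) else \<zero>\<^bsub>R\<^esub>)"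
  "\<one>\<^bsub>mat_ring R n\<^esub> (i, j) = (if i = j \<and> i < n then \<one>\<^bsub>R\<^esub> else \<zero>\<^bsub>R\<^esub>)"
  by (simp_all add: mat_ring_def free_module_def)

text \<open>Column \<open>k\<close> is the image of the \<open>k\<close>-th basis vector, so that
  left multiplication applies \<open>h\<close> to each column.\<close>

definition mat_of :: "('a, 'r) ring_scheme \<Rightarrow> nat \<Rightarrow> ((nat \<Rightarrow> 'a) \<Rightarrow> (nat \<Rightarrow> 'a)) \<Rightarrow> nat \<times> nat \<Rightarrow> 'a" where
  "mat_of R n h = (\<lambda>(i, k). if i < n \<and> k < n then h (free_gen R k) i else \<zero>\<^bsub>R\<^esub>)"

context cring
begin

lemma mat_ring_carrier: "carrier (mat_ring R n) = carrier (free_module R ({..<n} \<times> {..<n}))"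
  by (simp add: mat_ring_def)

lemma mat_ring_carrier_iff:
  "W \<in> carrier (mat_ring R n) \<longleftrightarrow> (\<forall>i j. W (i, j) \<in> carrier R \<and> (\<not> (i < n \<and> j < n) \<longrightarrow> W (i, j) = \<zero>))"
  by (subst mat_ring_carrier, subst free_module_finite_carrier) auto

lemma mat_ring_closed [simp, intro]: "W \<in> carrier (mat_ring R n) \<Longrightarrow> W p \<in> carrier R"
  by (cases p) (simp add: mat_ring_carrier_iff)

lemma mat_ring_module: "module R (mat_ring R n)"
  unfolding mat_ring_def module_mult_one_update by (rule free_module_is_module)

lemma mat_ring_interval_length:
  "interval_length R (mat_ring R n) = interval_length R (free_module R ({..<n} \<times> {..<n}))"
  unfolding mat_ring_def by (rule interval_length_mult_one_update)

lemma mat_ring_mult_closed: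
  assumes "V \<in> carrier (mat_ring R n)" "W \<in> carrier (mat_ring R n)"
  shows "V \<otimes>\<^bsub>mat_ring R n\<^esub> W \<in> carrier (mat_ring R n)"
  unfolding mat_ring_carrier_iff using assms by (auto intro!: finsum_closed)

lemma mat_ring_ring: "ring (mat_ring R n)"
proof -
  let ?E = "mat_ring R n"
  interpret E: module R ?E by (rule mat_ring_module)
  show ?thesis
  proof (intro ringI monoidI)
    show "abelian_group ?E" ..
    show "V \<otimes>\<^bsub>?E\<^esub> W \<in> carrier ?E" if "V \<in> carrier ?E" "W \<in> carrier ?E" for V W
      using that by (rule mat_ring_mult_closed)
    show "\<one>\<^bsub>?E\<^esub> \<in> carrier ?E" by (simp add: mat_ring_carrier_iff)
    show "U \<otimes>\<^bsub>?E\<^esub> V \<otimes>\<^bsub>?E\<^esub> W = U \<otimes>\<^bsub>?E\<^esub> (V \<otimes>\<^bsub>?E\<^esub> W)"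
      if U: "U \<in> carrier ?E" and V: "V \<in> carrier ?E" and W: "W \<in> carrier ?E" for U V W
    proof
      fix p :: "nat \<times> nat"
      obtain i j where p: "p = (i, j)" by (cases p)
      show "(U \<otimes>\<^bsub>?E\<^esub> V \<otimes>\<^bsub>?E\<^esub> W) p = (U \<otimes>\<^bsub>?E\<^esub> (V \<otimes>\<^bsub>?E\<^esub> W)) p"
      proof (cases "i < n \<and> j < n")
        case True
        have "(U \<otimes>\<^bsub>?E\<^esub> V \<otimes>\<^bsub>?E\<^esub> W) p = (\<Oplus>k\<in>{..<n}. (\<Oplus>l\<in>{..<n}. U (i, l) \<otimes> V (l, k)) \<otimes> W (k, j))"
          unfolding p using True U V W by (auto intro!: finsum_cong')
        also have "\<dots> = (\<Oplus>k\<in>{..<n}. \<Oplus>l\<in>{..<n}. U (i, l) \<otimes> V (l, k) \<otimes> W (k, j))"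
          using U V W by (intro finsum_cong' refl finsum_ldistr) auto
        also have "\<dots> = (\<Oplus>l\<in>{..<n}. \<Oplus>k\<in>{..<n}. U (i, l) \<otimes> V (l, k) \<otimes> W (k, j))"
          using U V W by (intro finsum_swap) auto
        also have "\<dots> = (\<Oplus>l\<in>{..<n}. U (i, l) \<otimes> (\<Oplus>k\<in>{..<n}. V (l, k) \<otimes> W (k, j)))"
        proof (intro finsum_cong' refl)
          fix l
          have "U (i, l) \<otimes> (\<Oplus>k\<in>{..<n}. V (l, k) \<otimes> W (k, j)) = (\<Oplus>k\<in>{..<n}. U (i, l) \<otimes> (V (l, k) \<otimes> W (k, j)))"
            using U V W by (intro finsum_rdistr) auto
          also have "\<dots> = (\<Oplus>k\<in>{..<n}. U (i, l) \<otimes> V (l, k) \<otimes> W (k, j))"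
            using U V W by (intro finsum_cong') (auto simp: m_assoc)
          finally show "(\<Oplus>k\<in>{..<n}. U (i, l) \<otimes> V (l, k) \<otimes> W (k, j)) = U (i, l) \<otimes> (\<Oplus>k\<in>{..<n}. V (l, k) \<otimes> W (k, j))"
            by simp
        qed (use U V W in \<open>auto intro!: finsum_closed\<close>)
        also have "\<dots> = (U \<otimes>\<^bsub>?E\<^esub> (V \<otimes>\<^bsub>?E\<^esub> W)) p"
          unfolding p using True U V W by (auto intro!: finsum_cong')
        finally show ?thesis .
      qed (auto simp: p)
    qed
    show "\<one>\<^bsub>?E\<^esub> \<otimes>\<^bsub>?E\<^esub> V = V" if V: "V \<in> carrier ?E" for V
    proof
      fix p :: "nat \<times> nat"
      obtain i j where p: "p = (i, j)" by (cases p)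
      have "(\<Oplus>k\<in>{..<n}. \<one>\<^bsub>?E\<^esub> (i, k) \<otimes> V (k, j)) = V (i, j)" if "i < n"
        using V that by (subst finsum_single[of "{..<n}" i]) auto
      then show "(\<one>\<^bsub>?E\<^esub> \<otimes>\<^bsub>?E\<^esub> V) p = V p"
        using V unfolding p by (auto simp: mat_ring_carrier_iff simp del: mat_ring_simps(5))
    qed
    show "V \<otimes>\<^bsub>?E\<^esub> \<one>\<^bsub>?E\<^esub> = V" if V: "V \<in> carrier ?E" for V
    proof
      fix p :: "nat \<times> nat"
      obtain i j where p: "p = (i, j)" by (cases p)
      have "(\<Oplus>k\<in>{..<n}. V (i, k) \<otimes> \<one>\<^bsub>?E\<^esub> (k, j)) = V (i, j)" if "j < n"
        using V that by (subst finsum_single[of "{..<n}" j]) auto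
      then show "(V \<otimes>\<^bsub>?E\<^esub> \<one>\<^bsub>?E\<^esub>) p = V p"
        using V unfolding p by (auto simp: mat_ring_carrier_iff simp del: mat_ring_simps(5))
    qed
    show "(U \<oplus>\<^bsub>?E\<^esub> V) \<otimes>\<^bsub>?E\<^esub> W = U \<otimes>\<^bsub>?E\<^esub> W \<oplus>\<^bsub>?E\<^esub> V \<otimes>\<^bsub>?E\<^esub> W"
      if U: "U \<in> carrier ?E" and V: "V \<in> carrier ?E" and W: "W \<in> carrier ?E" for U V W
    proof
      fix p :: "nat \<times> nat"
      obtain i j where p: "p = (i, j)" by (cases p)
      have "(\<Oplus>k\<in>{..<n}. (U (i, k) \<oplus> V (i, k)) \<otimes> W (k, j))
          = (\<Oplus>k\<in>{..<n}. U (i, k) \<otimes> W (k, j) \<oplus> V (i, k) \<otimes> W (k, j))"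
        using U V W by (intro finsum_cong') (auto simp: l_distr)
      also have "\<dots> = (\<Oplus>k\<in>{..<n}. U (i, k) \<otimes> W (k, j)) \<oplus> (\<Oplus>k\<in>{..<n}. V (i, k) \<otimes> W (k, j))"
        using U V W by (intro finsum_addf) auto
      finally show "((U \<oplus>\<^bsub>?E\<^esub> V) \<otimes>\<^bsub>?E\<^esub> W) p = (U \<otimes>\<^bsub>?E\<^esub> W \<oplus>\<^bsub>?E\<^esub> V \<otimes>\<^bsub>?E\<^esub> W) p"
        unfolding p by simp
    qed
    show "W \<otimes>\<^bsub>?E\<^esub> (U \<oplus>\<^bsub>?E\<^esub> V) = W \<otimes>\<^bsub>?E\<^esub> U \<oplus>\<^bsub>?E\<^esub> W \<otimes>\<^bsub>?E\<^esub> V"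
      if U: "U \<in> carrier ?E" and V: "V \<in> carrier ?E" and W: "W \<in> carrier ?E" for U V W
    proof
      fix p :: "nat \<times> nat"
      obtain i j where p: "p = (i, j)" by (cases p)
      have "(\<Oplus>k\<in>{..<n}. W (i, k) \<otimes> (U (k, j) \<oplus> V (k, j)))
          = (\<Oplus>k\<in>{..<n}. W (i, k) \<otimes> U (k, j) \<oplus> W (i, k) \<otimes> V (k, j))"
        using U V W by (intro finsum_cong') (auto simp: r_distr)
      also have "\<dots> = (\<Oplus>k\<in>{..<n}. W (i, k) \<otimes> U (k, j)) \<oplus> (\<Oplus>k\<in>{..<n}. W (i, k) \<otimes> V (k, j))"
        using U V W by (intro finsum_addf) auto
      finally show "(W \<otimes>\<^bsub>?E\<^esub> (U \<oplus>\<^bsub>?E\<^esub> V)) p = (W \<otimes>\<^bsub>?E\<^esub> U \<oplus>\<^bsub>?E\<^esub> W \<otimes>\<^bsub>?E\<^esub> V) p"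
        unfolding p by simp
    qed
  qed
qed

lemma mat_ring_smult_left:
  assumes a: "a \<in> carrier R" and V: "V \<in> carrier (mat_ring R n)" and W: "W \<in> carrier (mat_ring R n)"
  shows "(a \<odot>\<^bsub>mat_ring R n\<^esub> V) \<otimes>\<^bsub>mat_ring R n\<^esub> W = a \<odot>\<^bsub>mat_ring R n\<^esub> (V \<otimes>\<^bsub>mat_ring R n\<^esub> W)"
proof
  fix p :: "nat \<times> nat"
  obtain i j where p: "p = (i, j)" by (cases p)
  have "(\<Oplus>k\<in>{..<n}. a \<otimes> V (i, k) \<otimes> W (k, j)) = (\<Oplus>k\<in>{..<n}. a \<otimes> (V (i, k) \<otimes> W (k, j)))"
    using a V W by (intro finsum_cong') (auto simp: m_assoc)
  also have "\<dots> = a \<otimes> (\<Oplus>k\<in>{..<n}. V (i, k) \<otimes> W (k, j))"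
    using a V W by (intro finsum_rdistr[symmetric]) auto
  finally show "((a \<odot>\<^bsub>mat_ring R n\<^esub> V) \<otimes>\<^bsub>mat_ring R n\<^esub> W) p = (a \<odot>\<^bsub>mat_ring R n\<^esub> (V \<otimes>\<^bsub>mat_ring R n\<^esub> W)) p"
    unfolding p using a by simp
qed

lemma mat_ring_smult_right:
  assumes a: "a \<in> carrier R" and V: "V \<in> carrier (mat_ring R n)" and W: "W \<in> carrier (mat_ring R n)"
  shows "V \<otimes>\<^bsub>mat_ring R n\<^esub> (a \<odot>\<^bsub>mat_ring R n\<^esub> W) = a \<odot>\<^bsub>mat_ring R n\<^esub> (V \<otimes>\<^bsub>mat_ring R n\<^esub> W)"
proof
  fix p :: "nat \<times> nat"
  obtain i j where p: "p = (i, j)" by (cases p)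
  have "(\<Oplus>k\<in>{..<n}. V (i, k) \<otimes> (a \<otimes> W (k, j))) = (\<Oplus>k\<in>{..<n}. a \<otimes> (V (i, k) \<otimes> W (k, j)))"
    using a V W by (intro finsum_cong') (auto simp: m_lcomm)
  also have "\<dots> = a \<otimes> (\<Oplus>k\<in>{..<n}. V (i, k) \<otimes> W (k, j))"
    using a V W by (intro finsum_rdistr[symmetric]) auto
  finally show "(V \<otimes>\<^bsub>mat_ring R n\<^esub> (a \<odot>\<^bsub>mat_ring R n\<^esub> W)) p = (a \<odot>\<^bsub>mat_ring R n\<^esub> (V \<otimes>\<^bsub>mat_ring R n\<^esub> W)) p"
    unfolding p using a by simp
qed

text \<open>The multiples of \<open>x\<close> are the matrices with all entries in
  \<open>PIdl x\<close>, so the colength is \<open>n * n\<close> times that of \<open>PIdl x\<close>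
  in \<open>R\<close>.\<close>

lemma mat_ring_finite_colength:
  assumes "x \<in> carrier R" and "interval_length R (regular_module R) (PIdl x) (carrier R) \<noteq> \<infinity>"
  shows "interval_length R (mat_ring R n) {x \<odot>\<^bsub>mat_ring R n\<^esub> W | W. W \<in> carrier (mat_ring R n)} (carrier (mat_ring R n)) \<noteq> \<infinity>"
proof -
  let ?X = "{..<n} \<times> {..<n}"
  have "{x \<odot>\<^bsub>mat_ring R n\<^esub> W | W. W \<in> carrier (mat_ring R n)} = ideal_power (PIdl x) ?X"
    unfolding ideal_power_cgenideal[OF finite_cartesian_product[OF finite_lessThan finite_lessThan] assms(1)]
    by (auto simp: mat_ring_carrier simp del: free_module_simps(1))
  then have "interval_length R (mat_ring R n) {x \<odot>\<^bsub>mat_ring R n\<^esub> W | W. W \<in> carrier (mat_ring R n)} (carrier (mat_ring R n))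
     = interval_length R (mat_ring R n) (ideal_power (PIdl x) ?X) (carrier (mat_ring R n))" by simp
  also have "\<dots> = of_nat (card ?X) * interval_length R (regular_module R) (PIdl x) (carrier R)"
    unfolding mat_ring_interval_length mat_ring_carrier
    by (rule interval_length_ideal_power[OF cgenideal_ideal[OF assms(1)]]) simp
  also have "\<dots> < \<infinity>"
    using assms(2) by (cases "interval_length R (regular_module R) (PIdl x) (carrier R)")
      (auto simp: of_nat_eq_enat)
  finally show ?thesis by auto
qed

lemma mat_of_closed:
  assumes "h \<in> module_hom R (free_module R {..<n}) (free_module R {..<n})"
  shows "mat_of R n h \<in> carrier (mat_ring R n)"
  using module_homD(1)[OF assms free_gen_closed] by (auto simp: mat_ring_carrier_iff mat_of_def)

lemma mat_column_closed:
  assumes "W \<in> carrier (mat_ring R n)"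
  shows "(\<lambda>k. W (k, j)) \<in> carrier (free_module R {..<n})"
  using assms by (subst free_module_finite_carrier) (auto simp: mat_ring_carrier_iff)

lemma hom_free_apply:
  fixes n :: nat
  assumes h: "h \<in> module_hom R (free_module R {..<n}) (free_module R X)"
    and v: "v \<in> carrier (free_module R {..<n})"
  shows "h v i = (\<Oplus>k\<in>{..<n}. v k \<otimes> h (free_gen R k) i)"
proof -
  interpret F: module R "free_module R X" by (rule free_module_is_module)
  have "h v = (\<Oplus>\<^bsub>free_module R X\<^esub> k\<in>{..<n}. v k \<odot>\<^bsub>free_module R X\<^esub> h (free_gen R k))"
    by (rule module_hom_free_expansion[OF _ F.module_axioms h v]) simp
  also have "\<dots> = (\<lambda>x. \<Oplus>k\<in>{..<n}. (v k \<odot>\<^bsub>free_module R X\<^esub> h (free_gen R k)) x)"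
    using v module_homD(1)[OF h free_gen_closed]
    by (intro free_module_finsum F.smult_closed) auto
  finally show ?thesis by simp
qed

text \<open>The indices may be out of range: for \<open>j \<ge> n\<close> the column of
  \<open>W\<close> is zero, and for \<open>i \<ge> n\<close> every value of \<open>h\<close>
  vanishes at \<open>i\<close>.\<close>

lemma mat_of_mult:
  assumes h: "h \<in> module_hom R (free_module R {..<n}) (free_module R {..<n})"
    and W: "W \<in> carrier (mat_ring R n)"
  shows "(mat_of R n h \<otimes>\<^bsub>mat_ring R n\<^esub> W) (i, j) = h (\<lambda>k. W (k, j)) i"
proof (cases "i < n \<and> j < n")
  case True
  have "(mat_of R n h \<otimes>\<^bsub>mat_ring R n\<^esub> W) (i, j) = (\<Oplus>k\<in>{..<n}. mat_of R n h (i, k) \<otimes> W (k, j))"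
    using True by simp
  also have "\<dots> = (\<Oplus>k\<in>{..<n}. W (k, j) \<otimes> h (free_gen R k) i)"
    using W True module_homD(1)[OF h free_gen_closed]
    by (intro finsum_cong') (auto simp: mat_of_def m_comm)
  also have "\<dots> = h (\<lambda>k. W (k, j)) i"
    by (rule hom_free_apply[OF h mat_column_closed[OF W], symmetric])
  finally show ?thesis .
next
  case False
  have "h (\<lambda>k. W (k, j)) i = \<zero>"
  proof (cases "i < n")
    case True
    then have "(\<lambda>k. W (k, j)) = \<zero>\<^bsub>free_module R {..<n}\<^esub>"
      using False W by (auto simp: mat_ring_carrier_iff)
    then have "h (\<lambda>k. W (k, j)) = \<zero>\<^bsub>free_module R {..<n}\<^esub>"
      using module_hom_zero[OF free_module_is_module free_module_is_module h] by simp
    then show ?thesis by simp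
  qed (use module_homD(1)[OF h mat_column_closed[OF W]] in auto)
  then show ?thesis using False by auto
qed

text \<open>Left multiplication acts on the columns independently, so exactness on vectors can be
  lifted one column at a time.\<close>

lemma mat_of_exact:
  assumes f: "f \<in> module_hom R (free_module R {..<n}) (free_module R {..<n})"
    and g: "g \<in> module_hom R (free_module R {..<n}) (free_module R {..<n})"
    and ex: "{v \<in> carrier (free_module R {..<n}). f v = \<zero>\<^bsub>free_module R {..<n}\<^esub>} = g ` carrier (free_module R {..<n})"
  shows "mat_of R n f \<otimes>\<^bsub>mat_ring R n\<^esub> mat_of R n g = \<zero>\<^bsub>mat_ring R n\<^esub>"
    and "\<And>W. W \<in> carrier (mat_ring R n) \<Longrightarrow> mat_of R n f \<otimes>\<^bsub>mat_ring R n\<^esub> W = \<zero>\<^bsub>mat_ring R n\<^esub> \<Longrightarrow>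
           \<exists>V\<in>carrier (mat_ring R n). W = mat_of R n g \<otimes>\<^bsub>mat_ring R n\<^esub> V"
proof -
  let ?E = "mat_ring R n" and ?F = "free_module R {..<n}"
  note mg = mat_of_closed[OF g]
  show "mat_of R n f \<otimes>\<^bsub>?E\<^esub> mat_of R n g = \<zero>\<^bsub>?E\<^esub>"
  proof
    fix p :: "nat \<times> nat"
    obtain i j where p: "p = (i, j)" by (cases p)
    show "(mat_of R n f \<otimes>\<^bsub>?E\<^esub> mat_of R n g) p = \<zero>\<^bsub>?E\<^esub> p"
    proof (cases "j < n")
      case True
      then have "(\<lambda>k. mat_of R n g (k, j)) = g (free_gen R j)"
        using module_homD(1)[OF g free_gen_closed[of j "{..<n}"]] by (auto simp: mat_of_def)
      then have "f (\<lambda>k. mat_of R n g (k, j)) = (\<lambda>_. \<zero>)"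
        using ex free_gen_closed[of j "{..<n}"] True by auto
      then show ?thesis unfolding p mat_of_mult[OF f mg] by simp
    qed (simp add: p)
  qed
  fix W assume W: "W \<in> carrier ?E" and z: "mat_of R n f \<otimes>\<^bsub>?E\<^esub> W = \<zero>\<^bsub>?E\<^esub>"
  have "\<exists>v. v \<in> carrier ?F \<and> (\<lambda>k. W (k, j)) = g v" for j
  proof -
    have "f (\<lambda>k. W (k, j)) i = \<zero>" for i using mat_of_mult[OF f W, of i j] z by simp
    then have "f (\<lambda>k. W (k, j)) = \<zero>\<^bsub>?F\<^esub>" by auto
    then have "(\<lambda>k. W (k, j)) \<in> g ` carrier ?F"
      using ex mat_column_closed[OF W, of j] by blast
    then show ?thesis by blast
  qed
  then obtain v where v: "\<And>j. v j \<in> carrier ?F" "\<And>j. (\<lambda>k. W (k, j)) = g (v j)" by metis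
  define V where "V = (\<lambda>(k, j). if j < n then v j k else \<zero>)"
  have V: "V \<in> carrier ?E" using v(1) by (auto simp: V_def mat_ring_carrier_iff)
  have "W = mat_of R n g \<otimes>\<^bsub>?E\<^esub> V"
  proof
    fix p :: "nat \<times> nat"
    obtain i j where p: "p = (i, j)" by (cases p)
    show "W p = (mat_of R n g \<otimes>\<^bsub>?E\<^esub> V) p"
    proof (cases "j < n")
      case True
      then have "(\<lambda>k. V (k, j)) = v j" by (simp add: V_def)
      then show ?thesis unfolding p mat_of_mult[OF g V] using v(2)[of j] by (metis)
    qed (use W in \<open>simp add: p mat_ring_carrier_iff\<close>)
  qed
  then show "\<exists>V\<in>carrier ?E. W = mat_of R n g \<otimes>\<^bsub>?E\<^esub> V" using V by blast
qed

end

text \<open>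
  For \<open>S\<close> maximal such that no nonzero row vector supported on \<open>S\<close> is killed by \<open>A\<close>, the matrix \<open>e\<close>
  is the projection onto the columns in \<open>S\<close>.
\<close>

lemma (in domain) mat_ring_independent_columns:
  fixes n
  defines "E \<equiv> mat_ring R n"
  assumes A: "A \<in> carrier E"
  shows "\<exists>e\<in>carrier E. \<exists>x\<in>carrier R - {\<zero>}. e \<otimes>\<^bsub>E\<^esub> e = e \<and>
           (\<forall>C\<in>carrier E. C \<otimes>\<^bsub>E\<^esub> e \<otimes>\<^bsub>E\<^esub> A = \<zero>\<^bsub>E\<^esub> \<longrightarrow> C \<otimes>\<^bsub>E\<^esub> e = \<zero>\<^bsub>E\<^esub>) \<and>
           (\<forall>W\<in>carrier E. \<exists>C\<in>carrier E. \<exists>Z\<in>carrier E. x \<odot>\<^bsub>E\<^esub> W = C \<otimes>\<^bsub>E\<^esub> e \<oplus>\<^bsub>E\<^esub> Z \<and> Z \<otimes>\<^bsub>E\<^esub> A = \<zero>\<^bsub>E\<^esub>)"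
proof -
  interpret E: ring E unfolding E_def by (rule mat_ring_ring)
  interpret M: module R E unfolding E_def by (rule mat_ring_module)
  note Eiff = mat_ring_carrier_iff[of _ n, folded E_def]
  note Esimps = mat_ring_simps[of R n, folded E_def]
  note Ecl = mat_ring_closed[of _ n, folded E_def]
  \<comment> \<open>Row vectors are bundled into square matrices, so that independence can be
    expressed by multiplication in \<open>E\<close>.\<close>
  define cols where "cols S = {C \<in> carrier E. \<forall>i j. j \<notin> S \<longrightarrow> C (i, j) = \<zero>}" for S :: "nat set"
  define indep where "indep S \<longleftrightarrow> (\<forall>C\<in>cols S. C \<otimes>\<^bsub>E\<^esub> A = \<zero>\<^bsub>E\<^esub> \<longrightarrow> C = \<zero>\<^bsub>E\<^esub>)" for S
  have "indep {}" by (auto simp: indep_def cols_def Esimps fun_eq_iff)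
  moreover have "finite {S. S \<subseteq> {..<n} \<and> indep S}" by (rule finite_subset[of _ "Pow {..<n}"]) auto
  ultimately have "\<exists>S\<in>{S. S \<subseteq> {..<n} \<and> indep S}. \<forall>T\<in>{S. S \<subseteq> {..<n} \<and> indep S}. S \<subseteq> T \<longrightarrow> S = T"
    by (intro finite_has_maximal) auto
  then obtain S where "S \<in> {S. S \<subseteq> {..<n} \<and> indep S}"
    and mx': "\<forall>T\<in>{S. S \<subseteq> {..<n} \<and> indep S}. S \<subseteq> T \<longrightarrow> S = T" by (elim bexE)
  then have S: "S \<subseteq> {..<n}" "indep S" by auto
  have mx: "T \<subseteq> {..<n} \<Longrightarrow> indep T \<Longrightarrow> S \<subseteq> T \<Longrightarrow> S = T" for T using mx' by auto
  define e where "e = (\<lambda>(i, j). if i = j \<and> i \<in> S then \<one> else \<zero>)"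
  have e: "e \<in> carrier E" using S(1) by (auto simp: e_def Eiff)
  have me: "(C \<otimes>\<^bsub>E\<^esub> e) (i, j) = (if j \<in> S then C (i, j) else \<zero>)" if C: "C \<in> carrier E" for C i j
  proof (cases "i < n \<and> j < n")
    case True
    have "(\<Oplus>k\<in>{..<n}. C (i, k) \<otimes> e (k, j)) = C (i, j) \<otimes> e (j, j)"
      using True C Ecl e by (intro finsum_single) (auto simp: e_def)
    then show ?thesis using True C Ecl by (auto simp: Esimps e_def)
  qed (use C in \<open>auto simp: Esimps Eiff\<close>)
  have eq_e: "C \<otimes>\<^bsub>E\<^esub> e = C" if "C \<in> cols S" for C
    using that me[of C] by (auto simp: cols_def fun_eq_iff)
  have e_cols: "C \<otimes>\<^bsub>E\<^esub> e \<in> cols S" if "C \<in> carrier E" for C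
    using that me[of C] e by (auto simp: cols_def)
  have "e \<in> cols S" using e by (auto simp: cols_def e_def)
  then have ee: "e \<otimes>\<^bsub>E\<^esub> e = e" by (rule eq_e)
  \<comment> \<open>Columns outside \<open>S\<close> are added one at a time. Each of them
    multiplies the common denominator \<open>x\<close> by one more nonzero entry, and the product
    stays nonzero in a domain.\<close>
  have span: "\<exists>x\<in>carrier R - {\<zero>}. \<forall>W\<in>cols (S \<union> T). \<exists>C\<in>carrier E. \<exists>Z\<in>carrier E.
                x \<odot>\<^bsub>E\<^esub> W = C \<otimes>\<^bsub>E\<^esub> e \<oplus>\<^bsub>E\<^esub> Z \<and> Z \<otimes>\<^bsub>E\<^esub> A = \<zero>\<^bsub>E\<^esub>"
    if "finite T" "T \<subseteq> {..<n} - S" for T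
    using that
  proof (induction T rule: finite_induct)
    case empty
    have "\<exists>C\<in>carrier E. \<exists>Z\<in>carrier E. \<one> \<odot>\<^bsub>E\<^esub> W = C \<otimes>\<^bsub>E\<^esub> e \<oplus>\<^bsub>E\<^esub> Z \<and> Z \<otimes>\<^bsub>E\<^esub> A = \<zero>\<^bsub>E\<^esub>"
      if "W \<in> cols (S \<union> {})" for W
    proof -
      have W: "W \<in> carrier E" "W \<in> cols S" using that by (auto simp: cols_def)
      then show ?thesis using eq_e[OF W(2)] A
        by (intro bexI[of _ W] bexI[of _ "\<zero>\<^bsub>E\<^esub>"]) auto
    qed
    then show ?case by (intro bexI[of _ \<one>]) auto
  next
    case (insert j T)
    then obtain x where x: "x \<in> carrier R" "x \<noteq> \<zero>"
      and IH: "\<And>W. W \<in> cols (S \<union> T) \<Longrightarrow> \<exists>C\<in>carrier E. \<exists>Z\<in>carrier E.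
                x \<odot>\<^bsub>E\<^esub> W = C \<otimes>\<^bsub>E\<^esub> e \<oplus>\<^bsub>E\<^esub> Z \<and> Z \<otimes>\<^bsub>E\<^esub> A = \<zero>\<^bsub>E\<^esub>" by auto
    have j: "j < n" "j \<notin> S" using insert.prems by auto
    \<comment> \<open>Maximality of \<open>S\<close> yields a dependence \<open>C A = 0\<close>
      supported on \<open>S\<close> and \<open>j\<close>. It must involve column \<open>j\<close>,
      because \<open>S\<close> alone is independent; a nonzero entry \<open>C (l, j)\<close> becomes
      the new factor of the denominator.\<close>
    then have "\<not> indep (insert j S)" using mx[of "insert j S"] S(1) by auto
    then obtain C where C: "C \<in> cols (insert j S)" "C \<otimes>\<^bsub>E\<^esub> A = \<zero>\<^bsub>E\<^esub>" "C \<noteq> \<zero>\<^bsub>E\<^esub>"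
      by (auto simp: indep_def)
    then have CE: "C \<in> carrier E" by (simp add: cols_def)
    have "C \<notin> cols S" using C S(2) by (auto simp: indep_def)
    then obtain l k where "k \<notin> S" "C (l, k) \<noteq> \<zero>" using CE by (auto simp: cols_def)
    moreover from this have "k = j" using C(1) by (auto simp: cols_def)
    ultimately have l: "C (l, j) \<noteq> \<zero>" by simp
    then have ln: "l < n" using CE by (auto simp: Eiff)
    let ?y = "C (l, j)"
    have y: "?y \<in> carrier R" using CE by (rule Ecl)
    have "\<exists>C'\<in>carrier E. \<exists>Z\<in>carrier E. (x \<otimes> ?y) \<odot>\<^bsub>E\<^esub> W = C' \<otimes>\<^bsub>E\<^esub> e \<oplus>\<^bsub>E\<^esub> Z \<and> Z \<otimes>\<^bsub>E\<^esub> A = \<zero>\<^bsub>E\<^esub>"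
      if W: "W \<in> cols (S \<union> insert j T)" for W
    proof -
      have WE: "W \<in> carrier E" using W by (simp add: cols_def)
      \<comment> \<open>\<open>G\<close> moves column \<open>j\<close> of \<open>W\<close> to column
        \<open>l\<close>, so row \<open>i\<close> of \<open>G C\<close> is \<open>W (i, j)\<close>
        times row \<open>l\<close> of \<open>C\<close>. Hence \<open>G C\<close> agrees with
        \<open>?y W\<close> in column \<open>j\<close>, and it is killed by \<open>A\<close> from
        the right.\<close>
      define G where "G = (\<lambda>(i, k). if k = l then W (i, j) else \<zero>)"
      have G: "G \<in> carrier E" using WE ln j by (auto simp: G_def Eiff)
      have GC: "(G \<otimes>\<^bsub>E\<^esub> C) (i, k) = W (i, j) \<otimes> C (l, k)" for i k
      proof (cases "i < n \<and> k < n")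
        case True
        have "(\<Oplus>m\<in>{..<n}. G (i, m) \<otimes> C (m, k)) = G (i, l) \<otimes> C (l, k)"
          using WE CE Ecl ln by (intro finsum_single) (auto simp: G_def)
        then show ?thesis using True by (simp add: Esimps G_def)
      next
        case False
        then have "W (i, j) = \<zero> \<or> C (l, k) = \<zero>" using WE CE by (auto simp: Eiff)
        then show ?thesis using False WE CE Ecl by (auto simp: Esimps)
      qed
      define W' where "W' = ?y \<odot>\<^bsub>E\<^esub> W \<ominus>\<^bsub>E\<^esub> G \<otimes>\<^bsub>E\<^esub> C"
      have W'E: "W' \<in> carrier E" using WE G CE y by (simp add: W'_def)
      have eq: "?y \<odot>\<^bsub>E\<^esub> W = W' \<oplus>\<^bsub>E\<^esub> G \<otimes>\<^bsub>E\<^esub> C"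
        using WE G CE y by (simp add: W'_def a_minus_def E.a_assoc E.l_neg )
      have eqp: "?y \<otimes> W (i, k) = W' (i, k) \<oplus> W (i, j) \<otimes> C (l, k)" for i k
        using fun_cong[OF eq, of "(i, k)"] by (simp add: Esimps(2,3) GC)
      have "W' (i, k) = \<zero>" if k: "k \<notin> S \<union> T" for i k
      proof (cases "k = j")
        case True
        have "W' (i, k) \<oplus> W (i, j) \<otimes> ?y = \<zero> \<oplus> W (i, j) \<otimes> ?y"
          using eqp[of i k] True WE y Ecl by (simp add: m_comm)
        then show ?thesis using W'E WE y Ecl by (metis add.r_cancel m_closed zero_closed)
      next
        case False
        then have "W (i, k) = \<zero>" "C (l, k) = \<zero>" using W C(1) k by (auto simp: cols_def)
        then show ?thesis using eqp[of i k] W'E WE y Ecl by simp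
      qed
      then have "W' \<in> cols (S \<union> T)" using W'E by (auto simp: cols_def)
      then obtain C' Z where C': "C' \<in> carrier E" "Z \<in> carrier E" "x \<odot>\<^bsub>E\<^esub> W' = C' \<otimes>\<^bsub>E\<^esub> e \<oplus>\<^bsub>E\<^esub> Z" "Z \<otimes>\<^bsub>E\<^esub> A = \<zero>\<^bsub>E\<^esub>"
        using IH by blast
      define Z' where "Z' = Z \<oplus>\<^bsub>E\<^esub> (x \<odot>\<^bsub>E\<^esub> G) \<otimes>\<^bsub>E\<^esub> C"
      have Z': "Z' \<in> carrier E" using C' G CE x by (simp add: Z'_def )
      have "(x \<otimes> ?y) \<odot>\<^bsub>E\<^esub> W = x \<odot>\<^bsub>E\<^esub> (?y \<odot>\<^bsub>E\<^esub> W)" by (rule M.smult_assoc1[OF x(1) y WE])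
      also have "\<dots> = x \<odot>\<^bsub>E\<^esub> W' \<oplus>\<^bsub>E\<^esub> (x \<odot>\<^bsub>E\<^esub> G) \<otimes>\<^bsub>E\<^esub> C"
        unfolding eq using x W'E G CE mat_ring_smult_left[of x G n C, folded E_def]
        by (simp add: M.smult_r_distr )
      also have "\<dots> = C' \<otimes>\<^bsub>E\<^esub> e \<oplus>\<^bsub>E\<^esub> Z'"
        unfolding C'(3) Z'_def using C' e G CE x by (simp add: E.a_assoc )
      finally have 1: "(x \<otimes> ?y) \<odot>\<^bsub>E\<^esub> W = C' \<otimes>\<^bsub>E\<^esub> e \<oplus>\<^bsub>E\<^esub> Z'" .
      have "Z' \<otimes>\<^bsub>E\<^esub> A = Z \<otimes>\<^bsub>E\<^esub> A \<oplus>\<^bsub>E\<^esub> (x \<odot>\<^bsub>E\<^esub> G) \<otimes>\<^bsub>E\<^esub> (C \<otimes>\<^bsub>E\<^esub> A)"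
        unfolding Z'_def using C' G CE A x by (simp add: E.l_distr E.m_assoc )
      also have "\<dots> = \<zero>\<^bsub>E\<^esub>" unfolding C'(4) C(2) using x G by simp
      finally show ?thesis using 1 C'(1) Z' by blast
    qed
    moreover have "x \<otimes> ?y \<in> carrier R - {\<zero>}" using x y l integral_iff by auto
    ultimately show ?case by blast
  qed
  obtain x where x: "x \<in> carrier R - {\<zero>}"
    and xW: "\<And>W. W \<in> cols (S \<union> ({..<n} - S)) \<Longrightarrow> \<exists>C\<in>carrier E. \<exists>Z\<in>carrier E.
                x \<odot>\<^bsub>E\<^esub> W = C \<otimes>\<^bsub>E\<^esub> e \<oplus>\<^bsub>E\<^esub> Z \<and> Z \<otimes>\<^bsub>E\<^esub> A = \<zero>\<^bsub>E\<^esub>"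
    using span[of "{..<n} - S"] by auto
  have "carrier E \<subseteq> cols (S \<union> ({..<n} - S))" by (auto simp: cols_def Eiff)
  then show ?thesis
    using e x ee xW e_cols S(2) unfolding indep_def by blast
qed

section \<open>Spans, quotients and tensor products\<close>

context module
begin

lemma module_span_subset: "S \<subseteq> module_span R M S"
  by (auto simp: module_span_def)

lemma module_span_minimal: "submodule H R M \<Longrightarrow> S \<subseteq> H \<Longrightarrow> module_span R M S \<subseteq> H"
  by (auto simp: module_span_def)

lemma module_span_submodule:
  assumes "S \<subseteq> carrier M"
  shows "submodule (module_span R M S) R M"
proof -
  have "\<zero>\<^bsub>M\<^esub> \<in> H" "\<And>a. a \<in> H \<Longrightarrow> \<ominus>\<^bsub>M\<^esub> a \<in> H" "\<And>a b. a \<in> H \<Longrightarrow> b \<in> H \<Longrightarrow> a \<oplus>\<^bsub>M\<^esub> b \<in> H"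
    "\<And>r b. r \<in> carrier R \<Longrightarrow> b \<in> H \<Longrightarrow> r \<odot>\<^bsub>M\<^esub> b \<in> H" if "submodule H R M" for H
    using submoduleE[OF that] submodule_zero[OF that] by auto
  then show ?thesis
    using module_span_minimal[OF carrier_is_submodule assms]
    by (intro submoduleI) (auto simp: module_span_def)
qed

lemma submodule_finsum:
  assumes "submodule H R M" "finite J" "\<And>j. j \<in> J \<Longrightarrow> u j \<in> H"
  shows "finsum M u J \<in> H"
  using assms(2,3)
proof (induction J rule: finite_induct)
  case empty
  then show ?case using submodule_zero[OF assms(1)] by simp
next
  case (insert j J)
  then show ?case
    using submoduleE(1,5)[OF assms(1)] by (subst finsum_insert) (auto simp: Pi_iff)
qed

section \<open>Quotient modules\<close>

lemma submodule_abelian_subgroup: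
  assumes "submodule N R M"
  shows "abelian_subgroup N M"
  using submodule.axioms(1)[OF assms] a_comm_group by (rule abelian_subgroupI2[rotated])

lemma quotient_module_simps:
  "\<zero>\<^bsub>quotient_module M N\<^esub> = N"
  "X \<oplus>\<^bsub>quotient_module M N\<^esub> Y = X <+>\<^bsub>M\<^esub> Y"
  by (simp_all add: quotient_module_def)

lemma quotient_module_carrier: "carrier (quotient_module M N) = (\<lambda>x. N +>\<^bsub>M\<^esub> x) ` carrier M"
  by (auto simp: quotient_module_def A_RCOSETS_def')

lemma quotient_module_coset:
  assumes N: "submodule N R M"
  shows "x \<in> carrier M \<Longrightarrow> y \<in> carrier M \<Longrightarrow>
           (N +>\<^bsub>M\<^esub> x) \<oplus>\<^bsub>quotient_module M N\<^esub> (N +>\<^bsub>M\<^esub> y) = N +>\<^bsub>M\<^esub> (x \<oplus>\<^bsub>M\<^esub> y)"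
    and "a \<in> carrier R \<Longrightarrow> x \<in> carrier M \<Longrightarrow>
           a \<odot>\<^bsub>quotient_module M N\<^esub> (N +>\<^bsub>M\<^esub> x) = N +>\<^bsub>M\<^esub> (a \<odot>\<^bsub>M\<^esub> x)"
    and "x \<in> carrier M \<Longrightarrow> N +>\<^bsub>M\<^esub> x = N \<longleftrightarrow> x \<in> N"
proof -
  interpret N: abelian_subgroup N M by (rule submodule_abelian_subgroup[OF N])
  note NE = submoduleE[OF N]
  show "x \<in> carrier M \<Longrightarrow> y \<in> carrier M \<Longrightarrow>
           (N +>\<^bsub>M\<^esub> x) \<oplus>\<^bsub>quotient_module M N\<^esub> (N +>\<^bsub>M\<^esub> y) = N +>\<^bsub>M\<^esub> (x \<oplus>\<^bsub>M\<^esub> y)"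
    by (simp add: quotient_module_simps N.a_rcos_sum)
  show "x \<in> carrier M \<Longrightarrow> N +>\<^bsub>M\<^esub> x = N \<longleftrightarrow> x \<in> N"
    using N.a_rcos_self[of x] N.a_rcos_const[of x] by auto
  assume a: "a \<in> carrier R" and x: "x \<in> carrier M"
  have eq: "N +>\<^bsub>M\<^esub> (a \<odot>\<^bsub>M\<^esub> y) = N +>\<^bsub>M\<^esub> (a \<odot>\<^bsub>M\<^esub> x)" if y: "y \<in> N +>\<^bsub>M\<^esub> x" for y
  proof -
    have yM: "y \<in> carrier M" using N.a_elemrcos_carrier[OF x y] .
    have "y \<oplus>\<^bsub>M\<^esub> \<ominus>\<^bsub>M\<^esub> x \<in> N" by (rule N.a_rcos_module_imp[OF x y])
    then have "a \<odot>\<^bsub>M\<^esub> (y \<oplus>\<^bsub>M\<^esub> \<ominus>\<^bsub>M\<^esub> x) \<in> N" using NE(4) a by blast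
    then have "a \<odot>\<^bsub>M\<^esub> y \<oplus>\<^bsub>M\<^esub> \<ominus>\<^bsub>M\<^esub> (a \<odot>\<^bsub>M\<^esub> x) \<in> N"
      using a x yM by (simp add: smult_r_distr smult_r_minus)
    then have "a \<odot>\<^bsub>M\<^esub> y \<in> N +>\<^bsub>M\<^esub> (a \<odot>\<^bsub>M\<^esub> x)"
      using N.a_rcos_module_rev a x yM by blast
    then show ?thesis using N.a_repr_independence'[of "a \<odot>\<^bsub>M\<^esub> y" "a \<odot>\<^bsub>M\<^esub> x"] a x by simp
  qed
  have "x \<in> N +>\<^bsub>M\<^esub> x" using N.a_rcos_self x by blast
  then have "(\<Union>y\<in>N +>\<^bsub>M\<^esub> x. N +>\<^bsub>M\<^esub> (a \<odot>\<^bsub>M\<^esub> y)) = N +>\<^bsub>M\<^esub> (a \<odot>\<^bsub>M\<^esub> x)"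
    by (intro SUP_eq_const eq) auto
  then show "a \<odot>\<^bsub>quotient_module M N\<^esub> (N +>\<^bsub>M\<^esub> x) = N +>\<^bsub>M\<^esub> (a \<odot>\<^bsub>M\<^esub> x)"
    by (simp add: quotient_module_def)
qed

lemma quotient_module_is_module:
  assumes N: "submodule N R M"
  shows "module R (quotient_module M N)"
proof -
  let ?Q = "quotient_module M N" and ?p = "\<lambda>x. N +>\<^bsub>M\<^esub> x"
  note c = quotient_module_coset[OF N]
  have rep: "\<exists>x\<in>carrier M. X = ?p x" if "X \<in> carrier ?Q" for X
    using that by (auto simp: quotient_module_carrier)
  have cl: "?p x \<in> carrier ?Q" if "x \<in> carrier M" for x
    using that by (auto simp: quotient_module_carrier)
  have zero: "\<zero>\<^bsub>?Q\<^esub> = ?p \<zero>\<^bsub>M\<^esub>"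
    using c(3)[of "\<zero>\<^bsub>M\<^esub>"] submodule_zero[OF N] by (simp add: quotient_module_simps)
  show ?thesis
  proof (intro moduleI abelian_groupI)
    show "cring R" ..
    show "\<zero>\<^bsub>?Q\<^esub> \<in> carrier ?Q" unfolding zero by (rule cl) simp
    fix X assume "X \<in> carrier ?Q"
    then obtain x where x: "x \<in> carrier M" "X = ?p x" using rep by blast
    show "\<zero>\<^bsub>?Q\<^esub> \<oplus>\<^bsub>?Q\<^esub> X = X" unfolding zero x(2) using c(1) x(1) by simp
    show "\<one> \<odot>\<^bsub>?Q\<^esub> X = X" unfolding x(2) using c(2) x(1) by simp
    show "\<exists>Y\<in>carrier ?Q. Y \<oplus>\<^bsub>?Q\<^esub> X = \<zero>\<^bsub>?Q\<^esub>"
      unfolding zero x(2) using c(1) x(1) by (intro bexI[OF _ cl[of "\<ominus>\<^bsub>M\<^esub> x"]]) (auto simp: M.l_neg)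
    {
      fix a assume a: "a \<in> carrier R"
      show "a \<odot>\<^bsub>?Q\<^esub> X \<in> carrier ?Q" unfolding x(2) using c(2) a x(1) cl by simp
      fix b assume b: "b \<in> carrier R"
      show "(a \<oplus> b) \<odot>\<^bsub>?Q\<^esub> X = a \<odot>\<^bsub>?Q\<^esub> X \<oplus>\<^bsub>?Q\<^esub> b \<odot>\<^bsub>?Q\<^esub> X"
        unfolding x(2) using c(1,2) a b x(1) by (simp add: smult_l_distr)
      show "(a \<otimes> b) \<odot>\<^bsub>?Q\<^esub> X = a \<odot>\<^bsub>?Q\<^esub> (b \<odot>\<^bsub>?Q\<^esub> X)"
        unfolding x(2) using c(2) a b x(1) by (simp add: smult_assoc1)
    }
    fix Y assume "Y \<in> carrier ?Q"
    then obtain y where y: "y \<in> carrier M" "Y = ?p y" using rep by blast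
    show "X \<oplus>\<^bsub>?Q\<^esub> Y \<in> carrier ?Q" unfolding x(2) y(2) using c(1) x(1) y(1) cl by simp
    show "X \<oplus>\<^bsub>?Q\<^esub> Y = Y \<oplus>\<^bsub>?Q\<^esub> X" unfolding x(2) y(2) using c(1) x(1) y(1) by (simp add: M.a_comm)
    show "a \<odot>\<^bsub>?Q\<^esub> (X \<oplus>\<^bsub>?Q\<^esub> Y) = a \<odot>\<^bsub>?Q\<^esub> X \<oplus>\<^bsub>?Q\<^esub> a \<odot>\<^bsub>?Q\<^esub> Y" if "a \<in> carrier R" for a
      unfolding x(2) y(2) using c(1,2) x(1) y(1) that by (simp add: smult_r_distr)
    fix Z assume "Z \<in> carrier ?Q"
    then obtain z where z: "z \<in> carrier M" "Z = ?p z" using rep by blast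
    show "X \<oplus>\<^bsub>?Q\<^esub> Y \<oplus>\<^bsub>?Q\<^esub> Z = X \<oplus>\<^bsub>?Q\<^esub> (Y \<oplus>\<^bsub>?Q\<^esub> Z)"
      unfolding x(2) y(2) z(2) using c(1) x(1) y(1) z(1) by (simp add: M.a_assoc)
  qed
qed

lemma quotient_module_proj:
  assumes N: "submodule N R M"
  shows "(\<lambda>x. N +>\<^bsub>M\<^esub> x) \<in> module_hom R M (quotient_module M N)"
  using quotient_module_coset[OF N] by (intro module_homI) (auto simp: quotient_module_carrier)

end

text \<open>The second factor is merely closed under its operations: this keeps the relations inside
  the free module, and bilinearity of \<open>tens\<close> comes from the relations themselves. In
  this way the dual can serve as a factor without first being turned into a module.\<close>

locale tensor_product = R?: cring R for R (structure) +
  fixes M :: "('a, 'c, 'm) module_scheme" and N :: "('a, 'd, 'n) module_scheme"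
  assumes module_M: "module R M" and add_closed_N: "\<And>y y'. y \<in> carrier N \<Longrightarrow> y' \<in> carrier N \<Longrightarrow> y \<oplus>\<^bsub>N\<^esub> y' \<in> carrier N"
    and smult_closed_N: "\<And>a y. a \<in> carrier R \<Longrightarrow> y \<in> carrier N \<Longrightarrow> a \<odot>\<^bsub>N\<^esub> y \<in> carrier N"
begin

sublocale M: module R M by (rule module_M)

abbreviation "F \<equiv> free_module R (carrier M \<times> carrier N)"

abbreviation "T \<equiv> tensor_module R M N"

definition "rel_span = module_span R F (tensor_relations R M N)"

definition tens :: "'c \<Rightarrow> 'd \<Rightarrow> ('c \<times> 'd \<Rightarrow> 'a) set" where
  "tens x y = rel_span +>\<^bsub>F\<^esub> free_gen R (x, y)"

sublocale F: module R F by (rule free_module_is_module)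

lemma gen_closed: "x \<in> carrier M \<Longrightarrow> y \<in> carrier N \<Longrightarrow> free_gen R (x, y) \<in> carrier F"
  by (rule free_gen_closed) simp

lemma relations:
  assumes x: "x \<in> carrier M" and y: "y \<in> carrier N"
  shows "x' \<in> carrier M \<Longrightarrow> free_gen R (x \<oplus>\<^bsub>M\<^esub> x', y) \<ominus>\<^bsub>F\<^esub> (free_gen R (x, y) \<oplus>\<^bsub>F\<^esub> free_gen R (x', y)) \<in> tensor_relations R M N"
    and "y' \<in> carrier N \<Longrightarrow> free_gen R (x, y \<oplus>\<^bsub>N\<^esub> y') \<ominus>\<^bsub>F\<^esub> (free_gen R (x, y) \<oplus>\<^bsub>F\<^esub> free_gen R (x, y')) \<in> tensor_relations R M N"
    and "a \<in> carrier R \<Longrightarrow> free_gen R (a \<odot>\<^bsub>M\<^esub> x, y) \<ominus>\<^bsub>F\<^esub> a \<odot>\<^bsub>F\<^esub> free_gen R (x, y) \<in> tensor_relations R M N"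
    and "a \<in> carrier R \<Longrightarrow> free_gen R (x, a \<odot>\<^bsub>N\<^esub> y) \<ominus>\<^bsub>F\<^esub> a \<odot>\<^bsub>F\<^esub> free_gen R (x, y) \<in> tensor_relations R M N"
  unfolding tensor_relations_def Let_def
     apply (intro UnI1 CollectI exI conjI, (rule refl assms | assumption)+)
    apply (rule UnI1, rule UnI1, rule UnI2, intro CollectI exI conjI, (rule refl assms | assumption)+)
   apply (rule UnI1, rule UnI2, intro CollectI exI conjI, (rule refl assms | assumption)+)
  apply (rule UnI2, intro CollectI exI conjI, (rule refl assms | assumption)+)
  done

lemma relations_cases:
  assumes "t \<in> tensor_relations R M N"
  obtains (add_left) x x' y where "x \<in> carrier M" "x' \<in> carrier M" "y \<in> carrier N"
      "t = free_gen R (x \<oplus>\<^bsub>M\<^esub> x', y) \<ominus>\<^bsub>F\<^esub> (free_gen R (x, y) \<oplus>\<^bsub>F\<^esub> free_gen R (x', y))"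
    | (add_right) x y y' where "x \<in> carrier M" "y \<in> carrier N" "y' \<in> carrier N"
      "t = free_gen R (x, y \<oplus>\<^bsub>N\<^esub> y') \<ominus>\<^bsub>F\<^esub> (free_gen R (x, y) \<oplus>\<^bsub>F\<^esub> free_gen R (x, y'))"
    | (smult_left) a x y where "a \<in> carrier R" "x \<in> carrier M" "y \<in> carrier N"
      "t = free_gen R (a \<odot>\<^bsub>M\<^esub> x, y) \<ominus>\<^bsub>F\<^esub> a \<odot>\<^bsub>F\<^esub> free_gen R (x, y)"
    | (smult_right) a x y where "a \<in> carrier R" "x \<in> carrier M" "y \<in> carrier N"
      "t = free_gen R (x, a \<odot>\<^bsub>N\<^esub> y) \<ominus>\<^bsub>F\<^esub> a \<odot>\<^bsub>F\<^esub> free_gen R (x, y)"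
  using assms unfolding tensor_relations_def Let_def
  by (elim UnE CollectE exE conjE) (rule that; assumption)+

lemma relations_subset: "tensor_relations R M N \<subseteq> carrier F"
proof
  fix t assume "t \<in> tensor_relations R M N"
  then show "t \<in> carrier F"
    by (cases rule: relations_cases)
       (auto simp del: free_module_simps intro!: F.minus_closed F.a_closed F.smult_closed gen_closed
             add_closed_N smult_closed_N)
qed

lemma rel_span_submodule: "submodule rel_span R F"
  unfolding rel_span_def by (rule F.module_span_submodule[OF relations_subset])

lemma tensor_module_eq: "T = quotient_module F rel_span"
  by (simp add: tensor_module_def rel_span_def Let_def)

sublocale T: module R T
  unfolding tensor_module_eq by (rule F.quotient_module_is_module[OF rel_span_submodule])

lemma proj_hom: "(\<lambda>t. rel_span +>\<^bsub>F\<^esub> t) \<in> module_hom R F T"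
  unfolding tensor_module_eq by (rule F.quotient_module_proj[OF rel_span_submodule])

lemma proj_eq_zero_iff: "t \<in> carrier F \<Longrightarrow> rel_span +>\<^bsub>F\<^esub> t = \<zero>\<^bsub>T\<^esub> \<longleftrightarrow> t \<in> rel_span"
  unfolding tensor_module_eq F.quotient_module_simps by (rule F.quotient_module_coset(3)[OF rel_span_submodule])

lemma proj_eqI:
  assumes "s \<in> carrier F" "t \<in> carrier F" "s \<ominus>\<^bsub>F\<^esub> t \<in> tensor_relations R M N"
  shows "rel_span +>\<^bsub>F\<^esub> s = rel_span +>\<^bsub>F\<^esub> t"
proof -
  have "s \<ominus>\<^bsub>F\<^esub> t \<in> rel_span"
    using F.module_span_subset assms(3) by (auto simp: rel_span_def)
  then have "rel_span +>\<^bsub>F\<^esub> (s \<ominus>\<^bsub>F\<^esub> t) = \<zero>\<^bsub>T\<^esub>"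
    using proj_eq_zero_iff F.minus_closed[OF assms(1,2)] by blast
  then have "(rel_span +>\<^bsub>F\<^esub> s) \<ominus>\<^bsub>T\<^esub> (rel_span +>\<^bsub>F\<^esub> t) = \<zero>\<^bsub>T\<^esub>"
    using module_hom_minus[OF F.module_axioms T.module_axioms proj_hom assms(1,2)] by simp
  moreover have "rel_span +>\<^bsub>F\<^esub> s \<in> carrier T" "rel_span +>\<^bsub>F\<^esub> t \<in> carrier T"
    using module_homD(1)[OF proj_hom] assms(1,2) by blast+
  ultimately show ?thesis
    by (metis T.a_assoc T.a_inv_closed T.l_neg T.l_zero T.r_zero a_minus_def)
qed

lemma tens_closed: "x \<in> carrier M \<Longrightarrow> y \<in> carrier N \<Longrightarrow> tens x y \<in> carrier T"
  unfolding tens_def by (rule module_homD(1)[OF proj_hom gen_closed])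

lemma tens_add_left:
  assumes "x \<in> carrier M" "x' \<in> carrier M" "y \<in> carrier N"
  shows "tens (x \<oplus>\<^bsub>M\<^esub> x') y = tens x y \<oplus>\<^bsub>T\<^esub> tens x' y"
proof -
  have "tens (x \<oplus>\<^bsub>M\<^esub> x') y = rel_span +>\<^bsub>F\<^esub> (free_gen R (x, y) \<oplus>\<^bsub>F\<^esub> free_gen R (x', y))"
    unfolding tens_def by (intro proj_eqI relations gen_closed F.a_closed M.a_closed assms)
  also have "\<dots> = tens x y \<oplus>\<^bsub>T\<^esub> tens x' y"
    unfolding tens_def by (intro module_homD(2)[OF proj_hom] gen_closed assms)
  finally show ?thesis .
qed

lemma tens_add_right:
  assumes "x \<in> carrier M" "y \<in> carrier N" "y' \<in> carrier N"
  shows "tens x (y \<oplus>\<^bsub>N\<^esub> y') = tens x y \<oplus>\<^bsub>T\<^esub> tens x y'"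
proof -
  have "tens x (y \<oplus>\<^bsub>N\<^esub> y') = rel_span +>\<^bsub>F\<^esub> (free_gen R (x, y) \<oplus>\<^bsub>F\<^esub> free_gen R (x, y'))"
    unfolding tens_def by (intro proj_eqI relations gen_closed F.a_closed add_closed_N assms)
  also have "\<dots> = tens x y \<oplus>\<^bsub>T\<^esub> tens x y'"
    unfolding tens_def by (intro module_homD(2)[OF proj_hom] gen_closed assms)
  finally show ?thesis .
qed

lemma tens_smult_left:
  assumes "a \<in> carrier R" "x \<in> carrier M" "y \<in> carrier N"
  shows "tens (a \<odot>\<^bsub>M\<^esub> x) y = a \<odot>\<^bsub>T\<^esub> tens x y"
proof -
  have "tens (a \<odot>\<^bsub>M\<^esub> x) y = rel_span +>\<^bsub>F\<^esub> (a \<odot>\<^bsub>F\<^esub> free_gen R (x, y))"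
    unfolding tens_def by (intro proj_eqI relations gen_closed F.smult_closed M.smult_closed assms)
  also have "\<dots> = a \<odot>\<^bsub>T\<^esub> tens x y"
    unfolding tens_def by (intro module_homD(3)[OF proj_hom] gen_closed assms)
  finally show ?thesis .
qed

lemma tens_smult_right:
  assumes "a \<in> carrier R" "x \<in> carrier M" "y \<in> carrier N"
  shows "tens x (a \<odot>\<^bsub>N\<^esub> y) = a \<odot>\<^bsub>T\<^esub> tens x y"
proof -
  have "tens x (a \<odot>\<^bsub>N\<^esub> y) = rel_span +>\<^bsub>F\<^esub> (a \<odot>\<^bsub>F\<^esub> free_gen R (x, y))"
    unfolding tens_def by (intro proj_eqI relations gen_closed F.smult_closed smult_closed_N assms)
  also have "\<dots> = a \<odot>\<^bsub>T\<^esub> tens x y"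
    unfolding tens_def by (intro module_homD(3)[OF proj_hom] gen_closed assms)
  finally show ?thesis .
qed

end

section \<open>The dual as second factor of the tensor product\<close>

lemma dual_module_simps:
  "\<phi> \<in> carrier (dual_module R M) \<longleftrightarrow> \<phi> \<in> module_hom R M (regular_module R) \<and> \<phi> \<in> extensional (carrier M)"
  "\<phi> \<oplus>\<^bsub>dual_module R M\<^esub> \<psi> = (\<lambda>x\<in>carrier M. \<phi> x \<oplus>\<^bsub>R\<^esub> \<psi> x)"
  "a \<odot>\<^bsub>dual_module R M\<^esub> \<phi> = (\<lambda>x\<in>carrier M. a \<otimes>\<^bsub>R\<^esub> \<phi> x)"
  by (simp_all add: dual_module_def hom_module_def)

lemma (in module) tensor_product_dual: "tensor_product R M (dual_module R M)"
proof (unfold_locales, goal_cases)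
  case (1 \<phi> \<psi>)
  then have p: "\<phi> \<in> module_hom R M (regular_module R)" "\<psi> \<in> module_hom R M (regular_module R)"
    by (auto simp: dual_module_simps)
  note h = module_homD[OF p(1), simplified] module_homD[OF p(2), simplified]
  have "(\<lambda>x\<in>carrier M. \<phi> x \<oplus> \<psi> x) \<in> module_hom R M (regular_module R)"
    using h by (intro module_homI) (auto simp: R.a_ac R.r_distr)
  then show ?case by (simp add: dual_module_simps)
next
  case (2 a \<phi>)
  then have p: "\<phi> \<in> module_hom R M (regular_module R)" by (auto simp: dual_module_simps)
  note h = module_homD[OF p, simplified]
  have "(\<lambda>x\<in>carrier M. a \<otimes> \<phi> x) \<in> module_hom R M (regular_module R)"
    using h 2(1) by (intro module_homI) (auto simp: R.r_distr R.m_lcomm)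
  then show ?case by (simp add: dual_module_simps)
qed

section \<open>Torsion in the tensor product with the dual\<close>

text \<open>\<open>M\<close> is the cokernel of the endomorphism \<open>A\<close> of
  \<open>R^n\<close>. By right exactness its tensor product with \<open>M^*\<close> is the module of
  matrices with rows in \<open>M^*\<close> modulo \<open>A\<close> times such matrices; the locale
  makes explicit as much of this identification as the torsion argument uses.\<close>

locale free_presentation = module R M for R (structure) and M :: "('a, 'c, 'm) module_scheme" +
  fixes n :: nat and \<eta> :: "(nat \<Rightarrow> 'a) \<Rightarrow> 'c" and A :: "(nat \<Rightarrow> 'a) \<Rightarrow> (nat \<Rightarrow> 'a)"
  assumes eta_hom: "\<eta> \<in> module_hom R (free_module R {..<n}) M"
    and eta_surj: "\<eta> ` carrier (free_module R {..<n}) = carrier M"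
    and A_hom: "A \<in> module_hom R (free_module R {..<n}) (free_module R {..<n})"
    and ker_eta: "{v \<in> carrier (free_module R {..<n}). \<eta> v = \<zero>\<^bsub>M\<^esub>} = A ` carrier (free_module R {..<n})"
begin

sublocale tensor_product R M "dual_module R M"
  by (rule tensor_product_dual)

abbreviation "P \<equiv> free_module R {..<n}"

sublocale P: module R P by (rule free_module_is_module)

abbreviation "Q \<equiv> free_module R ({..<n} \<times> {..<n})"

sublocale Q: module R Q by (rule free_module_is_module)

abbreviation "E \<equiv> mat_ring R n"

abbreviation "a \<equiv> mat_of R n A"

definition dot :: "(nat \<Rightarrow> 'a) \<Rightarrow> (nat \<Rightarrow> 'a) \<Rightarrow> 'a" where
  "dot u v = (\<Oplus>i\<in>{..<n}. u i \<otimes> v i)"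

text \<open>The functionals on \<open>R^n\<close> that vanish on the image of \<open>A\<close>, that
  is, \<open>M^*\<close> in coordinates.\<close>

definition "dual_vecs = {u \<in> carrier P. \<forall>v\<in>carrier P. dot u (A v) = \<zero>}"

text \<open>A bare choice of preimages, in general not linear: whatever is built from it is well
  behaved only modulo the image of \<open>A\<close>.\<close>

definition section_of :: "'c \<Rightarrow> nat \<Rightarrow> 'a" where
  "section_of m = (SOME v. v \<in> carrier P \<and> \<eta> v = m)"

definition functional :: "(nat \<Rightarrow> 'a) \<Rightarrow> 'c \<Rightarrow> 'a" where
  "functional u = (\<lambda>m\<in>carrier M. dot u (section_of m))"

definition coords :: "('c \<Rightarrow> 'a) \<Rightarrow> nat \<Rightarrow> 'a" where
  "coords f = (\<lambda>l. if l < n then f (\<eta> (free_gen R l)) else \<zero>)"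

definition outer :: "(nat \<Rightarrow> 'a) \<Rightarrow> (nat \<Rightarrow> 'a) \<Rightarrow> nat \<times> nat \<Rightarrow> 'a" where
  "outer p f = (\<lambda>(i, l). p i \<otimes> f l)"

text \<open>The matrices that represent zero in the tensor product: \<open>A\<close> applied to the
  columns of a matrix whose rows lie in the dual.\<close>

definition "relation_mats = (\<lambda>Z. a \<otimes>\<^bsub>E\<^esub> Z) ` {Z \<in> carrier E. Z \<otimes>\<^bsub>E\<^esub> a = \<zero>\<^bsub>E\<^esub>}"

section \<open>The dual of \<open>M\<close> as the row vectors killed by \<open>A\<close>\<close>

lemma P_iff: "v \<in> carrier P \<longleftrightarrow> (\<forall>i. v i \<in> carrier R \<and> (\<not> i < n \<longrightarrow> v i = \<zero>))"
  by (subst free_module_finite_carrier) auto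

lemma P_closed: "v \<in> carrier P \<Longrightarrow> v i \<in> carrier R"
  by (simp add: P_iff)

lemma gen_P: "i < n \<Longrightarrow> free_gen R i \<in> carrier P"
  by (rule free_gen_closed) simp

lemma dot_closed: "u \<in> carrier P \<Longrightarrow> v \<in> carrier P \<Longrightarrow> dot u v \<in> carrier R"
  unfolding dot_def by (intro R.finsum_closed) (auto simp: P_iff)

lemma dot_commute: "u \<in> carrier P \<Longrightarrow> v \<in> carrier P \<Longrightarrow> dot u v = dot v u"
  unfolding dot_def by (intro R.finsum_cong') (auto simp: P_iff R.m_comm)

lemma dot_hom:
  assumes u: "u \<in> carrier P"
  shows "dot u \<in> module_hom R P (regular_module R)"
proof (rule module_homI)
  show "dot u v \<in> carrier (regular_module R)" if "v \<in> carrier P" for v using dot_closed[OF u that] by simp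
  show "dot u (v \<oplus>\<^bsub>P\<^esub> w) = dot u v \<oplus>\<^bsub>regular_module R\<^esub> dot u w"
    if v: "v \<in> carrier P" and w: "w \<in> carrier P" for v w
  proof -
    have "dot u (v \<oplus>\<^bsub>P\<^esub> w) = (\<Oplus>i\<in>{..<n}. u i \<otimes> v i \<oplus> u i \<otimes> w i)"
      unfolding dot_def using P_closed[OF u] P_closed[OF v] P_closed[OF w]
      by (intro R.finsum_cong') (auto simp: R.r_distr)
    also have "\<dots> = dot u v \<oplus> dot u w"
      unfolding dot_def using P_closed[OF u] P_closed[OF v] P_closed[OF w]
      by (intro R.finsum_addf) auto
    finally show ?thesis by simp
  qed
  show "dot u (c \<odot>\<^bsub>P\<^esub> v) = c \<odot>\<^bsub>regular_module R\<^esub> dot u v"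
    if c: "c \<in> carrier R" and v: "v \<in> carrier P" for c v
  proof -
    have "dot u (c \<odot>\<^bsub>P\<^esub> v) = (\<Oplus>i\<in>{..<n}. c \<otimes> (u i \<otimes> v i))"
      unfolding dot_def using c P_closed[OF u] P_closed[OF v]
      by (intro R.finsum_cong') (auto simp: R.m_lcomm)
    also have "\<dots> = c \<otimes> dot u v"
      unfolding dot_def using c P_closed[OF u] P_closed[OF v]
      by (intro R.finsum_rdistr[symmetric]) auto
    finally show ?thesis by simp
  qed
qed

lemma dot_gen: "u \<in> carrier P \<Longrightarrow> i < n \<Longrightarrow> dot u (free_gen R i) = u i"
  unfolding dot_def
  by (subst R.finsum_single[of "{..<n}" i]) (auto simp: free_gen_def P_iff)

lemma dot_add_left:
  assumes "u \<in> carrier P" "u' \<in> carrier P" "v \<in> carrier P"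
  shows "dot (u \<oplus>\<^bsub>P\<^esub> u') v = dot u v \<oplus> dot u' v"
  using module_homD(2)[OF dot_hom[OF assms(3)] assms(1,2)]
    dot_commute[OF assms(1,3)] dot_commute[OF assms(2,3)] dot_commute[OF P.a_closed[OF assms(1,2)] assms(3)]
  by (simp del: free_module_simps)

lemma dot_smult_left:
  assumes "c \<in> carrier R" "u \<in> carrier P" "v \<in> carrier P"
  shows "dot (c \<odot>\<^bsub>P\<^esub> u) v = c \<otimes> dot u v"
  using module_homD(3)[OF dot_hom[OF assms(3)] assms(1,2)]
    dot_commute[OF assms(2,3)] dot_commute[OF P.smult_closed[OF assms(1,2)] assms(3)]
  by (simp del: free_module_simps)

lemma A_closed: "v \<in> carrier P \<Longrightarrow> A v \<in> carrier P"
  by (rule module_homD(1)[OF A_hom])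

lemma eta_A: "v \<in> carrier P \<Longrightarrow> \<eta> (A v) = \<zero>\<^bsub>M\<^esub>"
  using ker_eta by blast

lemma dual_vecs_P: "u \<in> dual_vecs \<Longrightarrow> u \<in> carrier P"
  by (simp add: dual_vecs_def)

lemma dual_vecs_A: "u \<in> dual_vecs \<Longrightarrow> v \<in> carrier P \<Longrightarrow> dot u (A v) = \<zero>"
  by (simp add: dual_vecs_def)

lemma dual_vecs_submodule: "submodule dual_vecs R P"
proof -
  have "submodule {u \<in> carrier P. dot (A v) u \<in> {\<zero>}} R P" if "v \<in> carrier P" for v
  proof (rule submodule_vimage[OF P.module_axioms regular_module_is_module dot_hom[OF A_closed[OF that]]])
    show "submodule {\<zero>} R (regular_module R)"
      unfolding submodule_regular_iff by (rule R.zeroideal)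
  qed
  note s = P.submoduleE[OF this] P.submodule_zero[OF this]
  have eq: "dual_vecs = {u \<in> carrier P. \<forall>v\<in>carrier P. u \<in> {u \<in> carrier P. dot (A v) u \<in> {\<zero>}}}"
    using dot_commute A_closed by (auto simp: dual_vecs_def simp del: free_module_simps)
  show ?thesis
    unfolding eq
  proof (rule P.submoduleI, goal_cases)
    case 1
    show ?case by (auto simp del: free_module_simps)
  next
    case 2
    show ?case using s(7) P.zero_closed by (auto simp del: free_module_simps)
  next
    case (3 u)
    then show ?case using s(3) P.a_inv_closed by (auto simp del: free_module_simps)
  next
    case (4 u v)
    then show ?case using s(5) P.a_closed by (auto simp del: free_module_simps)
  next
    case (5 c u)
    then show ?case using s(4) P.smult_closed by (auto simp del: free_module_simps)
  qed
qed

lemma dual_vecsI: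
  assumes u: "u \<in> carrier P" and g: "\<And>k. k < n \<Longrightarrow> dot u (A (free_gen R k)) = \<zero>"
  shows "u \<in> dual_vecs"
proof -
  interpret S: module R "regular_module R" by (rule regular_module_is_module)
  have h: "(\<lambda>v. dot u (A v)) \<in> module_hom R P (regular_module R)"
    by (rule module_hom_comp[OF A_hom dot_hom[OF u]])
  have "dot u (A v) = \<zero>" if v: "v \<in> carrier P" for v
  proof -
    have "dot u (A v) = (\<Oplus>\<^bsub>regular_module R\<^esub> k\<in>{..<n}. v k \<odot>\<^bsub>regular_module R\<^esub> dot u (A (free_gen R k)))"
      by (rule module_hom_free_expansion[OF _ S.module_axioms h v]) simp
    also have "\<dots> = \<zero>\<^bsub>regular_module R\<^esub>"
      using g P_closed[OF v] by (intro S.add.finprod_one_eqI) auto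
    finally show ?thesis by simp
  qed
  then show ?thesis using u by (simp add: dual_vecs_def del: free_module_simps)
qed

lemma section_of:
  assumes "m \<in> carrier M"
  shows "section_of m \<in> carrier P" "\<eta> (section_of m) = m"
proof -
  have "m \<in> \<eta> ` carrier P" using assms eta_surj by simp
  then have "\<exists>v. v \<in> carrier P \<and> \<eta> v = m" by (auto simp del: free_module_simps)
  then have "section_of m \<in> carrier P \<and> \<eta> (section_of m) = m" unfolding section_of_def by (rule someI_ex)
  then show "section_of m \<in> carrier P" "\<eta> (section_of m) = m" by blast+
qed

lemma eta_closed: "v \<in> carrier P \<Longrightarrow> \<eta> v \<in> carrier M"
  by (rule module_homD(1)[OF eta_hom])

lemma eta_eqE:
  assumes "v \<in> carrier P" "w \<in> carrier P" "\<eta> v = \<eta> w"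
  obtains z where "z \<in> carrier P" "v \<ominus>\<^bsub>P\<^esub> w = A z"
proof -
  have "\<eta> (v \<ominus>\<^bsub>P\<^esub> w) = \<zero>\<^bsub>M\<^esub>"
    using module_hom_minus[OF P.module_axioms module_axioms eta_hom assms(1,2)] assms(3) eta_closed[OF assms(2)]
    by (simp add: a_minus_def M.r_neg)
  then have "v \<ominus>\<^bsub>P\<^esub> w \<in> A ` carrier P"
    using ker_eta P.minus_closed[OF assms(1,2)] by blast
  then show ?thesis using that by blast
qed

text \<open>Two preimages of an element of \<open>M\<close> differ by some \<open>A z\<close>, on
  which \<open>u\<close> vanishes, so the choice made by \<open>section_of\<close>
  disappears.\<close>

lemma functional_eta:
  assumes u: "u \<in> dual_vecs" and v: "v \<in> carrier P"
  shows "functional u (\<eta> v) = dot u v"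
proof -
  note s = section_of[OF eta_closed[OF v]]
  obtain z where z: "z \<in> carrier P" "section_of (\<eta> v) \<ominus>\<^bsub>P\<^esub> v = A z"
    by (rule eta_eqE[OF s(1) v s(2)])
  have "section_of (\<eta> v) = A z \<oplus>\<^bsub>P\<^esub> v"
    unfolding z(2)[symmetric] using s(1) v
    by (simp add: a_minus_def P.a_assoc P.l_neg del: free_module_simps)
  then have "dot u (section_of (\<eta> v)) = dot u (A z) \<oplus> dot u v"
    using module_homD(2)[OF dot_hom[OF dual_vecs_P[OF u]] A_closed[OF z(1)] v] by simp
  also have "\<dots> = dot u v"
    using dual_vecs_A[OF u z(1)] dot_closed[OF dual_vecs_P[OF u] v] by simp
  finally show ?thesis using eta_closed[OF v] by (simp add: functional_def)
qed

lemma functional_closed: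
  assumes u: "u \<in> dual_vecs"
  shows "functional u \<in> carrier (dual_module R M)"
  unfolding dual_module_simps
proof
  note d = module_homD[OF dot_hom[OF dual_vecs_P[OF u]]]
  note e = module_homD[OF eta_hom]
  have f: "functional u m = dot u (section_of m)" if "m \<in> carrier M" for m
    using that by (simp add: functional_def)
  show "functional u \<in> module_hom R M (regular_module R)"
  proof (rule module_homI)
    show "functional u m \<in> carrier (regular_module R)" if "m \<in> carrier M" for m
      using f[OF that] d(1) section_of[OF that] by simp
    fix m assume m: "m \<in> carrier M"
    note sm = section_of[OF m]
    show "functional u (m \<oplus>\<^bsub>M\<^esub> m') = functional u m \<oplus>\<^bsub>regular_module R\<^esub> functional u m'" if m': "m' \<in> carrier M" for m'
    proof -
      note sm' = section_of[OF m']
      have "functional u (m \<oplus>\<^bsub>M\<^esub> m') = functional u (\<eta> (section_of m \<oplus>\<^bsub>P\<^esub> section_of m'))"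
        using e(2)[OF sm(1) sm'(1)] sm(2) sm'(2) by simp
      also have "\<dots> = dot u (section_of m \<oplus>\<^bsub>P\<^esub> section_of m')"
        by (rule functional_eta[OF u P.a_closed[OF sm(1) sm'(1)]])
      also have "\<dots> = functional u m \<oplus>\<^bsub>regular_module R\<^esub> functional u m'"
        unfolding f[OF m] f[OF m'] by (rule d(2)[OF sm(1) sm'(1)])
      finally show ?thesis .
    qed
    show "functional u (c \<odot>\<^bsub>M\<^esub> m) = c \<odot>\<^bsub>regular_module R\<^esub> functional u m" if c: "c \<in> carrier R" for c
    proof -
      have "functional u (c \<odot>\<^bsub>M\<^esub> m) = functional u (\<eta> (c \<odot>\<^bsub>P\<^esub> section_of m))"
        using e(3)[OF c sm(1)] sm(2) by simp
      also have "\<dots> = dot u (c \<odot>\<^bsub>P\<^esub> section_of m)"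
        by (rule functional_eta[OF u P.smult_closed[OF c sm(1)]])
      also have "\<dots> = c \<odot>\<^bsub>regular_module R\<^esub> functional u m"
        unfolding f[OF m] by (rule d(3)[OF c sm(1)])
      finally show ?thesis .
    qed
  qed
qed (simp add: functional_def)

lemma functional_add:
  assumes "u \<in> dual_vecs" "u' \<in> dual_vecs"
  shows "functional (u \<oplus>\<^bsub>P\<^esub> u') = functional u \<oplus>\<^bsub>dual_module R M\<^esub> functional u'"
  using dot_add_left[OF dual_vecs_P[OF assms(1)] dual_vecs_P[OF assms(2)]] section_of
  unfolding dual_module_simps by (auto simp: functional_def fun_eq_iff simp del: free_module_simps)

lemma functional_smult:
  assumes "c \<in> carrier R" "u \<in> dual_vecs"
  shows "functional (c \<odot>\<^bsub>P\<^esub> u) = c \<odot>\<^bsub>dual_module R M\<^esub> functional u"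
  using dot_smult_left[OF assms(1) dual_vecs_P[OF assms(2)]] section_of
  unfolding dual_module_simps by (auto simp: functional_def fun_eq_iff simp del: free_module_simps)

lemma tens_hom_left:
  assumes f: "f \<in> carrier (dual_module R M)"
  shows "(\<lambda>v. tens (\<eta> v) f) \<in> module_hom R P T"
proof (rule module_homI)
  fix v assume v: "v \<in> carrier P"
  show "tens (\<eta> v) f \<in> carrier T" by (rule tens_closed[OF eta_closed[OF v] f])
  show "tens (\<eta> (v \<oplus>\<^bsub>P\<^esub> w)) f = tens (\<eta> v) f \<oplus>\<^bsub>T\<^esub> tens (\<eta> w) f" if w: "w \<in> carrier P" for w
    unfolding module_homD(2)[OF eta_hom v w] by (rule tens_add_left[OF eta_closed[OF v] eta_closed[OF w] f])
  show "tens (\<eta> (c \<odot>\<^bsub>P\<^esub> v)) f = c \<odot>\<^bsub>T\<^esub> tens (\<eta> v) f" if c: "c \<in> carrier R" for c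
    unfolding module_homD(3)[OF eta_hom c v] by (rule tens_smult_left[OF c eta_closed[OF v] f])
qed

text \<open>The map \<open>h\<close> will be \<open>c \<mapsto> c Z\<close> on row vectors, for a
  matrix with \<open>Z A = 0\<close>. Composing with it gives a map between genuine modules, to
  which expansion along a basis applies.\<close>

lemma tens_hom_right:
  assumes m: "m \<in> carrier M" and h: "h \<in> module_hom R P P" "\<And>c. c \<in> carrier P \<Longrightarrow> h c \<in> dual_vecs"
  shows "(\<lambda>c. tens m (functional (h c))) \<in> module_hom R P T"
proof (rule module_homI)
  fix v assume v: "v \<in> carrier P"
  show "tens m (functional (h v)) \<in> carrier T"
    by (rule tens_closed[OF m functional_closed[OF h(2)[OF v]]])
  show "tens m (functional (h (v \<oplus>\<^bsub>P\<^esub> w))) = tens m (functional (h v)) \<oplus>\<^bsub>T\<^esub> tens m (functional (h w))"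
    if w: "w \<in> carrier P" for w
    unfolding module_homD(2)[OF h(1) v w] functional_add[OF h(2)[OF v] h(2)[OF w]]
    by (rule tens_add_right[OF m functional_closed[OF h(2)[OF v]] functional_closed[OF h(2)[OF w]]])
  show "tens m (functional (h (c \<odot>\<^bsub>P\<^esub> v))) = c \<odot>\<^bsub>T\<^esub> tens m (functional (h v))"
    if c: "c \<in> carrier R" for c
    unfolding module_homD(3)[OF h(1) c v] functional_smult[OF c h(2)[OF v]]
    by (rule tens_smult_right[OF c m functional_closed[OF h(2)[OF v]]])
qed

section \<open>Matrices whose rows lie in the dual\<close>

lemma row_dual_vecs:
  assumes W: "W \<in> carrier E" and z: "W \<otimes>\<^bsub>E\<^esub> a = \<zero>\<^bsub>E\<^esub>"
  shows "(\<lambda>l. W (j, l)) \<in> dual_vecs"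
proof (rule dual_vecsI)
  show "(\<lambda>l. W (j, l)) \<in> carrier P" unfolding P_iff using W by (auto simp: mat_ring_carrier_iff)
  fix k assume k: "k < n"
  show "dot (\<lambda>l. W (j, l)) (A (free_gen R k)) = \<zero>"
  proof (cases "j < n")
    case True
    have "dot (\<lambda>l. W (j, l)) (A (free_gen R k)) = (W \<otimes>\<^bsub>E\<^esub> a) (j, k)"
      using True k W P_closed[OF A_closed[OF gen_P[OF k]]]
      by (auto simp: dot_def mat_of_def intro!: R.finsum_cong')
    then show ?thesis using z by simp
  next
    case False
    then show ?thesis using W P_closed[OF A_closed[OF gen_P[OF k]]]
      unfolding dot_def by (intro R.add.finprod_one_eqI) (auto simp: mat_ring_carrier_iff)
  qed
qed

lemma row_dual_vecsD:
  assumes W: "W \<in> carrier E" and r: "\<And>j. (\<lambda>l. W (j, l)) \<in> dual_vecs"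
  shows "W \<otimes>\<^bsub>E\<^esub> a = \<zero>\<^bsub>E\<^esub>"
proof
  fix p :: "nat \<times> nat"
  obtain j k where p: "p = (j, k)" by (cases p)
  show "(W \<otimes>\<^bsub>E\<^esub> a) p = \<zero>\<^bsub>E\<^esub> p"
  proof (cases "j < n \<and> k < n")
    case True
    then have k: "k < n" by simp
    have "(W \<otimes>\<^bsub>E\<^esub> a) (j, k) = dot (\<lambda>l. W (j, l)) (A (free_gen R k))"
      using True W P_closed[OF A_closed[OF gen_P[OF k]]]
      by (auto simp: dot_def mat_of_def intro!: R.finsum_cong')
    also have "\<dots> = \<zero>" by (rule dual_vecs_A[OF r gen_P[OF k]])
    finally show ?thesis by (simp add: p)
  qed (auto simp: p)
qed

lemma outer_closed:
  assumes "p \<in> carrier P" "f \<in> carrier P"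
  shows "outer p f \<in> carrier E"
  using assms unfolding P_iff mat_ring_carrier_iff by (auto simp: outer_def)

text \<open>With \<open>f\<close> as a row, \<open>(A v) f = A (v f)\<close>, and every row of
  \<open>v f\<close> is a multiple of \<open>f\<close>, hence again killed by \<open>A\<close> from
  the right.\<close>

lemma outer_relation:
  assumes v: "v \<in> carrier P" and f: "f \<in> dual_vecs"
  shows "outer (A v) f \<in> relation_mats"
proof -
  note fP = dual_vecs_P[OF f]
  have Z: "outer v f \<in> carrier E" by (rule outer_closed[OF v fP])
  have "(\<lambda>l. outer v f (j, l)) \<in> dual_vecs" for j
  proof -
    have "v j \<odot>\<^bsub>P\<^esub> f \<in> dual_vecs"
      by (rule P.submoduleE(4)[OF dual_vecs_submodule P_closed[OF v] f])
    then show ?thesis by (simp add: outer_def)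
  qed
  then have "outer v f \<otimes>\<^bsub>E\<^esub> a = \<zero>\<^bsub>E\<^esub>" by (rule row_dual_vecsD[OF Z])
  moreover have "outer (A v) f = a \<otimes>\<^bsub>E\<^esub> outer v f"
  proof
    fix p :: "nat \<times> nat"
    obtain i l where p: "p = (i, l)" by (cases p)
    have "(\<lambda>k. outer v f (k, l)) = f l \<odot>\<^bsub>P\<^esub> v"
      using P_closed[OF v] P_closed[OF fP] by (auto simp: outer_def R.m_comm)
    then have "(a \<otimes>\<^bsub>E\<^esub> outer v f) p = (f l \<odot>\<^bsub>P\<^esub> A v) i"
      unfolding p mat_of_mult[OF A_hom Z] using module_homD(3)[OF A_hom P_closed[OF fP] v] by simp
    also have "\<dots> = outer (A v) f p"
      using P_closed[OF fP] P_closed[OF A_closed[OF v]] by (simp add: p outer_def R.m_comm)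
    finally show "outer (A v) f p = (a \<otimes>\<^bsub>E\<^esub> outer v f) p" ..
  qed
  ultimately show ?thesis using Z unfolding relation_mats_def by blast
qed

lemma relation_mats_submodule: "submodule relation_mats R Q"
proof -
  interpret E: ring E by (rule mat_ring_ring)
  interpret EM: module R E by (rule mat_ring_module)
  have a: "a \<in> carrier E" by (rule mat_of_closed[OF A_hom])
  have r: "(\<lambda>Z. Z \<otimes>\<^bsub>E\<^esub> a) \<in> module_hom R E E"
    using a by (intro module_homI E.m_closed E.l_distr mat_ring_smult_left) auto
  have l: "(\<lambda>Z. a \<otimes>\<^bsub>E\<^esub> Z) \<in> module_hom R E E"
    using a by (intro module_homI E.m_closed E.r_distr mat_ring_smult_right) auto
  have "submodule {\<zero>\<^bsub>E\<^esub>} R E"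
    using EM.smult_r_null by (intro EM.submoduleI) (auto simp del: mat_ring_simps)
  then have "submodule {Z \<in> carrier E. Z \<otimes>\<^bsub>E\<^esub> a \<in> {\<zero>\<^bsub>E\<^esub>}} R E"
    by (rule submodule_vimage[OF EM.module_axioms EM.module_axioms r])
  then have "submodule relation_mats R E"
    unfolding relation_mats_def using submodule_image[OF EM.module_axioms EM.module_axioms l] by simp
  then show ?thesis unfolding mat_ring_def submodule_mult_one_update .
qed

text \<open>Pairing with the coordinates is the composition of \<open>f\<close> with
  \<open>\<eta>\<close>, and \<open>\<eta>\<close> kills the image of \<open>A\<close>.\<close>

lemma coords_dual_vecs:
  assumes f: "f \<in> carrier (dual_module R M)"
  shows "coords f \<in> dual_vecs"
proof -
  interpret S: module R "regular_module R" by (rule regular_module_is_module)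
  have fh: "f \<in> module_hom R M (regular_module R)" using f by (simp add: dual_module_simps)
  have h: "(\<lambda>v. f (\<eta> v)) \<in> module_hom R P (regular_module R)"
    by (rule module_hom_comp[OF eta_hom fh])
  have c: "coords f \<in> carrier P"
    unfolding P_iff coords_def using module_homD(1)[OF h gen_P] by auto
  have d: "dot (coords f) v = f (\<eta> v)" if v: "v \<in> carrier P" for v
  proof -
    have eq: "dot (coords f) (free_gen R k) = f (\<eta> (free_gen R k))" if "k \<in> {..<n}" for k
      using that dot_gen[OF c, of k] by (simp add: coords_def)
    have "dot (coords f) v = (\<Oplus>\<^bsub>regular_module R\<^esub> k\<in>{..<n}. v k \<odot>\<^bsub>regular_module R\<^esub> dot (coords f) (free_gen R k))"
      by (rule module_hom_free_expansion[OF _ S.module_axioms dot_hom[OF c] v]) simp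
    also have "\<dots> = (\<Oplus>\<^bsub>regular_module R\<^esub> k\<in>{..<n}. v k \<odot>\<^bsub>regular_module R\<^esub> f (\<eta> (free_gen R k)))"
      using module_homD(1)[OF h gen_P] P_closed[OF v] by (intro S.finsum_cong') (auto simp: eq)
    also have "\<dots> = f (\<eta> v)"
      by (rule module_hom_free_expansion[OF _ S.module_axioms h v, symmetric]) simp
    finally show ?thesis .
  qed
  have "dot (coords f) (A v) = \<zero>" if "v \<in> carrier P" for v
    using d[OF A_closed[OF that]] eta_A[OF that] module_hom_zero[OF module_axioms S.module_axioms fh] by simp
  then show ?thesis using c by (simp add: dual_vecs_def del: free_module_simps)
qed

lemma coords_functional:
  assumes u: "u \<in> dual_vecs"
  shows "coords (functional u) = u"
proof
  fix l
  show "coords (functional u) l = u l"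
  proof (cases "l < n")
    case True
    then show ?thesis
      using functional_eta[OF u gen_P] dot_gen[OF dual_vecs_P[OF u]] by (simp add: coords_def)
  next
    case False
    then show ?thesis using dual_vecs_P[OF u] unfolding P_iff by (simp add: coords_def)
  qed
qed

lemma outer_closed_Q: "p \<in> carrier P \<Longrightarrow> f \<in> carrier P \<Longrightarrow> outer p f \<in> carrier Q"
  using outer_closed by (simp add: mat_ring_carrier del: free_module_simps)

lemma outer_hom_left:
  assumes f: "f \<in> carrier P"
  shows "(\<lambda>p. outer p f) \<in> module_hom R P Q"
proof (rule module_homI)
  fix p assume p: "p \<in> carrier P"
  show "outer p f \<in> carrier Q" by (rule outer_closed_Q[OF p f])
  show "outer (p \<oplus>\<^bsub>P\<^esub> q) f = outer p f \<oplus>\<^bsub>Q\<^esub> outer q f" if q: "q \<in> carrier P" for q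
    using P_closed[OF p] P_closed[OF q] P_closed[OF f] by (auto simp: outer_def R.l_distr fun_eq_iff)
  show "outer (c \<odot>\<^bsub>P\<^esub> p) f = c \<odot>\<^bsub>Q\<^esub> outer p f" if c: "c \<in> carrier R" for c
    using P_closed[OF p] P_closed[OF f] c by (auto simp: outer_def R.m_assoc fun_eq_iff)
qed

lemma outer_hom_right:
  assumes p: "p \<in> carrier P"
  shows "outer p \<in> module_hom R P Q"
proof (rule module_homI)
  fix f assume f: "f \<in> carrier P"
  show "outer p f \<in> carrier Q" by (rule outer_closed_Q[OF p f])
  show "outer p (f \<oplus>\<^bsub>P\<^esub> g) = outer p f \<oplus>\<^bsub>Q\<^esub> outer p g" if g: "g \<in> carrier P" for g
    using P_closed[OF p] P_closed[OF g] P_closed[OF f] by (auto simp: outer_def R.r_distr fun_eq_iff)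
  show "outer p (c \<odot>\<^bsub>P\<^esub> f) = c \<odot>\<^bsub>Q\<^esub> outer p f" if c: "c \<in> carrier R" for c
    using P_closed[OF p] P_closed[OF f] c by (auto simp: outer_def R.m_lcomm fun_eq_iff)
qed

text \<open>Two lifts of one element of \<open>M\<close> differ by a vector \<open>A z\<close>, so
  \<open>outer_relation\<close> applies. This absorbs the failure of \<open>section_of\<close> to be
  linear.\<close>

lemma outer_eta_eq:
  assumes "p \<in> carrier P" "q \<in> carrier P" "\<eta> p = \<eta> q" "f \<in> dual_vecs"
  shows "outer p f \<ominus>\<^bsub>Q\<^esub> outer q f \<in> relation_mats"
proof -
  obtain z where z: "z \<in> carrier P" "p \<ominus>\<^bsub>P\<^esub> q = A z" by (rule eta_eqE[OF assms(1-3)])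
  have "outer p f \<ominus>\<^bsub>Q\<^esub> outer q f = outer (p \<ominus>\<^bsub>P\<^esub> q) f"
    by (rule module_hom_minus[OF P.module_axioms Q.module_axioms
          outer_hom_left[OF dual_vecs_P[OF assms(4)]] assms(1,2), symmetric])
  then show ?thesis using outer_relation[OF z(1) assms(4)] z(2) by simp
qed

lemma coords_add:
  assumes "f \<in> carrier (dual_module R M)" "g \<in> carrier (dual_module R M)"
  shows "coords (f \<oplus>\<^bsub>dual_module R M\<^esub> g) = coords f \<oplus>\<^bsub>P\<^esub> coords g"
  using eta_closed[OF gen_P] unfolding dual_module_simps by (auto simp: coords_def fun_eq_iff)

lemma coords_smult:
  assumes "c \<in> carrier R" "f \<in> carrier (dual_module R M)"
  shows "coords (c \<odot>\<^bsub>dual_module R M\<^esub> f) = c \<odot>\<^bsub>P\<^esub> coords f"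
  using eta_closed[OF gen_P] assms(1) unfolding dual_module_simps by (auto simp: coords_def fun_eq_iff)

text \<open>
  The map \<open>m \<otimes> f \<mapsto> (section_of m) f\<^sup>T\<close> from the tensor product to matrices modulo
  \<open>relation_mats\<close>, on representatives.
\<close>

lemma ex_tensor_to_mats:
  "\<exists>h\<in>module_hom R F Q. (\<forall>m\<in>carrier M. \<forall>f\<in>carrier (dual_module R M).
      h (free_gen R (m, f)) = outer (section_of m) (coords f)) \<and> (\<forall>t\<in>rel_span. h t \<in> relation_mats)"
proof -
  let ?g = "\<lambda>(m, f). outer (section_of m) (coords f)"
  have "\<exists>h\<in>module_hom R F Q. \<forall>y\<in>carrier M \<times> carrier (dual_module R M). h (free_gen R y) = ?g y"
  proof (rule free_module_extension[OF Q.module_axioms])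
    fix y assume "y \<in> carrier M \<times> carrier (dual_module R M)"
    then obtain m f where y: "y = (m, f)" "m \<in> carrier M" "f \<in> carrier (dual_module R M)" by (elim SigmaE)
    have "outer (section_of m) (coords f) \<in> carrier Q"
      by (intro outer_closed_Q section_of y dual_vecs_P coords_dual_vecs)
    then show "?g y \<in> carrier Q" unfolding y(1) prod.case .
  qed
  then obtain h where h: "h \<in> module_hom R F Q"
    and hg: "\<And>m f. m \<in> carrier M \<Longrightarrow> f \<in> carrier (dual_module R M) \<Longrightarrow>
               h (free_gen R (m, f)) = outer (section_of m) (coords f)" by fastforce
  note K = Q.submoduleE[OF relation_mats_submodule] Q.submodule_zero[OF relation_mats_submodule]
  note hh = module_homD[OF h]
  note hm = module_hom_minus[OF F.module_axioms Q.module_axioms h]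
  have zero: "u \<ominus>\<^bsub>Q\<^esub> u \<in> relation_mats" if "u \<in> carrier Q" for u
    using that K(7) by (simp add: a_minus_def Q.r_neg del: free_module_simps)
  \<comment> \<open>Relations in the second argument are respected exactly, since
    \<open>coords\<close> is linear; those in the first argument hold only modulo
    \<open>relation_mats\<close>, because \<open>section_of\<close> is not linear.\<close>
  have rel: "h t \<in> relation_mats" if "t \<in> tensor_relations R M (dual_module R M)" for t
    using that
  proof (cases rule: relations_cases)
    case (add_left x x' f)
    note s = section_of[OF add_left(1)] section_of[OF add_left(2)] section_of[OF M.a_closed[OF add_left(1,2)]]
    note f = coords_dual_vecs[OF add_left(3)]
    note g = gen_closed[OF add_left(1,3)] gen_closed[OF add_left(2,3)] gen_closed[OF M.a_closed[OF add_left(1,2)] add_left(3)]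
    have "h t = outer (section_of (x \<oplus>\<^bsub>M\<^esub> x')) (coords f) \<ominus>\<^bsub>Q\<^esub>
            (outer (section_of x) (coords f) \<oplus>\<^bsub>Q\<^esub> outer (section_of x') (coords f))"
      unfolding add_left(4) hm[OF g(3) F.a_closed[OF g(1,2)]] hh(2)[OF g(1,2)]
        hg[OF add_left(1,3)] hg[OF add_left(2,3)] hg[OF M.a_closed[OF add_left(1,2)] add_left(3)] ..
    also have "\<dots> = outer (section_of (x \<oplus>\<^bsub>M\<^esub> x')) (coords f) \<ominus>\<^bsub>Q\<^esub>
            outer (section_of x \<oplus>\<^bsub>P\<^esub> section_of x') (coords f)"
      unfolding module_homD(2)[OF outer_hom_left[OF dual_vecs_P[OF f]] s(1,3)] ..
    also have "\<dots> \<in> relation_mats"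
    proof (rule outer_eta_eq[OF s(5) P.a_closed[OF s(1,3)] _ f])
      show "\<eta> (section_of (x \<oplus>\<^bsub>M\<^esub> x')) = \<eta> (section_of x \<oplus>\<^bsub>P\<^esub> section_of x')"
        unfolding module_homD(2)[OF eta_hom s(1,3)] s(2,4,6) ..
    qed
    finally show ?thesis .
  next
    case (add_right x f f')
    note s = section_of(1)[OF add_right(1)]
    note ff = add_closed_N[OF add_right(2,3)]
    note f = dual_vecs_P[OF coords_dual_vecs[OF add_right(2)]] dual_vecs_P[OF coords_dual_vecs[OF add_right(3)]]
    note g = gen_closed[OF add_right(1,2)] gen_closed[OF add_right(1,3)] gen_closed[OF add_right(1) ff]
    have "h t = outer (section_of x) (coords f \<oplus>\<^bsub>P\<^esub> coords f') \<ominus>\<^bsub>Q\<^esub>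
            (outer (section_of x) (coords f) \<oplus>\<^bsub>Q\<^esub> outer (section_of x) (coords f'))"
      unfolding add_right(4) hm[OF g(3) F.a_closed[OF g(1,2)]] hh(2)[OF g(1,2)]
        hg[OF add_right(1,2)] hg[OF add_right(1,3)] hg[OF add_right(1) ff] coords_add[OF add_right(2,3)] ..
    also have "\<dots> \<in> relation_mats"
      unfolding module_homD(2)[OF outer_hom_right[OF s] f]
      by (intro zero Q.a_closed outer_closed_Q s f)
    finally show ?thesis .
  next
    case (smult_left c x f)
    note s = section_of[OF smult_left(2)] section_of[OF smult_closed[OF smult_left(1,2)]]
    note f = coords_dual_vecs[OF smult_left(3)]
    note g = gen_closed[OF smult_left(2,3)] gen_closed[OF smult_closed[OF smult_left(1,2)] smult_left(3)]
    have "h t = outer (section_of (c \<odot>\<^bsub>M\<^esub> x)) (coords f) \<ominus>\<^bsub>Q\<^esub> c \<odot>\<^bsub>Q\<^esub> outer (section_of x) (coords f)"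
      unfolding smult_left(4) hm[OF g(2) F.smult_closed[OF smult_left(1) g(1)]] hh(3)[OF smult_left(1) g(1)]
        hg[OF smult_left(2,3)] hg[OF smult_closed[OF smult_left(1,2)] smult_left(3)] ..
    also have "\<dots> = outer (section_of (c \<odot>\<^bsub>M\<^esub> x)) (coords f) \<ominus>\<^bsub>Q\<^esub> outer (c \<odot>\<^bsub>P\<^esub> section_of x) (coords f)"
      unfolding module_homD(3)[OF outer_hom_left[OF dual_vecs_P[OF f]] smult_left(1) s(1)] ..
    also have "\<dots> \<in> relation_mats"
    proof (rule outer_eta_eq[OF s(3) P.smult_closed[OF smult_left(1) s(1)] _ f])
      show "\<eta> (section_of (c \<odot>\<^bsub>M\<^esub> x)) = \<eta> (c \<odot>\<^bsub>P\<^esub> section_of x)"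
        unfolding module_homD(3)[OF eta_hom smult_left(1) s(1)] s(2,4) ..
    qed
    finally show ?thesis .
  next
    case (smult_right c x f)
    note s = section_of(1)[OF smult_right(2)]
    note cf = smult_closed_N[OF smult_right(1,3)]
    note f = dual_vecs_P[OF coords_dual_vecs[OF smult_right(3)]]
    note g = gen_closed[OF smult_right(2,3)] gen_closed[OF smult_right(2) cf]
    have "h t = outer (section_of x) (c \<odot>\<^bsub>P\<^esub> coords f) \<ominus>\<^bsub>Q\<^esub> c \<odot>\<^bsub>Q\<^esub> outer (section_of x) (coords f)"
      unfolding smult_right(4) hm[OF g(2) F.smult_closed[OF smult_right(1) g(1)]] hh(3)[OF smult_right(1) g(1)]
        hg[OF smult_right(2,3)] hg[OF smult_right(2) cf] coords_smult[OF smult_right(1,3)] ..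
    also have "\<dots> \<in> relation_mats"
      unfolding module_homD(3)[OF outer_hom_right[OF s] smult_right(1) f]
      by (intro zero Q.smult_closed outer_closed_Q s f smult_right(1))
    finally show ?thesis .
  qed
  have "rel_span \<subseteq> {t \<in> carrier F. h t \<in> relation_mats}"
    unfolding rel_span_def
  proof (rule F.module_span_minimal)
    show "submodule {t \<in> carrier F. h t \<in> relation_mats} R F"
      by (rule submodule_vimage[OF F.module_axioms Q.module_axioms h relation_mats_submodule])
    show "tensor_relations R M (dual_module R M) \<subseteq> {t \<in> carrier F. h t \<in> relation_mats}"
      using rel relations_subset by (auto simp del: free_module_simps)
  qed
  then show ?thesis using h hg by (intro bexI[of _ h]) auto
qed

text \<open>The passage from matrices back to tensors: \<open>Y\<close> is the sum of the rank-one
  matrices formed by the \<open>j\<close>-th basis vector and row \<open>j\<close>, and each of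
  these becomes a pure tensor.\<close>

definition tensor_of_mat :: "(nat \<times> nat \<Rightarrow> 'a) \<Rightarrow> ('c \<times> ('c \<Rightarrow> 'a) \<Rightarrow> 'a) set" where
  "tensor_of_mat Y = (\<Oplus>\<^bsub>T\<^esub> j\<in>{..<n}. tens (\<eta> (free_gen R j)) (functional (\<lambda>l. Y (j, l))))"

lemma tensor_of_mat_closed:
  assumes "Y \<in> carrier E" "Y \<otimes>\<^bsub>E\<^esub> a = \<zero>\<^bsub>E\<^esub>"
  shows "tensor_of_mat Y \<in> carrier T"
  unfolding tensor_of_mat_def
  by (intro T.finsum_closed Pi_I tens_closed eta_closed gen_P functional_closed row_dual_vecs[OF assms]) simp

text \<open>The map of \<open>ex_tensor_to_mats\<close> is applied to the evident representative
  \<open>t\<close>. The result would be \<open>Y\<close>, except that each basis vector is replaced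
  by the preimage that \<open>section_of\<close> selects for its image; this changes the sum by an
  element of \<open>relation_mats\<close>.\<close>

lemma tensor_of_mat_zeroD:
  assumes Y: "Y \<in> carrier E" "Y \<otimes>\<^bsub>E\<^esub> a = \<zero>\<^bsub>E\<^esub>" and z: "tensor_of_mat Y = \<zero>\<^bsub>T\<^esub>"
  shows "Y \<in> relation_mats"
proof -
  let ?e = "\<lambda>j. free_gen R j :: nat \<Rightarrow> 'a" and ?y = "\<lambda>j l. Y (j, l)"
  note y = row_dual_vecs[OF Y]
  note yP = dual_vecs_P[OF y]
  obtain h where h: "h \<in> module_hom R F Q"
    and hg: "\<And>m f. m \<in> carrier M \<Longrightarrow> f \<in> carrier (dual_module R M) \<Longrightarrow>
               h (free_gen R (m, f)) = outer (section_of m) (coords f)"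
    and hrel: "\<And>t. t \<in> rel_span \<Longrightarrow> h t \<in> relation_mats"
    using ex_tensor_to_mats by blast
  define t where "t = (\<Oplus>\<^bsub>F\<^esub> j\<in>{..<n}. free_gen R (\<eta> (?e j), functional (?y j)))"
  have g: "free_gen R (\<eta> (?e j), functional (?y j)) \<in> carrier F" if "j \<in> {..<n}" for j
    using that by (intro gen_closed eta_closed gen_P functional_closed y) simp
  have t: "t \<in> carrier F" unfolding t_def using g by (intro F.finsum_closed Pi_I)
  have "rel_span +>\<^bsub>F\<^esub> t = tensor_of_mat Y"
    unfolding t_def tensor_of_mat_def tens_def
    by (rule module_hom_finsum[OF F.module_axioms T.module_axioms proj_hom _ g]) simp
  then have "t \<in> rel_span" using z proj_eq_zero_iff[OF t] by simp
  then have ht: "h t \<in> relation_mats" by (rule hrel)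
  have "h t = (\<Oplus>\<^bsub>Q\<^esub> j\<in>{..<n}. h (free_gen R (\<eta> (?e j), functional (?y j))))"
    unfolding t_def by (rule module_hom_finsum[OF F.module_axioms Q.module_axioms h _ g]) simp
  also have "\<dots> = (\<Oplus>\<^bsub>Q\<^esub> j\<in>{..<n}. outer (section_of (\<eta> (?e j))) (?y j))"
  proof (rule Q.finsum_cong'[OF refl])
    show "(\<lambda>j. outer (section_of (\<eta> (?e j))) (?y j)) \<in> {..<n} \<rightarrow> carrier Q"
      by (intro Pi_I outer_closed_Q section_of eta_closed gen_P yP) simp
    fix j assume "j \<in> {..<n}"
    then have j: "j < n" by simp
    show "h (free_gen R (\<eta> (?e j), functional (?y j))) = outer (section_of (\<eta> (?e j))) (?y j)"
      unfolding hg[OF eta_closed[OF gen_P[OF j]] functional_closed[OF y]] coords_functional[OF y] ..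
  qed
  also have "\<dots> = (\<Oplus>\<^bsub>Q\<^esub> j\<in>{..<n}. outer (?e j) (?y j) \<oplus>\<^bsub>Q\<^esub>
                     (outer (section_of (\<eta> (?e j))) (?y j) \<ominus>\<^bsub>Q\<^esub> outer (?e j) (?y j)))"
  proof (rule Q.finsum_cong'[OF refl])
    have c: "outer (?e j) (?y j) \<in> carrier Q" "outer (section_of (\<eta> (?e j))) (?y j) \<in> carrier Q" if "j < n" for j
      using that by (intro outer_closed_Q section_of eta_closed gen_P yP; assumption)+
    show "(\<lambda>j. outer (?e j) (?y j) \<oplus>\<^bsub>Q\<^esub> (outer (section_of (\<eta> (?e j))) (?y j) \<ominus>\<^bsub>Q\<^esub> outer (?e j) (?y j)))
            \<in> {..<n} \<rightarrow> carrier Q"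
      using c by (intro Pi_I Q.a_closed Q.minus_closed) auto
    fix j assume "j \<in> {..<n}"
    then show "outer (section_of (\<eta> (?e j))) (?y j) = outer (?e j) (?y j) \<oplus>\<^bsub>Q\<^esub>
                  (outer (section_of (\<eta> (?e j))) (?y j) \<ominus>\<^bsub>Q\<^esub> outer (?e j) (?y j))"
      using c[of j] Q.a_comm[of "outer (?e j) (?y j)" "outer (section_of (\<eta> (?e j))) (?y j) \<ominus>\<^bsub>Q\<^esub> outer (?e j) (?y j)"]
      by (simp add: a_minus_def Q.a_assoc Q.l_neg del: free_module_simps)
  qed
  also have "\<dots> = (\<Oplus>\<^bsub>Q\<^esub> j\<in>{..<n}. outer (?e j) (?y j)) \<oplus>\<^bsub>Q\<^esub>
                  (\<Oplus>\<^bsub>Q\<^esub> j\<in>{..<n}. outer (section_of (\<eta> (?e j))) (?y j) \<ominus>\<^bsub>Q\<^esub> outer (?e j) (?y j))"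
    by (intro Q.finsum_addf Pi_I Q.minus_closed outer_closed_Q section_of eta_closed gen_P yP) simp_all
  also have "(\<Oplus>\<^bsub>Q\<^esub> j\<in>{..<n}. outer (?e j) (?y j)) = Y"
  proof -
    have "(\<Oplus>\<^bsub>Q\<^esub> j\<in>{..<n}. outer (?e j) (?y j)) = (\<lambda>p. \<Oplus>j\<in>{..<n}. outer (?e j) (?y j) p)"
      by (intro free_module_finsum outer_closed_Q gen_P yP) simp_all
    also have "\<dots> = Y"
    proof
      fix p :: "nat \<times> nat"
      obtain i l where p: "p = (i, l)" by (cases p)
      show "(\<Oplus>j\<in>{..<n}. outer (?e j) (?y j) p) = Y p"
      proof (cases "i < n")
        case True
        then show ?thesis
          using mat_ring_closed[OF Y(1)]
          by (subst R.finsum_single[of "{..<n}" i]) (auto simp: p outer_def free_gen_def)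
      next
        case False
        then have "(\<Oplus>j\<in>{..<n}. outer (?e j) (?y j) p) = \<zero>"
          using mat_ring_closed[OF Y(1)]
          by (intro R.add.finprod_one_eqI) (auto simp: p outer_def free_gen_def)
        then show ?thesis using False Y(1) by (simp add: p mat_ring_carrier_iff)
      qed
    qed
    finally show ?thesis .
  qed
  finally have eq: "h t = Y \<oplus>\<^bsub>Q\<^esub> (\<Oplus>\<^bsub>Q\<^esub> j\<in>{..<n}. outer (section_of (\<eta> (?e j))) (?y j) \<ominus>\<^bsub>Q\<^esub> outer (?e j) (?y j))"
    (is "_ = Y \<oplus>\<^bsub>Q\<^esub> ?D") .
  have D: "?D \<in> relation_mats"
    by (intro Q.submodule_finsum relation_mats_submodule outer_eta_eq section_of eta_closed gen_P y) simp_all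
  have YQ: "Y \<in> carrier Q" and DQ: "?D \<in> carrier Q"
    using Y(1) Q.submoduleE(1)[OF relation_mats_submodule] D by (auto simp: mat_ring_carrier simp del: free_module_simps)
  have "Y = h t \<ominus>\<^bsub>Q\<^esub> ?D"
    unfolding eq using YQ DQ by (simp add: a_minus_def Q.a_assoc Q.r_neg del: free_module_simps)
  then show ?thesis using Q.submodule_minus[OF relation_mats_submodule ht D] by simp
qed

text \<open>The coefficients of \<open>a\<close> are moved across the tensor sign. With rows
  \<open>z_k\<close> of \<open>Z\<close>, row \<open>j\<close> of \<open>x Y\<close> is the sum of
  the \<open>a (j, k) z_k\<close>; collecting by \<open>k\<close>, the left factors add up to
  \<open>\<eta> (A e_k)\<close>, which is zero.\<close>

lemma tensor_of_mat_torsion: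
  assumes Y: "Y \<in> carrier E" "Y \<otimes>\<^bsub>E\<^esub> a = \<zero>\<^bsub>E\<^esub>" and Z: "Z \<in> carrier E" "Z \<otimes>\<^bsub>E\<^esub> a = \<zero>\<^bsub>E\<^esub>"
    and x: "x \<in> carrier R" and eq: "x \<odot>\<^bsub>E\<^esub> Y = a \<otimes>\<^bsub>E\<^esub> Z"
  shows "x \<odot>\<^bsub>T\<^esub> tensor_of_mat Y = \<zero>\<^bsub>T\<^esub>"
proof -
  let ?e = "\<lambda>j. free_gen R j :: nat \<Rightarrow> 'a" and ?y = "\<lambda>j l. Y (j, l)" and ?z = "\<lambda>j l. Z (j, l)"
  note y = row_dual_vecs[OF Y] and z = row_dual_vecs[OF Z]
  have aE: "a \<in> carrier E" by (rule mat_of_closed[OF A_hom])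
  have aP: "(\<lambda>k. a (j, k)) \<in> carrier P" for j using aE unfolding P_iff by (auto simp: mat_ring_carrier_iff)
  have ac: "a (j, k) \<in> carrier R" for j k using P_closed[OF aP] .
  \<comment> \<open>\<open>h\<close> is the map \<open>c \<mapsto> c Z\<close> on row vectors; it
    takes row \<open>j\<close> of \<open>a\<close> to row \<open>j\<close> of
    \<open>a Z = x Y\<close>.\<close>
  obtain h where h: "h \<in> module_hom R P P" and hz: "\<And>k. k < n \<Longrightarrow> h (?e k) = ?z k"
    using free_module_extension[OF P.module_axioms, of "{..<n}" ?z] dual_vecs_P[OF z] by (auto simp del: free_module_simps)
  have hd: "h c \<in> dual_vecs" if c: "c \<in> carrier P" for c
  proof -
    have "h c = (\<Oplus>\<^bsub>P\<^esub> k\<in>{..<n}. c k \<odot>\<^bsub>P\<^esub> h (?e k))"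
      by (rule module_hom_free_expansion[OF _ P.module_axioms h c]) simp
    also have "\<dots> \<in> dual_vecs"
    proof (rule P.submodule_finsum[OF dual_vecs_submodule])
      fix k assume "k \<in> {..<n}"
      then show "c k \<odot>\<^bsub>P\<^esub> h (?e k) \<in> dual_vecs"
        using P.submoduleE(4)[OF dual_vecs_submodule P_closed[OF c] z[of k]] hz[of k] by simp
    qed simp
    finally show ?thesis .
  qed
  have row: "h (\<lambda>k. a (j, k)) = x \<odot>\<^bsub>P\<^esub> ?y j" if "j < n" for j
  proof
    fix l
    have "h (\<lambda>k. a (j, k)) l = (\<Oplus>k\<in>{..<n}. a (j, k) \<otimes> h (?e k) l)"
      by (rule hom_free_apply[OF h aP])
    also have "\<dots> = (\<Oplus>k\<in>{..<n}. a (j, k) \<otimes> Z (k, l))"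
      using ac mat_ring_closed[OF Z(1)] hz by (intro R.finsum_cong') auto
    also have "\<dots> = (a \<otimes>\<^bsub>E\<^esub> Z) (j, l)"
    proof (cases "l < n")
      case False
      then have "(\<Oplus>k\<in>{..<n}. a (j, k) \<otimes> Z (k, l)) = \<zero>"
        using ac Z(1) by (intro R.add.finprod_one_eqI) (auto simp: mat_ring_carrier_iff)
      then show ?thesis using False by simp
    qed (use that in simp)
    also have "\<dots> = (x \<odot>\<^bsub>P\<^esub> ?y j) l" unfolding eq[symmetric] by simp
    finally show "h (\<lambda>k. a (j, k)) l = (x \<odot>\<^bsub>P\<^esub> ?y j) l" .
  qed
  let ?t = "\<lambda>j k. tens (\<eta> (?e j)) (functional (h (?e k)))"
  have tc: "?t j k \<in> carrier T" if "j < n" "k < n" for j k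
    using that by (intro tens_closed eta_closed functional_closed hd gen_P)
  have "x \<odot>\<^bsub>T\<^esub> tensor_of_mat Y = (\<Oplus>\<^bsub>T\<^esub> j\<in>{..<n}. x \<odot>\<^bsub>T\<^esub> tens (\<eta> (?e j)) (functional (?y j)))"
    unfolding tensor_of_mat_def
    by (intro T.finsum_smult_ldistr x Pi_I tens_closed eta_closed gen_P functional_closed y) simp_all
  also have "\<dots> = (\<Oplus>\<^bsub>T\<^esub> j\<in>{..<n}. \<Oplus>\<^bsub>T\<^esub> k\<in>{..<n}. a (j, k) \<odot>\<^bsub>T\<^esub> ?t j k)"
  proof (rule T.finsum_cong'[OF refl])
    show "(\<lambda>j. \<Oplus>\<^bsub>T\<^esub> k\<in>{..<n}. a (j, k) \<odot>\<^bsub>T\<^esub> ?t j k) \<in> {..<n} \<rightarrow> carrier T"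
      using tc ac by (intro Pi_I T.finsum_closed T.smult_closed) auto
    fix j assume "j \<in> {..<n}"
    then have j: "j < n" by simp
    note m = eta_closed[OF gen_P[OF j]]
    have "x \<odot>\<^bsub>T\<^esub> tens (\<eta> (?e j)) (functional (?y j)) = tens (\<eta> (?e j)) (functional (h (\<lambda>k. a (j, k))))"
      unfolding row[OF j] functional_smult[OF x y] tens_smult_right[OF x m functional_closed[OF y]] ..
    also have "\<dots> = (\<Oplus>\<^bsub>T\<^esub> k\<in>{..<n}. a (j, k) \<odot>\<^bsub>T\<^esub> ?t j k)"
      by (rule module_hom_free_expansion[OF _ T.module_axioms tens_hom_right[OF m h hd] aP]) simp_all
    finally show "x \<odot>\<^bsub>T\<^esub> tens (\<eta> (?e j)) (functional (?y j)) = (\<Oplus>\<^bsub>T\<^esub> k\<in>{..<n}. a (j, k) \<odot>\<^bsub>T\<^esub> ?t j k)" .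
  qed
  also have "\<dots> = (\<Oplus>\<^bsub>T\<^esub> k\<in>{..<n}. \<Oplus>\<^bsub>T\<^esub> j\<in>{..<n}. a (j, k) \<odot>\<^bsub>T\<^esub> ?t j k)"
    using tc ac by (intro T.finsum_swap T.smult_closed) auto
  also have "\<dots> = \<zero>\<^bsub>T\<^esub>"
  proof (rule T.add.finprod_one_eqI)
    fix k assume "k \<in> {..<n}"
    then have k: "k < n" by simp
    note Ak = A_closed[OF gen_P[OF k]]
    note f = functional_closed[OF hd[OF gen_P[OF k]]]
    have "(\<Oplus>\<^bsub>T\<^esub> j\<in>{..<n}. a (j, k) \<odot>\<^bsub>T\<^esub> ?t j k) = (\<Oplus>\<^bsub>T\<^esub> j\<in>{..<n}. A (?e k) j \<odot>\<^bsub>T\<^esub> ?t j k)"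
      using tc k P_closed[OF Ak] by (intro T.finsum_cong' T.smult_closed Pi_I) (auto simp: mat_of_def)
    also have "\<dots> = tens (\<eta> (A (?e k))) (functional (h (?e k)))"
      by (rule module_hom_free_expansion[OF _ T.module_axioms tens_hom_left[OF f] Ak, symmetric]) simp
    also have "\<eta> (A (?e k)) = \<eta> \<zero>\<^bsub>P\<^esub>"
      unfolding eta_A[OF gen_P[OF k]] module_hom_zero[OF P.module_axioms module_axioms eta_hom] ..
    also have "tens (\<eta> \<zero>\<^bsub>P\<^esub>) (functional (h (?e k))) = \<zero>\<^bsub>T\<^esub>"
      by (rule module_hom_zero[OF P.module_axioms T.module_axioms tens_hom_left[OF f]])
    finally show "(\<Oplus>\<^bsub>T\<^esub> j\<in>{..<n}. a (j, k) \<odot>\<^bsub>T\<^esub> ?t j k) = \<zero>\<^bsub>T\<^esub>" .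
  qed
  finally show ?thesis .
qed

text \<open>The equation \<open>x Y = a Z\<close> makes the tensor of \<open>Y\<close> torsion,
  hence zero, and \<open>tensor_of_mat_zeroD\<close> brings this back to matrices.\<close>

lemma torsion_free_tensor_mats:
  assumes tf: "torsion_submodule R T = {\<zero>\<^bsub>T\<^esub>}"
    and Y: "Y \<in> carrier E" "Y \<otimes>\<^bsub>E\<^esub> a = \<zero>\<^bsub>E\<^esub>" and Z: "Z \<in> carrier E" "Z \<otimes>\<^bsub>E\<^esub> a = \<zero>\<^bsub>E\<^esub>"
    and x: "x \<in> carrier R - {\<zero>}" and eq: "x \<odot>\<^bsub>E\<^esub> Y = a \<otimes>\<^bsub>E\<^esub> Z"
  shows "\<exists>Z'\<in>carrier E. Y = a \<otimes>\<^bsub>E\<^esub> Z' \<and> Z' \<otimes>\<^bsub>E\<^esub> a = \<zero>\<^bsub>E\<^esub>"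
proof -
  have "tensor_of_mat Y \<in> torsion_submodule R T"
    unfolding torsion_submodule_def
    using tensor_of_mat_closed[OF Y] tensor_of_mat_torsion[OF Y Z _ eq] x by blast
  then have "Y \<in> relation_mats" using tensor_of_mat_zeroD[OF Y] tf by blast
  then show ?thesis by (auto simp: relation_mats_def)
qed

end

section \<open>Local domains of dimension one\<close>

lemma (in local_ring) max_ideal_maximal: "maximalideal (max_ideal R) R"
  unfolding max_ideal_def by (rule theI'[OF unique_maximal])

lemma (in local_ring) max_ideal_unique: "maximalideal J R \<Longrightarrow> J = max_ideal R"
  using unique_maximal max_ideal_maximal by blast

lemma (in ideal) finsum_mem:
  assumes "finite J" "\<And>j. j \<in> J \<Longrightarrow> u j \<in> I"
  shows "finsum R u J \<in> I"
  using assms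
proof (induction J rule: finite_induct)
  case (insert j J)
  then have "finsum R u (insert j J) = u j \<oplus> finsum R u J"
    by (intro finsum_insert) (auto intro: Icarr)
  then show ?case using insert by auto
qed simp

locale local_domain_dim1 = noetherian_domain R + local_ring R for R (structure) +
  assumes dim: "krull_dim R = 1"
begin

abbreviation "\<mm> \<equiv> max_ideal R"

sublocale mm: maximalideal \<mm> R
  by (rule max_ideal_maximal)

lemma proper_ideal_subset: "ideal I R \<Longrightarrow> I \<noteq> carrier R \<Longrightarrow> I \<subseteq> \<mm>"
  using proper_ideal_subset_maximal max_ideal_unique by blast

lemma one_notin: "\<one> \<notin> \<mm>"
  using mm.one_imp_carrier mm.I_notcarr by blast

lemma one_minus_unit:
  assumes t: "t \<in> \<mm>"
  shows "\<one> \<ominus> t \<in> Units R"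
proof -
  have tc: "t \<in> carrier R" by (rule mm.Icarr[OF t])
  have c: "\<one> \<ominus> t \<in> carrier R" using tc by simp
  have "PIdl (\<one> \<ominus> t) = carrier R"
  proof (rule ccontr)
    assume "PIdl (\<one> \<ominus> t) \<noteq> carrier R"
    then have "\<one> \<ominus> t \<in> \<mm>"
      using proper_ideal_subset[OF cgenideal_ideal[OF c]] cgenideal_self[OF c] by blast
    then have "(\<one> \<ominus> t) \<oplus> t \<in> \<mm>" using t by (rule mm.a_closed)
    moreover have "(\<one> \<ominus> t) \<oplus> t = \<one>" using tc by (simp add: a_minus_def a_assoc l_neg)
    ultimately show False using one_notin by simp
  qed
  then have "\<one> \<in> PIdl (\<one> \<ominus> t)" by simp
  then obtain s where "s \<in> carrier R" "\<one> = s \<otimes> (\<one> \<ominus> t)" by (auto simp: cgenideal_def)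
  then show ?thesis using c m_comm[of s "\<one> \<ominus> t"] by (auto simp: Units_def intro!: bexI[of _ s])
qed

text \<open>Positive dimension provides two primes, one strictly inside the other; an element of the
  larger outside the smaller is nonzero and lies in the maximal ideal.\<close>

lemma ex_nonzero_max_ideal: "\<exists>x\<in>\<mm>. x \<noteq> \<zero>"
proof -
  have "0 < krull_dim R" using dim by simp
  then obtain m \<pp> where m: "0 < m" "prime_chain R m \<pp>"
    unfolding krull_dim_def less_Sup_iff by (auto simp: zero_enat_def)
  then have p: "primeideal (\<pp> 0) R" "primeideal (\<pp> 1) R" "\<pp> 0 \<subset> \<pp> 1" by (auto simp: prime_chain_def)
  interpret p1: primeideal "\<pp> 1" R by (rule p(2))
  interpret p0: primeideal "\<pp> 0" R by (rule p(1))
  have "\<pp> 1 \<subseteq> \<mm>" using proper_ideal_subset[OF p1.is_ideal] p1.I_notcarr by blast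
  moreover obtain x where "x \<in> \<pp> 1" "x \<notin> \<pp> 0" using p(3) by blast
  ultimately show ?thesis using p0.zero_closed by (metis subsetD)
qed

lemma finite_length_scalar:
  assumes "x \<in> carrier R" "x \<noteq> \<zero>"
  shows "interval_length R (regular_module R) (PIdl x) (carrier R) \<noteq> \<infinity>"
  using finite_interval_length[OF dim cgenideal_ideal[OF assms(1)]] cgenideal_self[OF assms(1)] assms(2) by blast

end

section \<open>Exact pairs between finite free modules\<close>

text \<open>If \<open>f v = x z\<close>, then \<open>x (g z) = g (f v) = 0\<close>, so
  \<open>g z = 0\<close> in a domain and \<open>z = f y\<close>. Now \<open>v - x y\<close> lies in
  the kernel of \<open>f\<close>, which is the image of \<open>g\<close>.\<close>

lemma (in domain) exact_mod_scalar:
  assumes X: "finite X" and Y: "finite Y"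
    and f: "f \<in> module_hom R (free_module R X) (free_module R Y)"
    and g: "g \<in> module_hom R (free_module R Y) (free_module R X)"
    and kf: "{v \<in> carrier (free_module R X). f v = \<zero>\<^bsub>free_module R Y\<^esub>} = g ` carrier (free_module R Y)"
    and kg: "{v \<in> carrier (free_module R Y). g v = \<zero>\<^bsub>free_module R X\<^esub>} = f ` carrier (free_module R X)"
    and x: "x \<in> carrier R" "x \<noteq> \<zero>"
  shows "f ` ideal_power (PIdl x) X \<subseteq> ideal_power (PIdl x) Y"
    and "{v \<in> carrier (free_module R X). f v \<in> ideal_power (PIdl x) Y}
           = ideal_power (PIdl x) X <+>\<^bsub>free_module R X\<^esub> g ` carrier (free_module R Y)"
proof -
  let ?M = "free_module R X" and ?N = "free_module R Y"
  interpret M: module R ?M by (rule free_module_is_module)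
  interpret N: module R ?N by (rule free_module_is_module)
  note fD = module_homD[OF f] and gD = module_homD[OF g]
  note IX = ideal_power_cgenideal[OF X x(1)] and IY = ideal_power_cgenideal[OF Y x(1)]
  show im: "f ` ideal_power (PIdl x) X \<subseteq> ideal_power (PIdl x) Y"
    unfolding IX IY using fD(1,3) x(1) by (auto simp del: free_module_simps)
  have DY: "submodule (ideal_power (PIdl x) Y) R ?N"
    by (rule submodule_ideal_power[OF cgenideal_ideal[OF x(1)]])
  have DX: "submodule (ideal_power (PIdl x) X) R ?M"
    by (rule submodule_ideal_power[OF cgenideal_ideal[OF x(1)]])
  show "{v \<in> carrier ?M. f v \<in> ideal_power (PIdl x) Y} = ideal_power (PIdl x) X <+>\<^bsub>?M\<^esub> g ` carrier ?N"
  proof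
    show "ideal_power (PIdl x) X <+>\<^bsub>?M\<^esub> g ` carrier ?N \<subseteq> {v \<in> carrier ?M. f v \<in> ideal_power (PIdl x) Y}"
    proof (rule M.set_add_least)
      show "submodule {v \<in> carrier ?M. f v \<in> ideal_power (PIdl x) Y} R ?M"
        by (rule submodule_vimage[OF M.module_axioms N.module_axioms f DY])
      show "ideal_power (PIdl x) X \<subseteq> {v \<in> carrier ?M. f v \<in> ideal_power (PIdl x) Y}"
        using im M.submoduleE(1)[OF DX] by blast
      show "g ` carrier ?N \<subseteq> {v \<in> carrier ?M. f v \<in> ideal_power (PIdl x) Y}"
        unfolding kf[symmetric] using N.submodule_zero[OF DY] by (auto simp del: free_module_simps)
    qed
    show "{v \<in> carrier ?M. f v \<in> ideal_power (PIdl x) Y} \<subseteq> ideal_power (PIdl x) X <+>\<^bsub>?M\<^esub> g ` carrier ?N"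
    proof
      fix v assume "v \<in> {v \<in> carrier ?M. f v \<in> ideal_power (PIdl x) Y}"
      then have v: "v \<in> carrier ?M" and "f v \<in> ideal_power (PIdl x) Y" by blast+
      then obtain z where z: "z \<in> carrier ?N" "f v = x \<odot>\<^bsub>?N\<^esub> z" unfolding IY by blast
      have "g (f v) = \<zero>\<^bsub>?M\<^esub>" using kg v by blast
      then have "x \<odot>\<^bsub>?M\<^esub> g z = \<zero>\<^bsub>?M\<^esub>" using gD(3)[OF x(1) z(1)] z(2) by simp
      then have "x \<otimes> g z i = \<zero>" for i by (simp add: fun_eq_iff)
      then have "g z i = \<zero>" for i using gD(1)[OF z(1)] x integral[of x "g z i"] by auto
      then have "g z = \<zero>\<^bsub>?M\<^esub>" by auto
      then obtain y where y: "y \<in> carrier ?M" "z = f y" using kg z(1) by blast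
      define w where "w = v \<ominus>\<^bsub>?M\<^esub> x \<odot>\<^bsub>?M\<^esub> y"
      have xy: "x \<odot>\<^bsub>?M\<^esub> y \<in> carrier ?M" by (rule M.smult_closed[OF x(1) y(1)])
      have "f w = f v \<ominus>\<^bsub>?N\<^esub> f (x \<odot>\<^bsub>?M\<^esub> y)"
        unfolding w_def by (rule module_hom_minus[OF M.module_axioms N.module_axioms f v xy])
      also have "\<dots> = \<zero>\<^bsub>?N\<^esub>"
        unfolding fD(3)[OF x(1) y(1)] z(2) y(2)[symmetric]
        using N.smult_closed[OF x(1) z(1)] by (simp add: a_minus_def N.r_neg del: free_module_simps)
      finally have "w \<in> g ` carrier ?N" using kf M.minus_closed[OF v xy] by (auto simp: w_def simp del: free_module_simps)
      moreover have "x \<odot>\<^bsub>?M\<^esub> y \<in> ideal_power (PIdl x) X" unfolding IX using y(1) by blast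
      moreover have "v = x \<odot>\<^bsub>?M\<^esub> y \<oplus>\<^bsub>?M\<^esub> w"
        unfolding w_def using v xy M.a_comm[of "x \<odot>\<^bsub>?M\<^esub> y" "v \<ominus>\<^bsub>?M\<^esub> x \<odot>\<^bsub>?M\<^esub> y"]
        by (simp add: a_minus_def M.a_assoc M.l_neg del: free_module_simps)
      ultimately show "v \<in> ideal_power (PIdl x) X <+>\<^bsub>?M\<^esub> g ` carrier ?N"
        using set_addI[of "x \<odot>\<^bsub>?M\<^esub> y" "ideal_power (PIdl x) X" w "g ` carrier ?N" ?M] by simp
    qed
  qed
qed

text \<open>
  Modulo a nonzero \<open>x\<close> the pair remains exact, and now the modules \<open>(R / x)\<^sup>X\<close> and \<open>(R / x)\<^sup>Y\<close> have
  finite length.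
\<close>

lemma (in local_domain_dim1) exact_pair_card_eq:
  assumes X: "finite X" and Y: "finite Y"
    and f: "f \<in> module_hom R (free_module R X) (free_module R Y)"
    and g: "g \<in> module_hom R (free_module R Y) (free_module R X)"
    and kf: "{v \<in> carrier (free_module R X). f v = \<zero>\<^bsub>free_module R Y\<^esub>} = g ` carrier (free_module R Y)"
    and kg: "{v \<in> carrier (free_module R Y). g v = \<zero>\<^bsub>free_module R X\<^esub>} = f ` carrier (free_module R X)"
  shows "card X = card Y"
proof -
  \<comment> \<open>Taking \<open>x\<close> in the maximal ideal makes \<open>R / x\<close> nonzero,
    so its length is positive and can be cancelled at the end.\<close>
  obtain x where xm: "x \<in> \<mm>" "x \<noteq> \<zero>" using ex_nonzero_max_ideal by blast
  then have x: "x \<in> carrier R" "x \<noteq> \<zero>" using mm.Icarr by auto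
  note I = cgenideal_ideal[OF x(1)]
  let ?l = "interval_length R (regular_module R) (PIdl x) (carrier R)"
  have "PIdl x \<subseteq> \<mm>" by (rule cgenideal_minimal[OF mm.is_ideal xm(1)])
  then have "\<one> \<notin> PIdl x" using one_notin by blast
  then have "PIdl x \<subset> carrier R" using ideal.Icarr[OF I] by auto
  then have "1 \<le> ?l"
    by (intro interval_length_pos) (auto simp: submodule_regular_iff I oneideal)
  moreover have "?l \<noteq> \<infinity>" by (rule finite_length_scalar[OF x])
  ultimately obtain k where k: "?l = enat k" "1 \<le> k" by (cases ?l) (auto simp: one_enat_def)
  note m1 = exact_mod_scalar[OF X Y f g kf kg x] and m2 = exact_mod_scalar[OF Y X g f kg kf x]
  have "interval_length R (free_module R X) (ideal_power (PIdl x) X) (carrier (free_module R X))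
      = interval_length R (free_module R Y) (ideal_power (PIdl x) Y) (carrier (free_module R Y))"
    by (rule exact_pair_length_eq[OF free_module_is_module free_module_is_module f g
          submodule_ideal_power[OF I] submodule_ideal_power[OF I] m1(1) m2(1) m1(2) m2(2)])
  then have "of_nat (card X) * enat k = of_nat (card Y) * enat k"
    unfolding interval_length_ideal_power[OF I X] interval_length_ideal_power[OF I Y] k(1) .
  then show ?thesis using k(2) by (auto simp: of_nat_eq_enat)
qed

text \<open>All entries of \<open>a V\<close> lie in the maximal ideal, so each column of
  \<open>a\<close> solves a linear system of the kind treated in
  \<open>nakayama_finite\<close>.\<close>

lemma (in local_domain_dim1) mat_ring_nakayama:
  assumes a: "a \<in> carrier (mat_ring R n)" "\<And>i j. a (i, j) \<in> \<mm>"
    and V: "V \<in> carrier (mat_ring R n)"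
    and eq: "a = a \<otimes>\<^bsub>mat_ring R n\<^esub> V \<otimes>\<^bsub>mat_ring R n\<^esub> a"
  shows "a = \<zero>\<^bsub>mat_ring R n\<^esub>"
proof
  fix p :: "nat \<times> nat"
  obtain i j where p: "p = (i, j)" by (cases p)
  let ?\<mu> = "\<lambda>i l. (a \<otimes>\<^bsub>mat_ring R n\<^esub> V) (i, l)"
  show "a p = \<zero>\<^bsub>mat_ring R n\<^esub> p"
  proof (cases "i < n \<and> j < n")
    case True
    have \<mu>: "?\<mu> i l \<in> \<mm>" for i l
      using a(2) mat_ring_closed[OF V] by (auto intro!: mm.finsum_mem mm.I_r_closed)
    have step: "a (i, j) = (\<Oplus>l\<in>{..<n}. ?\<mu> i l \<otimes> a (l, j))" if "i \<in> {..<n}" for i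
    proof -
      have "a (i, j) = (a \<otimes>\<^bsub>mat_ring R n\<^esub> V \<otimes>\<^bsub>mat_ring R n\<^esub> a) (i, j)" using eq by simp
      also have "\<dots> = (\<Oplus>l\<in>{..<n}. ?\<mu> i l \<otimes> a (l, j))"
        unfolding mat_ring_simps(4)[of R n "a \<otimes>\<^bsub>mat_ring R n\<^esub> V"] using that True by (simp del: mat_ring_simps(4))
      finally show ?thesis .
    qed
    have "a (i, j) = \<zero>"
    proof (rule nakayama_finite[OF mm.is_ideal one_minus_unit, of "{..<n}" "\<lambda>i. a (i, j)" ?\<mu>])
      show "i \<in> {..<n}" using True by simp
    qed (rule finite_lessThan mat_ring_closed[OF a(1)] \<mu> step | assumption)+
    then show ?thesis by (simp add: p)
  qed (use a(1) in \<open>auto simp: p mat_ring_carrier_iff\<close>)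
qed

lemma (in local_domain_dim1) exact_pair_torsion:
  assumes pres: "free_presentation R M n \<eta> A"
    and B: "B \<in> module_hom R (free_module R {..<n}) (free_module R {..<n})"
    and kA: "{v \<in> carrier (free_module R {..<n}). A v = \<zero>\<^bsub>free_module R {..<n}\<^esub>} = B ` carrier (free_module R {..<n})"
    and kB: "{v \<in> carrier (free_module R {..<n}). B v = \<zero>\<^bsub>free_module R {..<n}\<^esub>} = A ` carrier (free_module R {..<n})"
    and Am: "A ` carrier (free_module R {..<n}) \<subseteq> ideal_power \<mm> {..<n}"
    and Bm: "B ` carrier (free_module R {..<n}) \<subseteq> ideal_power \<mm> {..<n}"
    and n: "0 < n"
  shows "torsion_submodule R (tensor_module R M (dual_module R M)) \<noteq> {\<zero>\<^bsub>tensor_module R M (dual_module R M)\<^esub>}"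
proof
  assume tf: "torsion_submodule R (tensor_module R M (dual_module R M)) = {\<zero>\<^bsub>tensor_module R M (dual_module R M)\<^esub>}"
  interpret pres: free_presentation R M n \<eta> A by (rule pres)
  define E where "E = mat_ring R n"
  note Esimps = mat_ring_simps[of R n, folded E_def]
  interpret E: ring E unfolding E_def by (rule mat_ring_ring)
  interpret EM: module R E unfolding E_def by (rule mat_ring_module)
  define a b where "a = mat_of R n A" and "b = mat_of R n B"
  have ab: "a \<in> carrier E" "b \<in> carrier E"
    unfolding a_def b_def E_def by (intro mat_of_closed pres.A_hom B)+
  note sl = mat_ring_smult_left[of _ _ n, folded E_def] and sr = mat_ring_smult_right[of _ _ n, folded E_def]
  note exA = mat_of_exact[OF pres.A_hom B kA, folded E_def a_def b_def]
  note exB = mat_of_exact[OF B pres.A_hom kB, folded E_def a_def b_def]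
  obtain e x where e: "e \<in> carrier E" "e \<otimes>\<^bsub>E\<^esub> e = e" and x: "x \<in> carrier R - {\<zero>}"
    and indep: "\<And>C. C \<in> carrier E \<Longrightarrow> C \<otimes>\<^bsub>E\<^esub> e \<otimes>\<^bsub>E\<^esub> a = \<zero>\<^bsub>E\<^esub> \<Longrightarrow> C \<otimes>\<^bsub>E\<^esub> e = \<zero>\<^bsub>E\<^esub>"
    and rank: "\<And>W. W \<in> carrier E \<Longrightarrow> \<exists>C\<in>carrier E. \<exists>Z\<in>carrier E. x \<odot>\<^bsub>E\<^esub> W = C \<otimes>\<^bsub>E\<^esub> e \<oplus>\<^bsub>E\<^esub> Z \<and> Z \<otimes>\<^bsub>E\<^esub> a = \<zero>\<^bsub>E\<^esub>"
    using mat_ring_independent_columns[of a n, folded E_def, OF ab(1)] by blast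
  have xc: "x \<in> carrier R" "x \<noteq> \<zero>" using x by auto
  \<comment> \<open>Multiplying by \<open>x\<close> decomposes \<open>W\<close>:
    \<open>x a W = (a C) e + a Z\<close>. Since \<open>a W a = 0\<close> and \<open>Z a = 0\<close>,
    multiplication by \<open>a\<close> from the right gives \<open>(a C) e a = 0\<close>, so
    \<open>indep\<close> removes the free summand. What is left, \<open>x a W = a Z\<close>, says
    that \<open>a W\<close> represents torsion.\<close>
  have tor: "\<exists>Z\<in>carrier E. a \<otimes>\<^bsub>E\<^esub> W = a \<otimes>\<^bsub>E\<^esub> Z \<and> Z \<otimes>\<^bsub>E\<^esub> a = \<zero>\<^bsub>E\<^esub>"
    if W: "W \<in> carrier E" and z: "a \<otimes>\<^bsub>E\<^esub> W \<otimes>\<^bsub>E\<^esub> a = \<zero>\<^bsub>E\<^esub>" for W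
  proof -
    obtain C Z where C: "C \<in> carrier E" "Z \<in> carrier E" "x \<odot>\<^bsub>E\<^esub> W = C \<otimes>\<^bsub>E\<^esub> e \<oplus>\<^bsub>E\<^esub> Z" "Z \<otimes>\<^bsub>E\<^esub> a = \<zero>\<^bsub>E\<^esub>"
      using rank[OF W] by blast
    have eq: "x \<odot>\<^bsub>E\<^esub> (a \<otimes>\<^bsub>E\<^esub> W) = (a \<otimes>\<^bsub>E\<^esub> C) \<otimes>\<^bsub>E\<^esub> e \<oplus>\<^bsub>E\<^esub> a \<otimes>\<^bsub>E\<^esub> Z"
      unfolding sr[OF xc(1) ab(1) W, symmetric] C(3) using ab(1) C(1,2) e(1) by (simp add: E.r_distr E.m_assoc)
    have "\<zero>\<^bsub>E\<^esub> = x \<odot>\<^bsub>E\<^esub> (a \<otimes>\<^bsub>E\<^esub> W) \<otimes>\<^bsub>E\<^esub> a"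
      using sl[OF xc(1) E.m_closed[OF ab(1) W] ab(1)] z EM.smult_r_null[OF xc(1)] by metis
    also have "\<dots> = (a \<otimes>\<^bsub>E\<^esub> C) \<otimes>\<^bsub>E\<^esub> e \<otimes>\<^bsub>E\<^esub> a \<oplus>\<^bsub>E\<^esub> a \<otimes>\<^bsub>E\<^esub> (Z \<otimes>\<^bsub>E\<^esub> a)"
      unfolding eq using ab(1) C(1,2) e(1) by (simp add: E.l_distr E.m_assoc)
    also have "\<dots> = (a \<otimes>\<^bsub>E\<^esub> C) \<otimes>\<^bsub>E\<^esub> e \<otimes>\<^bsub>E\<^esub> a" using ab(1) C e(1) by simp
    finally have "(a \<otimes>\<^bsub>E\<^esub> C) \<otimes>\<^bsub>E\<^esub> e = \<zero>\<^bsub>E\<^esub>" using indep[of "a \<otimes>\<^bsub>E\<^esub> C"] ab(1) C(1) by simp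
    then have "x \<odot>\<^bsub>E\<^esub> (a \<otimes>\<^bsub>E\<^esub> W) = a \<otimes>\<^bsub>E\<^esub> Z" unfolding eq using ab(1) C(2) by simp
    then show ?thesis
      using pres.torsion_free_tensor_mats[OF tf _ _ _ _ x, folded E_def a_def, OF E.m_closed[OF ab(1) W] z C(2,4)]
      by blast
  qed
  have "\<exists>V\<in>carrier E. a = a \<otimes>\<^bsub>E\<^esub> V \<otimes>\<^bsub>E\<^esub> a"
  proof (rule exact_pair_regular[OF EM.module_axioms E.ring_axioms sl sr ab e exA(1) exB(1) exA(2) exB(2) indep xc(1) rank _ tor])
    show "interval_length R E {x \<odot>\<^bsub>E\<^esub> W | W. W \<in> carrier E} (carrier E) \<noteq> \<infinity>"
      unfolding E_def by (rule mat_ring_finite_colength[OF xc(1) finite_length_scalar[OF xc]])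
  qed
  then obtain V where V: "V \<in> carrier E" "a = a \<otimes>\<^bsub>E\<^esub> V \<otimes>\<^bsub>E\<^esub> a" by blast
  have m: "mat_of R n h (i, j) \<in> \<mm>" if "h ` carrier (free_module R {..<n}) \<subseteq> ideal_power \<mm> {..<n}" for h i j
  proof (cases "i < n \<and> j < n")
    case True
    then have "h (free_gen R j) \<in> ideal_power \<mm> {..<n}" using that pres.gen_P[of j] by blast
    then show ?thesis using True by (simp add: mat_of_def ideal_power_def)
  qed (use mm.zero_closed in \<open>auto simp: mat_of_def\<close>)
  have "a = \<zero>\<^bsub>E\<^esub>"
    using mat_ring_nakayama[OF ab(1)[unfolded E_def] _ V[unfolded E_def]] m[OF Am] unfolding E_def a_def by blast
  \<comment> \<open>Left multiplication by \<open>a\<close> kills even the identity, which is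
    therefore \<open>b U\<close>. All entries of \<open>b\<close> lie in the maximal ideal, and
    comparing entry \<open>(0, 0)\<close>, available because \<open>0 < n\<close>, gives the
    contradiction.\<close>
  then have "a \<otimes>\<^bsub>E\<^esub> \<one>\<^bsub>E\<^esub> = \<zero>\<^bsub>E\<^esub>" by simp
  then obtain U where U: "U \<in> carrier E" "\<one>\<^bsub>E\<^esub> = b \<otimes>\<^bsub>E\<^esub> U" using exA(2)[OF E.one_closed] by blast
  have "\<one> = \<one>\<^bsub>E\<^esub> (0, 0)" using n by (simp add: E_def)
  also have "\<dots> = (b \<otimes>\<^bsub>E\<^esub> U) (0, 0)" using U(2) by simp
  also have "\<dots> \<in> \<mm>"
    unfolding E_def b_def mat_ring_simps(4)
    using m[OF Bm] mat_ring_closed[OF U(1)[unfolded E_def]] by (auto intro!: mm.finsum_mem mm.I_r_closed)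
  finally show False using one_notin by simp
qed

section \<open>Two-periodic modules\<close>

lemma module_iso_inverse:
  assumes M: "module R M" and h: "h \<in> module_hom R M N" "bij_betw h (carrier M) (carrier N)"
  shows "inv_into (carrier M) h \<in> module_hom R N M"
proof -
  interpret M: module R M by fact
  let ?k = "inv_into (carrier M) h"
  have kM: "?k y \<in> carrier M" and hk: "h (?k y) = y" if "y \<in> carrier N" for y
    using that h(2) by (auto simp: bij_betw_def inv_into_into f_inv_into_f)
  have kh: "?k (h x) = x" if "x \<in> carrier M" for x
    using that h(2) by (simp add: bij_betw_def)
  note hD = module_homD[OF h(1)]
  show ?thesis
  proof (rule module_homI)
    fix y assume y: "y \<in> carrier N"
    show "?k y \<in> carrier M" by (rule kM[OF y])
    show "?k (y \<oplus>\<^bsub>N\<^esub> z) = ?k y \<oplus>\<^bsub>M\<^esub> ?k z" if z: "z \<in> carrier N" for z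
      using kh[OF M.a_closed[OF kM[OF y] kM[OF z]]] hD(2)[OF kM[OF y] kM[OF z]] hk y z by simp
    show "?k (c \<odot>\<^bsub>N\<^esub> y) = c \<odot>\<^bsub>M\<^esub> ?k y" if c: "c \<in> carrier R" for c
      using kh[OF M.smult_closed[OF c kM[OF y]]] hD(3)[OF c kM[OF y]] hk y by simp
  qed
qed

text \<open>Turns minimality, formulated for abstract free modules, into a statement on coordinates
  and hence on matrix entries.\<close>

lemma (in cring) ideal_smult_coordinates:
  assumes I: "ideal I R" and N: "module R N" and k: "k \<in> module_hom R N (free_module R X)"
    and y: "y \<in> ideal_smult R I N"
  shows "k y \<in> ideal_power I X"
proof -
  interpret N: module R N by fact
  interpret F: module R "free_module R X" by (rule free_module_is_module)
  interpret I: ideal I R by fact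
  have "ideal_smult R I N \<subseteq> {y \<in> carrier N. k y \<in> ideal_power I X}"
    unfolding ideal_smult_def
  proof (rule N.module_span_minimal)
    show "submodule {y \<in> carrier N. k y \<in> ideal_power I X} R N"
      by (rule submodule_vimage[OF N F.module_axioms k submodule_ideal_power[OF I]])
    show "{c \<odot>\<^bsub>N\<^esub> z | c z. c \<in> I \<and> z \<in> carrier N} \<subseteq> {y \<in> carrier N. k y \<in> ideal_power I X}"
    proof
      fix w assume "w \<in> {c \<odot>\<^bsub>N\<^esub> z | c z. c \<in> I \<and> z \<in> carrier N}"
      then obtain c z where w: "w = c \<odot>\<^bsub>N\<^esub> z" "c \<in> I" "z \<in> carrier N" by blast
      have c: "c \<in> carrier R" by (rule I.Icarr[OF w(2)])
      have wN: "w \<in> carrier N" unfolding w(1) by (rule N.smult_closed[OF c w(3)])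
      have "k w = c \<odot>\<^bsub>free_module R X\<^esub> k z" unfolding w(1) by (rule module_homD(3)[OF k c w(3)])
      then have "k w p \<in> I" for p
        using module_homD(1)[OF k w(3)] I.I_r_closed[OF w(2), of "k z p"] by simp
      then show "w \<in> {y \<in> carrier N. k y \<in> ideal_power I X}"
        using wN module_homD(1)[OF k wN] by (simp add: ideal_power_def)
    qed
  qed
  then show ?thesis using y by blast
qed

theorem theorem1p3:
  fixes R :: "('a, 'r) ring_scheme"
    and M :: "('a, 'b, 'm) module_scheme"
    and \<Omega> :: "('a, 'c) module"
  assumes "noetherian_domain R"
    and "local_ring R"
    and "krull_dim R = 1"
    and "module R M"
    and "finitely_generated_module R M"
    and "carrier M \<noteq> {\<zero>\<^bsub>M\<^esub>}"
    and "is_syzygy R 2 M \<Omega>"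
    and "modules_isomorphic R M \<Omega>"
  shows "torsion_submodule R (tensor_module R M (dual_module R M))
           \<noteq> {\<zero>\<^bsub>tensor_module R M (dual_module R M)\<^esub>}"
proof -
  interpret local_domain_dim1 R
    by (intro local_domain_dim1.intro local_domain_dim1_axioms.intro assms(1-3))
  interpret M: module R M by fact
  obtain F d \<epsilon> where res: "minimal_free_resolution R M F d \<epsilon>"
    and \<Omega>: "\<Omega> = (F 1)\<lparr>carrier := d 2 ` carrier (F 2)\<rparr>"
    using assms(7) by (auto simp: is_syzygy_def)
  have ff: "finite_free_module R (F i)" for i using res by (simp add: minimal_free_resolution_def)
  then interpret F0: module R "F 0" by (simp add: finite_free_module_def)
  interpret F1: module R "F 1" using ff by (simp add: finite_free_module_def)
  have \<epsilon>: "\<epsilon> \<in> module_hom R (F 0) M" "\<epsilon> ` carrier (F 0) = carrier M"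
    and d1: "d 1 \<in> module_hom R (F 1) (F 0)"
    and ker\<epsilon>: "d 1 ` carrier (F 1) = {x \<in> carrier (F 0). \<epsilon> x = \<zero>\<^bsub>M\<^esub>}"
    and kerd1: "d 2 ` carrier (F 2) = {x \<in> carrier (F 1). d 1 x = \<zero>\<^bsub>F 0\<^esub>}"
    and min1: "d 1 ` carrier (F 1) \<subseteq> ideal_smult R \<mm> (F 0)"
    and min2: "d 2 ` carrier (F 2) \<subseteq> ideal_smult R \<mm> (F 1)"
  proof -
    have r: "\<epsilon> \<in> module_hom R (F 0) M" "\<epsilon> ` carrier (F 0) = carrier M"
      "\<And>n. d (Suc n) \<in> module_hom R (F (Suc n)) (F n)"
      "d 1 ` carrier (F 1) = {x \<in> carrier (F 0). \<epsilon> x = \<zero>\<^bsub>M\<^esub>}"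
      "\<And>n. d (Suc (Suc n)) ` carrier (F (Suc (Suc n))) = {x \<in> carrier (F (Suc n)). d (Suc n) x = \<zero>\<^bsub>F n\<^esub>}"
      "\<And>n. d (Suc n) ` carrier (F (Suc n)) \<subseteq> ideal_smult R \<mm> (F n)"
      using res unfolding minimal_free_resolution_def by auto
    show "\<epsilon> \<in> module_hom R (F 0) M" "\<epsilon> ` carrier (F 0) = carrier M"
      "d 1 \<in> module_hom R (F 1) (F 0)" "d 1 ` carrier (F 1) = {x \<in> carrier (F 0). \<epsilon> x = \<zero>\<^bsub>M\<^esub>}"
      "d 2 ` carrier (F 2) = {x \<in> carrier (F 1). d 1 x = \<zero>\<^bsub>F 0\<^esub>}"
      "d 1 ` carrier (F 1) \<subseteq> ideal_smult R \<mm> (F 0)"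
      "d 2 ` carrier (F 2) \<subseteq> ideal_smult R \<mm> (F 1)"
      using r(1,2,4) r(3)[of 0] r(5)[of 0] r(6)[of 0] r(6)[of 1] by (simp_all add: numeral_2_eq_2)
  qed
  obtain p \<alpha> where \<alpha>: "\<alpha> \<in> module_hom R (free_module R {..<p::nat}) (F 0)"
      "bij_betw \<alpha> (carrier (free_module R {..<p})) (carrier (F 0))"
    using ff[of 0] unfolding finite_free_module_def modules_isomorphic_def by blast
  obtain q \<beta> where \<beta>: "\<beta> \<in> module_hom R (free_module R {..<q::nat}) (F 1)"
      "bij_betw \<beta> (carrier (free_module R {..<q})) (carrier (F 1))"
    using ff[of 1] unfolding finite_free_module_def modules_isomorphic_def by blast
  obtain h where h\<Omega>: "h \<in> module_hom R M \<Omega>" and hbij: "bij_betw h (carrier M) (carrier \<Omega>)"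
    using assms(8) unfolding modules_isomorphic_def by blast
  let ?P = "free_module R {..<p}" and ?Q = "free_module R {..<q}"
  interpret P: module R ?P by (rule free_module_is_module)
  interpret Q: module R ?Q by (rule free_module_is_module)
  define \<alpha>' \<beta>' where "\<alpha>' = inv_into (carrier ?P) \<alpha>" and "\<beta>' = inv_into (carrier ?Q) \<beta>"
  have \<alpha>': "\<alpha>' \<in> module_hom R (F 0) ?P" unfolding \<alpha>'_def by (rule module_iso_inverse[OF P.module_axioms \<alpha>])
  have \<beta>': "\<beta>' \<in> module_hom R (F 1) ?Q" unfolding \<beta>'_def by (rule module_iso_inverse[OF Q.module_axioms \<beta>])
  have \<alpha>im: "\<alpha> ` carrier ?P = carrier (F 0)" and \<beta>im: "\<beta> ` carrier ?Q = carrier (F 1)"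
    using \<alpha>(2) \<beta>(2) by (auto simp: bij_betw_def)
  have \<alpha>'\<alpha>: "\<alpha>' (\<alpha> v) = v" if "v \<in> carrier ?P" for v
    using \<alpha>(2) that by (simp add: \<alpha>'_def bij_betw_def)
  have \<alpha>\<alpha>': "\<alpha> (\<alpha>' y) = y" if "y \<in> carrier (F 0)" for y
    using \<alpha>im that by (simp add: \<alpha>'_def f_inv_into_f)
  have \<beta>'\<beta>: "\<beta>' (\<beta> v) = v" if "v \<in> carrier ?Q" for v
    using \<beta>(2) that by (simp add: \<beta>'_def bij_betw_def)
  have \<beta>\<beta>': "\<beta> (\<beta>' y) = y" if "y \<in> carrier (F 1)" for y
    using \<beta>im that by (simp add: \<beta>'_def f_inv_into_f)
  have him: "h ` carrier M = {x \<in> carrier (F 1). d 1 x = \<zero>\<^bsub>F 0\<^esub>}"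
    using hbij kerd1 by (simp add: \<Omega> bij_betw_def)
  have hm: "h ` carrier M \<subseteq> ideal_smult R \<mm> (F 1)" using hbij min2 by (simp add: \<Omega> bij_betw_def)
  \<comment> \<open>\<open>\<Omega>\<close> and \<open>F 1\<close> differ only in their carriers, so
    \<open>h\<close> can be read as a map into \<open>F 1\<close> with image the kernel of
    \<open>d 1\<close>.\<close>
  have h: "h \<in> module_hom R M (F 1)"
  proof (rule module_homI)
    show "h x \<in> carrier (F 1)" if "x \<in> carrier M" for x using him that by blast
  qed (use module_homD(2,3)[OF h\<Omega>] in \<open>auto simp: \<Omega>\<close>)
  have hinj: "h x = \<zero>\<^bsub>F 1\<^esub> \<longleftrightarrow> x = \<zero>\<^bsub>M\<^esub>" if "x \<in> carrier M" for x
  proof -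
    have "h \<zero>\<^bsub>M\<^esub> = \<zero>\<^bsub>F 1\<^esub>" by (rule module_hom_zero[OF assms(4) F1.module_axioms h])
    moreover have "inj_on h (carrier M)" using hbij by (simp add: bij_betw_def)
    ultimately show ?thesis using that M.zero_closed by (metis inj_onD)
  qed
  \<comment> \<open>The resolution is closed up into a loop: \<open>A\<close> is \<open>d 1\<close>
    in coordinates, while \<open>B\<close> runs from \<open>?P\<close> onto \<open>M\<close> and
    then by \<open>h\<close> onto the kernel of \<open>d 1\<close> inside
    \<open>F 1\<close>.\<close>
  define A where "A v = \<alpha>' (d 1 (\<beta> v))" for v
  define \<eta> where "\<eta> v = \<epsilon> (\<alpha> v)" for v
  define B where "B v = \<beta>' (h (\<eta> v))" for v
  have \<eta>: "\<eta> \<in> module_hom R ?P M" unfolding \<eta>_def by (rule module_hom_comp[OF \<alpha>(1) \<epsilon>(1)])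
  have A: "A \<in> module_hom R ?Q ?P"
    unfolding A_def by (rule module_hom_comp[OF module_hom_comp[OF \<beta>(1) d1] \<alpha>'])
  have B: "B \<in> module_hom R ?P ?Q"
    unfolding B_def by (rule module_hom_comp[OF module_hom_comp[OF \<eta> h] \<beta>'])
  have \<eta>im: "\<eta> ` carrier ?P = carrier M"
    using \<epsilon>(2) \<alpha>im unfolding \<eta>_def by (metis image_image)
  have \<alpha>'_zero: "\<alpha>' y = \<zero>\<^bsub>?P\<^esub> \<longleftrightarrow> y = \<zero>\<^bsub>F 0\<^esub>" if "y \<in> carrier (F 0)" for y
    using \<alpha>\<alpha>'[OF that] module_hom_zero[OF P.module_axioms F0.module_axioms \<alpha>(1)]
      module_hom_zero[OF F0.module_axioms P.module_axioms \<alpha>'] by metis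
  have \<beta>'_zero: "\<beta>' y = \<zero>\<^bsub>?Q\<^esub> \<longleftrightarrow> y = \<zero>\<^bsub>F 1\<^esub>" if "y \<in> carrier (F 1)" for y
    using \<beta>\<beta>'[OF that] module_hom_zero[OF Q.module_axioms F1.module_axioms \<beta>(1)]
      module_hom_zero[OF F1.module_axioms Q.module_axioms \<beta>'] by metis
  have Aim: "A ` carrier ?Q = \<alpha>' ` (d 1 ` carrier (F 1))"
    unfolding \<beta>im[symmetric] by (auto simp: A_def image_image)
  have Bim: "B ` carrier ?P = \<beta>' ` (h ` carrier M)"
    unfolding \<eta>im[symmetric] by (auto simp: B_def image_image)
  have ker\<eta>: "{v \<in> carrier ?P. \<eta> v = \<zero>\<^bsub>M\<^esub>} = A ` carrier ?Q"
  proof (intro equalityI subsetI)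
    fix v assume "v \<in> {v \<in> carrier ?P. \<eta> v = \<zero>\<^bsub>M\<^esub>}"
    then have v: "v \<in> carrier ?P" "\<epsilon> (\<alpha> v) = \<zero>\<^bsub>M\<^esub>" by (auto simp: \<eta>_def)
    then have "\<alpha> v \<in> d 1 ` carrier (F 1)" using ker\<epsilon> module_homD(1)[OF \<alpha>(1) v(1)] by blast
    then have "\<alpha>' (\<alpha> v) \<in> A ` carrier ?Q" unfolding Aim by (rule imageI)
    then show "v \<in> A ` carrier ?Q" using \<alpha>'\<alpha>[OF v(1)] by simp
  next
    fix v assume "v \<in> A ` carrier ?Q"
    then obtain y where y: "y \<in> d 1 ` carrier (F 1)" "v = \<alpha>' y" unfolding Aim by blast
    then have y0: "y \<in> carrier (F 0)" "\<epsilon> y = \<zero>\<^bsub>M\<^esub>" using ker\<epsilon> by auto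
    then show "v \<in> {v \<in> carrier ?P. \<eta> v = \<zero>\<^bsub>M\<^esub>}"
      using module_homD(1)[OF \<alpha>' y0(1)] \<alpha>\<alpha>'[OF y0(1)] y(2) by (simp add: \<eta>_def del: free_module_simps)
  qed
  have kerA: "{v \<in> carrier ?Q. A v = \<zero>\<^bsub>?P\<^esub>} = B ` carrier ?P"
  proof (intro equalityI subsetI)
    fix v assume "v \<in> {v \<in> carrier ?Q. A v = \<zero>\<^bsub>?P\<^esub>}"
    then have v: "v \<in> carrier ?Q" "A v = \<zero>\<^bsub>?P\<^esub>" by blast+
    have \<beta>v: "\<beta> v \<in> carrier (F 1)" by (rule module_homD(1)[OF \<beta>(1) v(1)])
    have "d 1 (\<beta> v) = \<zero>\<^bsub>F 0\<^esub>"
      using v(2) \<alpha>'_zero[OF module_homD(1)[OF d1 \<beta>v]] unfolding A_def by blast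
    then have "\<beta> v \<in> h ` carrier M" using him \<beta>v by blast
    then have "\<beta>' (\<beta> v) \<in> B ` carrier ?P" unfolding Bim by (rule imageI)
    then show "v \<in> B ` carrier ?P" using \<beta>'\<beta>[OF v(1)] by simp
  next
    fix v assume "v \<in> B ` carrier ?P"
    then obtain y where y: "y \<in> h ` carrier M" "v = \<beta>' y" unfolding Bim by blast
    then have y1: "y \<in> carrier (F 1)" "d 1 y = \<zero>\<^bsub>F 0\<^esub>" using him by auto
    then have "A v = \<zero>\<^bsub>?P\<^esub>"
      unfolding A_def y(2) \<beta>\<beta>'[OF y1(1)] using module_hom_zero[OF F0.module_axioms P.module_axioms \<alpha>'] by metis
    then show "v \<in> {v \<in> carrier ?Q. A v = \<zero>\<^bsub>?P\<^esub>}"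
      using module_homD(1)[OF \<beta>' y1(1)] y(2) by blast
  qed
  \<comment> \<open>As \<open>h\<close> and the coordinate map \<open>\<beta>'\<close> are
    injective, \<open>B\<close> has the same kernel as \<open>\<eta>\<close>.\<close>
  have kerB: "{v \<in> carrier ?P. B v = \<zero>\<^bsub>?Q\<^esub>} = A ` carrier ?Q"
  proof -
    have "B v = \<zero>\<^bsub>?Q\<^esub> \<longleftrightarrow> \<eta> v = \<zero>\<^bsub>M\<^esub>" if v: "v \<in> carrier ?P" for v
    proof -
      have m: "\<eta> v \<in> carrier M" by (rule module_homD(1)[OF \<eta> v])
      show ?thesis unfolding B_def using \<beta>'_zero[OF module_homD(1)[OF h m]] hinj[OF m] by blast
    qed
    then show ?thesis unfolding ker\<eta>[symmetric] by blast
  qed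
  have pq: "q = p" using exact_pair_card_eq[OF _ _ A B kerA kerB] by simp
  have Am: "A ` carrier ?Q \<subseteq> ideal_power \<mm> {..<p}"
    unfolding Aim using ideal_smult_coordinates[OF mm.is_ideal F0.module_axioms \<alpha>'] min1 by blast
  \<comment> \<open>The image of \<open>h\<close> is the image of \<open>d 2\<close>, so it is
    minimality in the second step of the resolution that bounds \<open>B\<close>.\<close>
  have Bm: "B ` carrier ?P \<subseteq> ideal_power \<mm> {..<q}"
    unfolding Bim using ideal_smult_coordinates[OF mm.is_ideal F1.module_axioms \<beta>'] hm by blast
  have "0 < p"
  proof (rule ccontr)
    assume "\<not> 0 < p"
    then have "carrier ?P = {\<zero>\<^bsub>?P\<^esub>}" by auto
    then have "carrier M = {\<zero>\<^bsub>M\<^esub>}"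
      using \<eta>im module_hom_zero[OF P.module_axioms assms(4) \<eta>] by (metis image_empty image_insert)
    then show False using assms(6) by simp
  qed
  moreover have "free_presentation R M p \<eta> A"
    using \<eta> \<eta>im A ker\<eta> assms(4) unfolding pq
    by (intro free_presentation.intro free_presentation_axioms.intro)
  ultimately show ?thesis
    using exact_pair_torsion[OF _ B[unfolded pq] kerA[unfolded pq] kerB[unfolded pq] Am[unfolded pq] Bm[unfolded pq]]
    by blast
qed

end
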